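(* Let $N$ be a norm on $\mathbb{R}^2$ such that the restriction of $N$ to $\mathbb{R}^2\setminus\{0\}$ is of class $C^{2,\delta}$ for some $\delta>0$ and the unit circle $\partial B_N(0,1)$ has strictly positive curvature. For $v\in\mathbb{S}^1$ let $P_v:\mathbb{R}^2\to H_v$ be the closest-point projection onto $H_v$ with respect to $N$. Let $A\subset\mathbb{R}^2$ be a Borel set and let $s:=\dim A$. Then the following hold: (1) If $s>1$, then (1.a) $\mathcal{H}^1(P_v(A))>0$ for $\mathcal{H}^1$-a.e. $v\in\mathbb{S}^1$; (1.b) $\dim\{v\in\mathbb{S}^1:\mathcal{H}^1(P_v(A))=0\}\le 2-\min\{s,1+\delta\}$. (2) If $s\le 1$, then (2.a) $\dim(P_v(A))=\dim(A)$ for $\mathcal{H}^1$-a.e. $v\in\mathbb{S}^1$; (2.b) $\dim\{v\in\mathbb{S}^1:\dim(P_v(A))<s\}\le s$.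
   Context: $\mathbb{S}^1$ is the Euclidean unit circle in $\mathbb{R}^2$, $\mathcal{H}^s$ is the $s$-dimensional Hausdorff measure and $\dim$ is Hausdorff dimension. $B_N(0,1)=\{x\in\mathbb{R}^2:N(x)\le 1\}$. For $0<\delta\le 1$ and $k\in\mathbb{N}_0$, a map on an open set $U\subset\mathbb{R}^n$ is of class $C^{k,\delta}$ if it is $k$ times continuously differentiable and its partial derivatives of order $k$ are locally $\delta$-H\"older, i.e. for every compact $K\subset U$ there is $M_K$ with $\|D^\alpha f(x)-D^\alpha f(y)\|\le M_K\|x-y\|^\delta$ for all $x,y\in K$ and $|\alpha|=k$. Curvature: under the hypothesis, $\partial B_N(0,1)$ is a simple closed $C^2$ curve; its curvature at $\gamma(t)$ is $\|\ddot\gamma(t)\|$, where $\gamma$ is a parametrization by Euclidean arc-length and $\|\cdot\|$ is the Euclidean norm. Strictly positive curvature implies that $B_N(0,1)$ is strictly convex. For $v\in\mathbb{S}^1$, $H_v:=\{w\in\mathbb{R}^2:v\cdot w=0\}$ (Euclidean scalar product). For a strictly convex norm $N$ the closest-point projection $P_v(x)$ of $x\in\mathbb{R}^2$ is the unique point of $H_v$ with $N(x-P_v(x))=\min\{N(x-q):q\in H_v\}$. *)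

theory Defs
  imports "HOL-Analysis.Analysis"
begin

section \<open>Hausdorff measure and Hausdorff dimension\<close>

text \<open>
  The factor \<open>diam(U)^s\<close>, with the usual conventions \<open>diam({})^s = 0\<close> and
  \<open>diam(U)^0 = 1\<close> for nonempty \<open>U\<close>; the latter needs a separate case since
  \<^term>\<open>0 powr 0 = (0::real)\<close>.
\<close>

definition diam_power :: "real \<Rightarrow> 'a::metric_space set \<Rightarrow> ennreal" where
  "diam_power s U =
     (if U = {} then 0 else if s = 0 then 1 else ennreal (diameter U powr s))"

text \<open>
  Boundedness is required explicitly, because \<^const>\<open>diameter\<close> is real-valued and
  unspecified on unbounded sets.
\<close>

definition fine_covers :: "real \<Rightarrow> 'a::metric_space set \<Rightarrow> (nat \<Rightarrow> 'a set) set" where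
  "fine_covers r A =
     {U. A \<subseteq> (\<Union>i. U i) \<and> (\<forall>i. bounded (U i) \<and> diameter (U i) \<le> r)}"

definition hausdorff_pre_measure :: "real \<Rightarrow> real \<Rightarrow> 'a::metric_space set \<Rightarrow> ennreal" where
  "hausdorff_pre_measure s r A = (INF U\<in>fine_covers r A. \<Sum>i. diam_power s (U i))"

text \<open>
  This is the outer measure, defined on all sets, for \<open>s \<ge> 0\<close>. No dimensional constant
  is included; the usual constant is 1 for \<open>s = 1\<close>, and in general it is irrelevant for
  null sets and for the dimension.
\<close>

definition hausdorff_measure :: "real \<Rightarrow> 'a::metric_space set \<Rightarrow> ennreal" where
  "hausdorff_measure s A = (SUP r\<in>{0<..}. hausdorff_pre_measure s r A)"

definition hausdorff_dim :: "'a::metric_space set \<Rightarrow> ereal" where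
  "hausdorff_dim A = (INF s\<in>{s. 0 \<le> s \<and> hausdorff_measure s A = 0}. ereal s)"

definition hausdorff_ae :: "real \<Rightarrow> 'a::metric_space set \<Rightarrow> ('a \<Rightarrow> bool) \<Rightarrow> bool" where
  "hausdorff_ae s S Q \<longleftrightarrow> hausdorff_measure s {x\<in>S. \<not> Q x} = 0"


section \<open>Differentiability classes\<close>

text \<open>
  This is the partial derivative in direction \<open>b\<close> at every point where \<open>f\<close> is
  differentiable; it is only used at such points.
\<close>

definition partial_deriv ::
    "'a::euclidean_space \<Rightarrow> ('a \<Rightarrow> 'b::real_normed_vector) \<Rightarrow> 'a \<Rightarrow> 'b" where
  "partial_deriv b f x = frechet_derivative f (at x) b"

text \<open>
  A list \<open>bs\<close> of basis vectors plays the role of a multi-index of order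
  \<^term>\<open>length bs\<close>. All orderings of the directions are considered, which makes no
  difference by the symmetry of continuous mixed partial derivatives.
\<close>

definition iter_partial_deriv ::
    "'a::euclidean_space list \<Rightarrow> ('a \<Rightarrow> 'b::real_normed_vector) \<Rightarrow> 'a \<Rightarrow> 'b" where
  "iter_partial_deriv bs f = foldr partial_deriv bs f"

definition C_k_on ::
    "nat \<Rightarrow> ('a::euclidean_space \<Rightarrow> 'b::real_normed_vector) \<Rightarrow> 'a set \<Rightarrow> bool" where
  "C_k_on k f U \<longleftrightarrow> open U \<and>
     (\<forall>bs. set bs \<subseteq> Basis \<and> length bs < k \<longrightarrow>
        (\<forall>x\<in>U. iter_partial_deriv bs f differentiable at x)) \<and>
     (\<forall>bs. set bs \<subseteq> Basis \<and> length bs \<le> k \<longrightarrow> continuous_on U (iter_partial_deriv bs f))"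

definition locally_holder_on ::
    "real \<Rightarrow> ('a::euclidean_space \<Rightarrow> 'b::real_normed_vector) \<Rightarrow> 'a set \<Rightarrow> bool" where
  "locally_holder_on \<delta> f U \<longleftrightarrow>
     (\<forall>K. compact K \<and> K \<subseteq> U \<longrightarrow>
        (\<exists>M. \<forall>x\<in>K. \<forall>y\<in>K. norm (f x - f y) \<le> M * norm (x - y) powr \<delta>))"

definition C_k_holder_on ::
    "nat \<Rightarrow> real \<Rightarrow> ('a::euclidean_space \<Rightarrow> 'b::real_normed_vector) \<Rightarrow> 'a set \<Rightarrow> bool" where
  "C_k_holder_on k \<delta> f U \<longleftrightarrow> C_k_on k f U \<and>
     (\<forall>bs. set bs \<subseteq> Basis \<and> length bs = k \<longrightarrow>
        locally_holder_on \<delta> (iter_partial_deriv bs f) U)"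


section \<open>Curvature of simple closed plane curves\<close>

text \<open>
  \<open>\<gamma>\<close> is an \<open>L\<close>-periodic \<open>C\<^sup>2\<close> parametrization by Euclidean arc-length of the simple
  closed curve \<open>C\<close>, where \<open>L\<close> is the length of \<open>C\<close>.
\<close>

definition arclength_parametrization ::
    "(real \<Rightarrow> real^2) \<Rightarrow> real \<Rightarrow> (real^2) set \<Rightarrow> bool" where
  "arclength_parametrization \<gamma> L C \<longleftrightarrow>
     0 < L \<and> C_k_on 2 \<gamma> UNIV \<and>
     (\<forall>t. norm (vector_derivative \<gamma> (at t)) = 1) \<and>
     (\<forall>t. \<gamma> (t + L) = \<gamma> t) \<and> inj_on \<gamma> {0..<L} \<and> \<gamma> ` {0..<L} = C"

text \<open>The curvature at \<open>\<gamma> t\<close>, when \<open>\<gamma>\<close> is a parametrization by arc-length.\<close>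

definition curvature :: "(real \<Rightarrow> real^2) \<Rightarrow> real \<Rightarrow> real" where
  "curvature \<gamma> t = norm (vector_derivative (\<lambda>u. vector_derivative \<gamma> (at u)) (at t))"

text \<open>
  Parametrizations by arc-length of the same curve differ only by a shift and a change of
  orientation, so the choice of \<open>\<gamma>\<close> does not matter.
\<close>

definition strictly_positive_curvature :: "(real^2) set \<Rightarrow> bool" where
  "strictly_positive_curvature C \<longleftrightarrow>
     (\<exists>\<gamma> L. arclength_parametrization \<gamma> L C \<and> (\<forall>t. 0 < curvature \<gamma> t))"


section \<open>Norms and closest-point projections\<close>

definition is_norm :: "('a::real_vector \<Rightarrow> real) \<Rightarrow> bool" where
  "is_norm N \<longleftrightarrow>
     (\<forall>x. 0 \<le> N x) \<and> (\<forall>x. N x = 0 \<longleftrightarrow> x = 0) \<and>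
     (\<forall>c x. N (c *\<^sub>R x) = \<bar>c\<bar> * N x) \<and> (\<forall>x y. N (x + y) \<le> N x + N y)"

definition unit_ball :: "('a \<Rightarrow> real) \<Rightarrow> 'a set" where
  "unit_ball N = {x. N x \<le> 1}"

definition orth_line :: "real^2 \<Rightarrow> (real^2) set" where
  "orth_line v = {w. v \<bullet> w = 0}"

text \<open>The minimizer is unique if \<open>N\<close> is a strictly convex norm.\<close>

definition norm_proj :: "(real^2 \<Rightarrow> real) \<Rightarrow> real^2 \<Rightarrow> real^2 \<Rightarrow> real^2" where
  "norm_proj N v x =
     (THE p. p \<in> orth_line v \<and> (\<forall>q\<in>orth_line v. N (x - p) \<le> N (x - q)))"

end

theory Submission
  imports Defs "HOL-Probability.Probability"
begin

text \<open>
  Let \<open>u\<close> be the point of the unit circle of \<open>N\<close> that maximizes \<open>v \<bullet> u\<close>. Then \<open>P\<^sub>v\<close> is the linear projection onto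
  \<open>H\<^sub>v\<close> with kernel spanned by \<open>u\<close>, so \<open>P\<^sub>v(A)\<close> is a bi-Lipschitz image of a Euclidean projection of \<open>A\<close>, and \<open>v\<close> is
  the normalized gradient of \<open>N\<close> at \<open>u\<close>. The gradient is \<open>C\<^sup>1\<close>, hence \<open>v\<close> is a Lipschitz function of the direction
  of \<open>u\<close>, and the exceptional sets are Lipschitz images of those for Euclidean projections. For these the
  classical bounds of Kaufman (\<open>dim \<le> t\<close> for the directions whose projection has dimension less than \<open>t\<close>)
  and Falconer (\<open>dim \<le> 2 - s\<close> for the directions with null projection) imply all four claims.

  Both bounds are proved by comparing finitely supported Frostman weights on the set and on the exceptional
  directions at a finite dyadic scale \<open>2^-m\<close>, uniformly in \<open>m\<close>. The passage to the limit only uses that dyadic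
  Hausdorff content is continuous along increasing sequences of arbitrary sets. The same fact gives, by Choquet's
  argument, compact subsets of positive content of a Borel set.
\<close>

section \<open>Dyadic cells and net content\<close>

text \<open>The classical proofs put a Frostman measure on the set of exceptional directions, and
  this requires knowing that set to be measurable. Net content avoids the question because two
  dyadic cells are nested or disjoint. Hence the coarsest cells of a family form a disjoint
  subfamily with the same union. This yields strong subadditivity, the source of continuity along
  increasing sequences, and a finite Frostman lemma in which the mass on a disjoint family of tight
  cells equals the cost of a cover. Both estimates take the form
  \<open>(sum w P)\<^sup>2 * sum \<nu> Q \<le> C * e\<close>, where \<open>e\<close> bounds the cost
  of covers of the projections. The mass of \<open>w\<close> stays bounded below, so
  \<open>e\<close> tending to 0 leaves no content for the exceptional slopes. Slopes replace angles:
  the kernel of \<open>lproj b\<close> is spanned by \<open>(-b, 1)\<close>, and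
  \<open>lproj b z\<close> is affine in \<open>b\<close>. The slopes that make it small thus form an
  interval, which Kaufman's argument uses, and the frequencies of a projection are the points
  \<open>(r, b * r)\<close> of a line, which Falconer's argument uses.\<close>

abbreviation l1 :: "'a::euclidean_space \<Rightarrow> real" where
  "l1 x \<equiv> \<Sum>b\<in>Basis. \<bar>x \<bullet> b\<bar>"

text \<open>The half-open dyadic cube of side \<open>(1/2) ^ k\<close> through \<open>x\<close>.
  Naming a cube by any of its points turns nestedness into a statement about a single point.\<close>

definition cell :: "nat \<Rightarrow> 'a::euclidean_space \<Rightarrow> 'a set" where
  "cell k x = {y. \<forall>b\<in>Basis. \<lfloor>2 ^ k * (y \<bullet> b)\<rfloor> = \<lfloor>2 ^ k * (x \<bullet> b)\<rfloor>}"

lemma cell_self [simp]: "x \<in> cell k x"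
  by (simp add: cell_def)

lemma cell_eq: "y \<in> cell k x \<Longrightarrow> cell k y = cell k x"
  by (auto simp: cell_def)

lemma cell_sym: "y \<in> cell k x \<longleftrightarrow> x \<in> cell k y"
  by (auto simp: cell_def)

lemma floor_pow2_div:
  fixes u :: real
  assumes "k \<le> l"
  shows "\<lfloor>2 ^ k * u\<rfloor> = \<lfloor>2 ^ l * u\<rfloor> div 2 ^ (l - k)"
proof -
  have "2 ^ k * u = (2 ^ l * u) / real_of_int (2 ^ (l - k))"
    using assms by (simp add: field_simps flip: power_add)
  then show ?thesis
    using floor_divide_real_eq_div[of "2 ^ (l - k)" "2 ^ l * u"] by simp
qed

lemma cell_mono:
  assumes "k \<le> l"
  shows "cell l x \<subseteq> cell k x"
  using floor_pow2_div[OF assms] by (auto simp: cell_def)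

lemma cell_inner_diff_less:
  assumes "y \<in> cell k x" "z \<in> cell k x" "b \<in> Basis"
  shows "\<bar>(y - z) \<bullet> b\<bar> < (1/2) ^ k"
proof -
  have "\<lfloor>2 ^ k * (y \<bullet> b)\<rfloor> = \<lfloor>2 ^ k * (z \<bullet> b)\<rfloor>"
    using assms by (auto simp: cell_def)
  then have "\<bar>2 ^ k * (y \<bullet> b) - 2 ^ k * (z \<bullet> b)\<bar> < 1"
    by linarith
  then have "2 ^ k * \<bar>(y - z) \<bullet> b\<bar> < 1"
    by (simp add: inner_diff_left abs_mult flip: right_diff_distrib)
  then show ?thesis
    by (simp add: field_simps power_divide)
qed

lemma cell_norm_diff_le:
  fixes x :: "'a::euclidean_space"
  assumes "y \<in> cell k x" "z \<in> cell k x"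
  shows "norm (y - z) \<le> real DIM('a) * (1/2) ^ k"
proof -
  have "norm (y - z) \<le> (\<Sum>b\<in>Basis. \<bar>(y - z) \<bullet> b\<bar>)"
    by (rule norm_le_l1)
  also have "\<dots> \<le> (\<Sum>b\<in>(Basis::'a set). (1/2) ^ k)"
    using cell_inner_diff_less[OF assms] by (intro sum_mono) (auto intro: less_imp_le)
  finally show ?thesis by simp
qed

text \<open>A cell is determined by the integer vector of its floors, so counting cells means
  counting integer vectors.\<close>

lemma cell_image_finite:
  fixes S :: "'a::euclidean_space set"
  assumes "\<And>x b. x \<in> S \<Longrightarrow> b \<in> Basis \<Longrightarrow> \<lfloor>2 ^ k * (x \<bullet> b)\<rfloor> \<in> Z b" "\<And>b. finite (Z b)"
  shows "finite (cell k ` S)" "card (cell k ` S) \<le> (\<Prod>b\<in>(Basis::'a set). card (Z b))"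
proof -
  let ?F = "PiE (Basis::'a set) Z"
  let ?g = "\<lambda>f. {y::'a. \<forall>b\<in>Basis. \<lfloor>2 ^ k * (y \<bullet> b)\<rfloor> = f b}"
  have sub: "cell k ` S \<subseteq> ?g ` ?F"
  proof (intro image_subsetI image_eqI)
    fix x assume "x \<in> S"
    then show "(\<lambda>b\<in>Basis. \<lfloor>2 ^ k * (x \<bullet> b)\<rfloor>) \<in> ?F" using assms by simp
  qed (auto simp: cell_def)
  have fF: "finite ?F" using assms by (intro finite_PiE) auto
  then have fin: "finite (?g ` ?F)" by (rule finite_imageI)
  show "finite (cell k ` S)" using finite_subset[OF sub fin] .
  have "card (cell k ` S) \<le> card (?g ` ?F)" using fin sub by (rule card_mono)
  also have "\<dots> \<le> card ?F" using fF by (rule card_image_le)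
  finally show "card (cell k ` S) \<le> (\<Prod>b\<in>(Basis::'a set). card (Z b))" by (simp add: card_PiE)
qed

text \<open>The level is carried as a tag, so that a cost is read off \<open>fst\<close> without
  recovering the side length from the set.\<close>

definition cells :: "(nat \<times> 'a::euclidean_space set) set" where
  "cells = {(k, cell k x) |k x. True}"

lemma countable_cells: "countable (cells :: (nat \<times> 'a::euclidean_space set) set)"
proof -
  let ?F = "PiE (Basis::'a set) (\<lambda>_. UNIV :: int set)"
  let ?g = "\<lambda>(k, f). (k, {y::'a. \<forall>b\<in>Basis. \<lfloor>2 ^ k * (y \<bullet> b)\<rfloor> = f b})"
  have "countable (UNIV \<times> ?F :: (nat \<times> ('a \<Rightarrow> int)) set)"
    by (intro countable_SIGMA countable_PiE) auto
  moreover have "cells \<subseteq> ?g ` (UNIV \<times> ?F)"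
  proof
    fix p :: "nat \<times> 'a set" assume "p \<in> cells"
    then obtain k x where p: "p = (k, cell k x)" by (auto simp: cells_def)
    have "p = ?g (k, \<lambda>b\<in>Basis. \<lfloor>2 ^ k * (x \<bullet> b)\<rfloor>)"
      by (auto simp: p cell_def)
    then show "p \<in> ?g ` (UNIV \<times> ?F)" by (rule image_eqI) simp
  qed
  ultimately show ?thesis
    by (rule countable_subset[OF _ countable_image, rotated])
qed

lemma cells_eqI:
  assumes "(k, Q) \<in> cells" "x \<in> Q"
  shows "Q = cell k x"
  using assms cell_eq by (auto simp: cells_def)

text \<open>The power \<open>t\<close> of the side length \<open>(1/2) ^ k\<close>, see
  \<open>weight_eq\<close>, written as a geometric sequence in \<open>k\<close> so that sums over
  levels are geometric series.\<close>

definition weight :: "real \<Rightarrow> nat \<Rightarrow> real" where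
  "weight t k = (2 powr (- t)) ^ k"

lemma weight_pos [simp]: "0 < weight t k" "0 \<le> weight t k" "weight t k \<noteq> 0"
  by (auto simp: weight_def)

text \<open>As an integral against counting measure, the cost can be exchanged with series and is
  subject to Fatou's lemma.\<close>

definition cost :: "real \<Rightarrow> (nat \<times> 'a set) set \<Rightarrow> ennreal" where
  "cost t U = (\<integral>\<^sup>+p. ennreal (weight t (fst p)) \<partial>count_space U)"

definition cover_of :: "'a::euclidean_space set \<Rightarrow> (nat \<times> 'a set) set set" where
  "cover_of E = {U. U \<subseteq> cells \<and> E \<subseteq> \<Union>(snd ` U)}"

definition net_content :: "real \<Rightarrow> 'a::euclidean_space set \<Rightarrow> ennreal" where
  "net_content t E = (INF U\<in>cover_of E. cost t U)"

section \<open>Additivity of the cost\<close>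

lemma cost_alt: "cost t U = (\<integral>\<^sup>+p. ennreal (weight t (fst p)) * indicator U p \<partial>count_space UNIV)"
  unfolding cost_def by (simp add: nn_integral_count_space_indicator)

lemma cost_Un_Int: "cost t (U \<union> V) + cost t (U \<inter> V) = cost t U + cost t V"
  unfolding cost_alt
  by (simp add: nn_integral_add[symmetric] distrib_left[symmetric] del: nn_integral_indicator_singleton)
     (auto intro!: nn_integral_cong simp: indicator_def)

lemma cost_empty [simp]: "cost t {} = 0"
  by (simp add: cost_alt)

lemma cost_disjoint: "U \<inter> V = {} \<Longrightarrow> cost t (U \<union> V) = cost t U + cost t V"
  using cost_Un_Int[of t U V] by simp

lemma cost_Un_le: "cost t (U \<union> V) \<le> cost t U + cost t V"
  using cost_Un_Int[of t U V] by (metis add.right_neutral add_left_mono zero_le)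

lemma cost_finite: "finite U \<Longrightarrow> cost t U = ennreal (\<Sum>p\<in>U. weight t (fst p))"
  unfolding cost_def by (simp add: nn_integral_count_space_finite)

lemma cost_UN_le: "cost t (\<Union>i. U i) \<le> (\<Sum>i. cost t (U i))"
proof -
  have "cost t (\<Union>i. U i) \<le> (\<integral>\<^sup>+p. (\<Sum>i. ennreal (weight t (fst p)) * indicator (U i) p) \<partial>count_space UNIV)"
    unfolding cost_alt
  proof (intro nn_integral_mono)
    fix p
    show "ennreal (weight t (fst p)) * indicator (\<Union>i. U i) p
            \<le> (\<Sum>i. ennreal (weight t (fst p)) * indicator (U i) p)"
    proof (cases "p \<in> (\<Union>i. U i)")
      case True
      then obtain i where i: "p \<in> U i" by auto
      have "ennreal (weight t (fst p)) * indicator (\<Union>i. U i) p = (\<Sum>j\<in>{i}. ennreal (weight t (fst p)) * indicator (U j) p)"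
        using i True by simp
      also have "\<dots> \<le> (\<Sum>i. ennreal (weight t (fst p)) * indicator (U i) p)"
        by (rule sum_le_suminf) auto
      finally show ?thesis .
    qed simp
  qed
  also have "\<dots> = (\<Sum>i. cost t (U i))"
    unfolding cost_alt by (subst nn_integral_suminf) auto
  finally show ?thesis .
qed

lemma net_content_le: "U \<in> cover_of E \<Longrightarrow> net_content t E \<le> cost t U"
  unfolding net_content_def by (rule INF_lower)

lemma net_content_mono: "E \<subseteq> F \<Longrightarrow> net_content t E \<le> net_content t F"
  unfolding net_content_def by (rule INF_superset_mono) (auto simp: cover_of_def)

lemma net_content_less_cover:
  assumes "net_content t E < c"
  obtains U where "U \<in> cover_of E" "cost t U < c"
  using assms unfolding net_content_def INF_less_iff by blast

lemma net_content_UN_null: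
  assumes "\<And>i::nat. net_content t (E i) = 0"
  shows "net_content t (\<Union>i. E i) = 0"
proof -
  have "net_content t (\<Union>i. E i) \<le> ennreal e" if e: "0 < e" for e :: real
  proof -
    have "\<exists>U. U \<in> cover_of (E i) \<and> cost t U < ennreal (e * (1/2) ^ Suc i)" for i
      by (rule net_content_less_cover[of t "E i"]) (use assms e in \<open>auto simp: ennreal_zero_less_mult_iff\<close>)
    then obtain U where U: "\<And>i. U i \<in> cover_of (E i)" "\<And>i. cost t (U i) < ennreal (e * (1/2) ^ Suc i)"
      by metis
    have "(\<Union>i. U i) \<in> cover_of (\<Union>i. E i)"
      using U(1) unfolding cover_of_def by blast
    then have "net_content t (\<Union>i. E i) \<le> (\<Sum>i. cost t (U i))"
      using net_content_le cost_UN_le order_trans by blast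
    also have "\<dots> \<le> (\<Sum>i. ennreal (e * (1/2) ^ Suc i))"
      using U(2) by (intro suminf_le) (auto intro: less_imp_le)
    also have "\<dots> = ennreal e"
      using sums_mult[OF power_half_series, of e] e by (intro suminf_ennreal_eq) auto
    finally show ?thesis .
  qed
  then show ?thesis
    by (metis ennreal_le_epsilon le_zero_eq add_0)
qed

text \<open>Cells that meet are nested, so in a family of cells these are the members maximal under
  inclusion.\<close>

definition maximal :: "(nat \<times> 'a set) set \<Rightarrow> (nat \<times> 'a set) set" where
  "maximal U = {p\<in>U. \<forall>q\<in>U. snd p \<inter> snd q \<noteq> {} \<longrightarrow> fst p \<le> fst q}"

lemma maximal_subset: "maximal U \<subseteq> U"
  by (auto simp: maximal_def)

text \<open>Levels are natural numbers, so some member containing \<open>x\<close> is coarsest. A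
  still coarser member meeting it would contain \<open>x\<close> as well.\<close>

lemma maximal_covers:
  assumes "U \<subseteq> cells" "(k, Q) \<in> U" "x \<in> Q"
  obtains l where "l \<le> k" "(l, cell l x) \<in> maximal U"
proof -
  let ?P = "\<lambda>l. (l, cell l x) \<in> U"
  have "Q = cell k x" using assms cells_eqI by blast
  then have Pk: "?P k" using assms by simp
  define l where "l = (LEAST l. ?P l)"
  have l: "?P l" "l \<le> k" using Pk unfolding l_def by (auto intro: LeastI Least_le)
  have "l \<le> j" if jR: "(j, R) \<in> U" "cell l x \<inter> R \<noteq> {}" for j R
  proof (rule ccontr)
    assume "\<not> l \<le> j"
    then have jl: "j < l" by simp
    obtain y where y: "y \<in> cell l x" "y \<in> R" using jR(2) by auto
    then have "R = cell j y" using jR assms(1) cells_eqI by blast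
    moreover have "cell j y = cell j x"
      using y(1) cell_mono[of j l x] jl by (intro cell_eq) auto
    ultimately have "?P j" using jR by simp
    then show False using jl not_less_Least unfolding l_def by blast
  qed
  then have "(l, cell l x) \<in> maximal U"
    using l by (fastforce simp: maximal_def)
  then show ?thesis using that l by blast
qed

lemma maximal_disjoint:
  assumes "U \<subseteq> cells" "p \<in> maximal U" "q \<in> maximal U" "snd p \<inter> snd q \<noteq> {}"
  shows "p = q"
proof -
  obtain x where x: "x \<in> snd p" "x \<in> snd q" using assms(4) by blast
  have U: "p \<in> U" "q \<in> U" using assms(2,3) by (auto simp: maximal_def)
  have "fst p \<le> fst q" using assms(2,4) U by (auto simp: maximal_def)
  moreover have "fst q \<le> fst p" using assms(3,4) U by (auto simp: maximal_def Int_commute)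
  moreover have "snd p = cell (fst p) x"
    by (rule cells_eqI) (use U x assms(1) in auto)
  moreover have "snd q = cell (fst q) x"
    by (rule cells_eqI) (use U x assms(1) in auto)
  ultimately show ?thesis by (simp add: prod_eq_iff)
qed

lemma cover_cell:
  assumes "U \<subseteq> cells" "x \<in> \<Union>(snd ` U)"
  obtains k where "(k, cell k x) \<in> U"
proof -
  obtain p where p: "p \<in> U" "x \<in> snd p" using assms(2) by blast
  have "snd p = cell (fst p) x"
    by (rule cells_eqI) (use p assms(1) in auto)
  then have "(fst p, cell (fst p) x) \<in> U" using p(1) by (metis prod.collapse)
  then show ?thesis using that by blast
qed

lemma finer_not_maximal:
  assumes "k < l" "(k, cell k x) \<in> U"
  shows "(l, cell l x) \<notin> maximal U"
proof -
  have "cell l x \<inter> cell k x \<noteq> {}" using cell_self by blast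
  then show ?thesis using assms unfolding maximal_def by fastforce
qed

text \<open>Strong subadditivity at the level of covers: of two nested cells, the coarser one survives in
  the maximal family and the finer one is left over to cover the intersection.\<close>

lemma cost_maximal_Un:
  assumes "U \<subseteq> cells" "V \<subseteq> cells" "E \<subseteq> \<Union>(snd ` U)" "E \<subseteq> \<Union>(snd ` V)"
  shows "cost t (maximal (U \<union> V)) + net_content t E \<le> cost t U + cost t V"
proof -
  let ?M = "maximal (U \<union> V)"
  let ?W = "(U \<union> V - ?M) \<union> (U \<inter> V)"
  have "E \<subseteq> \<Union>(snd ` ?W)"
  proof
    fix x assume x: "x \<in> E"
    obtain k where k: "(k, cell k x) \<in> U"
      by (rule cover_cell[OF assms(1) subsetD[OF assms(3) x]])
    obtain l where l: "(l, cell l x) \<in> V"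
      by (rule cover_cell[OF assms(2) subsetD[OF assms(4) x]])
    note kl = k l
    consider "k = l" | "k < l" | "l < k" by linarith
    then have "\<exists>p\<in>?W. x \<in> snd p"
    proof cases
      case 1
      then have "(k, cell k x) \<in> ?W" using kl by auto
      then show ?thesis by force
    next
      case 2
      then have "(l, cell l x) \<in> ?W" using kl finer_not_maximal[OF 2, of x "U \<union> V"] by blast
      then show ?thesis by force
    next
      case 3
      then have "(k, cell k x) \<in> ?W" using kl finer_not_maximal[OF 3, of x "U \<union> V"] by blast
      then show ?thesis by force
    qed
    then show "x \<in> \<Union>(snd ` ?W)" by auto
  qed
  then have "net_content t E \<le> cost t ?W"
    using assms by (intro net_content_le) (auto simp: cover_of_def)
  also have "\<dots> \<le> cost t (U \<union> V - ?M) + cost t (U \<inter> V)"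
    by (rule cost_Un_le)
  finally have "cost t ?M + net_content t E \<le> (cost t ?M + cost t (U \<union> V - ?M)) + cost t (U \<inter> V)"
    by (simp add: add.assoc add_left_mono)
  also have "cost t ?M + cost t (U \<union> V - ?M) = cost t (U \<union> V)"
  proof -
    have "?M \<union> (U \<union> V - ?M) = U \<union> V" using maximal_subset[of "U \<union> V"] by blast
    then show ?thesis using cost_disjoint[of ?M "U \<union> V - ?M" t] by simp
  qed
  finally show ?thesis by (simp add: cost_Un_Int)
qed

text \<open>Almost optimal covers \<open>U n\<close> are merged successively into
  \<open>V n\<close>, keeping only maximal cells. By \<open>cost_maximal_Un\<close> each merge loses
  only the error \<open>d n\<close> of the new cover, and the errors add up to at most
  \<open>e\<close>.\<close>

lemma net_content_incseq_le:
  fixes E :: "nat \<Rightarrow> 'a::euclidean_space set"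
  assumes inc: "incseq E" and le: "\<And>n. net_content t (E n) \<le> ennreal C"
  shows "net_content t (\<Union>n. E n) \<le> ennreal C"
proof (rule ennreal_le_epsilon)
  fix e :: real assume e: "0 < e"
  define d where "d n = ennreal (e * (1/2) ^ Suc n)" for n
  have fin: "net_content t (E n) < \<top>" for n
    using le[of n] by (simp add: order_le_less_trans)
  have "\<exists>U. U \<in> cover_of (E n) \<and> cost t U < net_content t (E n) + d n" for n
    by (rule net_content_less_cover[of t "E n" "net_content t (E n) + d n"])
       (use fin[of n] e in \<open>auto simp: d_def ennreal_zero_less_mult_iff\<close>)
  then obtain U where U: "\<And>n. U n \<in> cover_of (E n)"
      and cU: "\<And>n. cost t (U n) < net_content t (E n) + d n"
    by metis
  have Ucells: "U n \<subseteq> cells" and Ucov: "E n \<subseteq> \<Union>(snd ` U n)" for n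
    using U by (auto simp: cover_of_def)
  define V where "V = rec_nat (U 0) (\<lambda>n W. maximal (W \<union> U (Suc n)))"
  have V0: "V 0 = U 0" and VS: "V (Suc n) = maximal (V n \<union> U (Suc n))" for n
    by (auto simp: V_def)
  have Vcells: "V n \<subseteq> cells" for n
  proof (induction n)
    case 0
    show ?case using Ucells by (simp add: V0)
  next
    case (Suc n)
    then show ?case using Ucells[of "Suc n"] maximal_subset[of "V n \<union> U (Suc n)"] unfolding VS by blast
  qed
  have cell_up: "\<exists>l\<le>k. (l, cell l x) \<in> V (Suc n)" if "(k, cell k x) \<in> V n \<union> U (Suc n)" for n k x
    using maximal_covers[of "V n \<union> U (Suc n)" k "cell k x" x] that Vcells[of n] Ucells[of "Suc n"]
    unfolding VS by (metis cell_self le_sup_iff)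
  have Vcov: "E n \<subseteq> \<Union>(snd ` V n)" for n
  proof (cases n)
    case 0 show ?thesis unfolding 0 V0 by (rule Ucov)
  next
    case (Suc m)
    show ?thesis
    proof
      fix x assume "x \<in> E n"
      then have "x \<in> \<Union>(snd ` U n)" using Ucov by (rule rev_subsetD)
      then obtain k where "(k, cell k x) \<in> U n" by (rule cover_cell[OF Ucells])
      then have "\<exists>l\<le>k. (l, cell l x) \<in> V n" unfolding Suc by (intro cell_up) simp
      then obtain l where "(l, cell l x) \<in> V n" by blast
      then show "x \<in> \<Union>(snd ` V n)" by force
    qed
  qed
  have costV: "cost t (V n) \<le> net_content t (E n) + (\<Sum>i\<le>n. d i)" for n
  proof (induction n)
    case 0
    then show ?case using cU[of 0] by (simp add: V0)
  next
    case (Suc n)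
    have "cost t (V (Suc n)) + net_content t (E n) \<le> cost t (V n) + cost t (U (Suc n))"
      unfolding VS using incseq_SucD[OF inc, of n] Ucov[of "Suc n"]
      by (intro cost_maximal_Un Vcells Ucells Vcov) (rule order_trans)
    also have "\<dots> \<le> (net_content t (E n) + (\<Sum>i\<le>n. d i)) + (net_content t (E (Suc n)) + d (Suc n))"
      using Suc cU[of "Suc n"] by (intro add_mono) auto
    finally have "net_content t (E n) + cost t (V (Suc n)) \<le> net_content t (E n) + (net_content t (E (Suc n)) + (\<Sum>i\<le>Suc n. d i))"
      by (simp add: algebra_simps)
    \<comment> \<open>The content of \<open>E n\<close> is finite, so it can be cancelled on both
      sides.\<close>
    then show ?case
      using fin[of n] by (auto simp: ennreal_add_left_cancel_le algebra_simps)
  qed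
  have sumd: "(\<Sum>i\<le>n. d i) \<le> ennreal e" for n
  proof -
    have "(\<Sum>i\<le>n. d i) \<le> (\<Sum>i. d i)"
      by (intro sum_le_suminf) auto
    also have "\<dots> = ennreal e"
      unfolding d_def using sums_mult[OF power_half_series, of e] e by (intro suminf_ennreal_eq) auto
    finally show ?thesis .
  qed
  \<comment> \<open>The cell of \<open>V n\<close> containing a given point only gets coarser with \<open>n\<close>, hence it stabilizes.\<close>
  define W where "W = {p. \<forall>\<^sub>F n in sequentially. p \<in> V n}"
  have Wcells: "W \<subseteq> cells"
  proof
    fix p assume "p \<in> W"
    then obtain n where "p \<in> V n"
      unfolding W_def using eventually_happens' sequentially_bot by blast
    then show "p \<in> cells" using Vcells by blast
  qed
  have Wcov: "(\<Union>n. E n) \<subseteq> \<Union>(snd ` W)"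
  proof
    fix x assume "x \<in> (\<Union>n. E n)"
    then obtain n where n: "x \<in> E n" by auto
    define L where "L = {l. \<exists>m\<ge>n. (l, cell l x) \<in> V m}"
    have "x \<in> \<Union>(snd ` V n)" using n Vcov by (rule rev_subsetD)
    then obtain k where k: "(k, cell k x) \<in> V n" by (rule cover_cell[OF Vcells])
    then have "k \<in> L" unfolding L_def by auto
    define l where "l = (LEAST l. l \<in> L)"
    have "l \<in> L" using \<open>k \<in> L\<close> unfolding l_def by (rule LeastI)
    then obtain m where m: "m \<ge> n" "(l, cell l x) \<in> V m" unfolding L_def by auto
    have "(l, cell l x) \<in> V j" if "j \<ge> m" for j
      using that
    proof (induction j rule: dec_induct)
      case base show ?case by (rule m)
    next
      case (step j)
      have "\<exists>l'\<le>l. (l', cell l' x) \<in> V (Suc j)" using step.IH by (intro cell_up) simp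
      then obtain l' where l': "l' \<le> l" "(l', cell l' x) \<in> V (Suc j)" by blast
      then have "l' \<in> L" unfolding L_def using step m by (auto intro!: exI[of _ "Suc j"])
      then have "l \<le> l'" unfolding l_def by (rule Least_le)
      then show ?case using l' by simp
    qed
    then have "(l, cell l x) \<in> W" unfolding W_def eventually_sequentially by auto
    then show "x \<in> \<Union>(snd ` W)" by force
  qed
  have "net_content t (\<Union>n. E n) \<le> cost t W"
    using Wcells Wcov by (intro net_content_le) (auto simp: cover_of_def)
  \<comment> \<open>\<open>W\<close> is the lower limit of the families \<open>V n\<close>, so its
    indicator is at most the lower limit of theirs; Fatou's lemma then bounds its cost.\<close>
  also have "\<dots> \<le> (\<integral>\<^sup>+p. liminf (\<lambda>n. ennreal (weight t (fst p)) * indicator (V n) p) \<partial>count_space UNIV)"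
    unfolding cost_alt
  proof (intro nn_integral_mono)
    fix p
    show "ennreal (weight t (fst p)) * indicator W p \<le> liminf (\<lambda>n. ennreal (weight t (fst p)) * indicator (V n) p)"
    proof (cases "p \<in> W")
      case True
      then have "\<forall>\<^sub>F n in sequentially. ennreal (weight t (fst p)) \<le> ennreal (weight t (fst p)) * indicator (V n) p"
        unfolding W_def by (auto elim!: eventually_mono)
      then show ?thesis using True by (auto intro!: Liminf_bounded)
    qed simp
  qed
  also have "\<dots> \<le> liminf (\<lambda>n. cost t (V n))"
    unfolding cost_alt by (rule nn_integral_liminf) auto
  also have "\<dots> \<le> ennreal C + ennreal e"
  proof -
    have "cost t (V n) \<le> ennreal C + ennreal e" for n
      using costV[of n] le[of n] sumd[of n] by (meson add_mono order_trans)
    then have "liminf (\<lambda>n. cost t (V n)) \<le> liminf (\<lambda>n::nat. ennreal C + ennreal e)"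
      by (intro Liminf_mono always_eventually) auto
    then show ?thesis by (simp add: Liminf_const)
  qed
  finally show "net_content t (\<Union>n. E n) \<le> ennreal C + ennreal e" .
qed

section \<open>Souslin sets and capacitability\<close>

text \<open>Analytic sets, encoded as projections of closed sets along the Baire space. Countable
  operations then amount to recoding sequences.\<close>

definition souslin :: "'a::euclidean_space set \<Rightarrow> bool" where
  "souslin A \<longleftrightarrow> (\<exists>F :: ('a \<times> (nat \<Rightarrow> nat)) set. closed F \<and> A = fst ` F)"

lemma souslin_closed:
  assumes "closed A"
  shows "souslin A"
  unfolding souslin_def
proof (intro exI conjI)
  show "closed (A \<times> (UNIV :: (nat \<Rightarrow> nat) set))"
    using assms by (intro closed_Times) auto
qed auto

lemma continuous_on_coordinate [continuous_intros]:
  fixes f :: "'a::topological_space \<Rightarrow> nat \<Rightarrow> nat"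
  assumes "continuous_on S f"
  shows "continuous_on S (\<lambda>x. f x i)"
  by (rule continuous_on_product_then_coordinatewise[OF assms])

text \<open>One sequence codes countably many through \<open>prod_encode\<close>, and
  \<open>h n\<close> extracts the witness for \<open>A n\<close>.\<close>

lemma souslin_INT:
  assumes "\<And>n::nat. souslin (A n)"
  shows "souslin (\<Inter>n. A n)"
proof -
  obtain F :: "nat \<Rightarrow> ('a \<times> (nat \<Rightarrow> nat)) set" where F: "\<And>n. closed (F n)" "\<And>n. A n = fst ` F n"
    using assms unfolding souslin_def by metis
  define h where "h n = (\<lambda>p::'a \<times> (nat \<Rightarrow> nat). (fst p, \<lambda>i. snd p (prod_encode (n, i))))" for n
  have "continuous_on UNIV (h n)" for n
    unfolding h_def by (intro continuous_intros continuous_on_coordinatewise_then_product)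
  then have "closed (\<Inter>n. h n -` F n)"
    using F(1) by (auto intro!: closed_INT closed_vimage)
  moreover have "(\<Inter>n. A n) = fst ` (\<Inter>n. h n -` F n)"
  proof (intro equalityI subsetI)
    fix x assume "x \<in> (\<Inter>n. A n)"
    then have "\<forall>n. \<exists>f. (x, f) \<in> F n" using F(2) by force
    then obtain f where f: "\<And>n. (x, f n) \<in> F n" by metis
    define g where "g = (\<lambda>j. f (fst (prod_decode j)) (snd (prod_decode j)))"
    have "h n (x, g) = (x, f n)" for n
      by (simp add: h_def g_def)
    then have "(x, g) \<in> (\<Inter>n. h n -` F n)" using f by simp
    then show "x \<in> fst ` (\<Inter>n. h n -` F n)" by force
  next
    fix x assume "x \<in> fst ` (\<Inter>n. h n -` F n)"
    then obtain g where "\<forall>n. h n (x, g) \<in> F n" by auto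
    then have "\<And>n. x \<in> fst ` F n" unfolding h_def by force
    then show "x \<in> (\<Inter>n. A n)" using F(2) by auto
  qed
  ultimately show ?thesis unfolding souslin_def by blast
qed

text \<open>The first entry of the sequence selects the set \<open>A n\<close>, and the remaining
  entries are the witness.\<close>

lemma souslin_UN:
  assumes "\<And>n::nat. souslin (A n)"
  shows "souslin (\<Union>n. A n)"
proof -
  obtain F :: "nat \<Rightarrow> ('a \<times> (nat \<Rightarrow> nat)) set" where F: "\<And>n. closed (F n)" "\<And>n. A n = fst ` F n"
    using assms unfolding souslin_def by metis
  define h where "h = (\<lambda>p::'a \<times> (nat \<Rightarrow> nat). (fst p, \<lambda>i. snd p (Suc i)))"
  \<comment> \<open>Read as an implication, "if the first entry is \<open>n\<close>, the shifted
    point lies in \<open>F n\<close>", the condition exhibits \<open>G\<close> as an intersection of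
    closed sets.\<close>
  define G where "G = (\<Inter>n. (\<lambda>p::'a \<times> (nat \<Rightarrow> nat). snd p 0) -` (- {n}) \<union> h -` F n)"
  have "continuous_on UNIV h"
    unfolding h_def by (intro continuous_intros continuous_on_coordinatewise_then_product)
  moreover have "continuous_on UNIV (\<lambda>p::'a \<times> (nat \<Rightarrow> nat). snd p 0)"
    by (intro continuous_intros)
  moreover have "closed (- {n::nat})" for n
    by (rule discrete_topology_class.open_discrete[THEN closed_Compl])
  ultimately have "closed G"
    unfolding G_def using F(1) by (auto intro!: closed_INT closed_Un closed_vimage)
  moreover have "(\<Union>n. A n) = fst ` G"
  proof (intro equalityI subsetI)
    fix x assume "x \<in> (\<Union>n. A n)"
    then obtain n f where f: "(x, f) \<in> F n" using F(2) by force
    have "(x, case_nat n f) \<in> G" using f by (simp add: G_def h_def)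
    then show "x \<in> fst ` G" by force
  next
    fix x assume "x \<in> fst ` G"
    then obtain g where g: "(x, g) \<in> G" by auto
    then have "h (x, g) \<in> F (g 0)" by (auto simp: G_def)
    then have "x \<in> fst ` F (g 0)" unfolding h_def by force
    then show "x \<in> (\<Union>n. A n)" using F(2) by auto
  qed
  ultimately show ?thesis unfolding souslin_def by blast
qed

lemma souslin_open:
  fixes A :: "'a::euclidean_space set"
  assumes "open A"
  shows "souslin A"
proof -
  obtain D where D: "countable D" "\<And>X. X \<in> D \<Longrightarrow> \<exists>a b. X = cbox a b" "\<Union>D = A"
    using open_countable_Union_open_cbox[OF assms] by metis
  have "closed (from_nat_into (insert {} D) n)" for n
  proof -
    have "from_nat_into (insert {} D) n \<in> insert {} D" by (rule from_nat_into) simp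
    then show ?thesis using D(2)[of "from_nat_into (insert {} D) n"] closed_cbox by fastforce
  qed
  then have "souslin (\<Union>n. from_nat_into (insert {} D) n)"
    by (intro souslin_UN souslin_closed)
  moreover have "range (from_nat_into (insert {} D)) = insert {} D"
    using D(1) by (intro range_from_nat_into) auto
  ultimately show ?thesis using D(3) by simp
qed

text \<open>Souslin sets are not closed under complements in general, so the induction carries the
  set and its complement together.\<close>

lemma souslin_borel:
  assumes "A \<in> sets borel"
  shows "souslin A"
proof -
  have "A \<in> sigma_sets UNIV (Collect closed)"
    using assms by (simp add: borel_eq_closed)
  then have "souslin A \<and> souslin (- A)"
  proof (induction rule: sigma_sets.induct)
    case (Basic a)
    then show ?case by (simp add: souslin_closed souslin_open open_Compl)
  next
    case Empty
    then show ?case by (simp add: souslin_closed)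
  next
    case (Compl a)
    then show ?case by (simp add: Compl_eq_Diff_UNIV[symmetric])
  next
    case (Union a)
    then have "souslin (\<Inter>i. - a i)" by (intro souslin_INT) auto
    then show ?case using Union by (auto intro: souslin_UN)
  qed
  then show ?thesis ..
qed

lemma compact_nat_box:
  fixes g :: "nat \<Rightarrow> nat"
  shows "compact {f. \<forall>i. f i \<le> g i}"
proof -
  have "compactin (product_topology (\<lambda>i. euclidean) UNIV) (PiE UNIV (\<lambda>i. {..g i}))"
    by (subst compactin_PiE) (auto intro!: finite_imp_compact)
  moreover have "PiE UNIV (\<lambda>i. {..g i}) = {f. \<forall>i. f i \<le> g i}"
    by (auto simp: PiE_def)
  ultimately show ?thesis
    by (simp add: euclidean_product_topology)
qed

lemma tendsto_coordinate:
  fixes f :: "'b \<Rightarrow> nat \<Rightarrow> nat"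
  shows "(f \<longlongrightarrow> l) F \<longleftrightarrow> (\<forall>i. ((\<lambda>n. f n i) \<longlongrightarrow> l i) F)"
proof -
  have "(f \<longlongrightarrow> l) F \<longleftrightarrow> limitin (product_topology (\<lambda>i::nat. euclidean) UNIV) f l F"
    by (simp add: euclidean_product_topology)
  also have "\<dots> \<longleftrightarrow> (\<forall>i. ((\<lambda>n. f n i) \<longlongrightarrow> l i) F)"
    by (simp add: limitin_componentwise)
  finally show ?thesis .
qed

text \<open>Choquet's capacitability argument: choose the bounds \<open>g 0\<close>, \<open>g 1\<close>, and so on successively so that the
  content of the restricted projections stays above \<open>c\<close>; the limit set is a compact projection.\<close>

lemma souslin_compact_approx:
  fixes A :: "'a::euclidean_space set"
  assumes A: "souslin A" "bounded A" and c: "ennreal c < net_content t A" 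
  obtains K where "compact K" "K \<subseteq> A" "\<And>V. open V \<Longrightarrow> K \<subseteq> V \<Longrightarrow> ennreal c < net_content t V"
proof -
  obtain F :: "('a \<times> (nat \<Rightarrow> nat)) set" where F: "closed F" "A = fst ` F"
    using A unfolding souslin_def by blast
  obtain R where R: "A \<subseteq> cball 0 R"
    using bounded_subset_ballD[OF A(2), of 0] ball_subset_cball by (meson order_trans)
  define B where "B k g = fst ` {p\<in>F. \<forall>i<k. snd p i \<le> g i}" for k :: nat and g :: "nat \<Rightarrow> nat"
  have "\<exists>g. \<forall>k. ennreal c < net_content t (B k (g k)) \<and> (\<forall>i<k. g (Suc k) i = g k i)"
  proof (rule dependent_nat_choice)
    show "\<exists>g. ennreal c < net_content t (B 0 g)"
      using c F by (auto simp: B_def)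
  next
    fix g k assume g: "ennreal c < net_content t (B k g)"
    have "B k g \<subseteq> (\<Union>n. B (Suc k) (g(k := n)))"
    proof
      fix x assume "x \<in> B k g"
      then obtain f where f: "(x, f) \<in> F" "\<forall>i<k. f i \<le> g i" by (auto simp: B_def)
      then have "(x, f) \<in> {p\<in>F. \<forall>i<Suc k. snd p i \<le> (g(k := f k)) i}" by (auto simp: less_Suc_eq)
      then show "x \<in> (\<Union>n. B (Suc k) (g(k := n)))" unfolding B_def by force
    qed
    then have "ennreal c < net_content t (\<Union>n. B (Suc k) (g(k := n)))"
      using g net_content_mono order_less_le_trans by blast
    moreover have "incseq (\<lambda>n. B (Suc k) (g(k := n)))"
    proof (rule incseq_SucI)
      fix n
      have "{p\<in>F. \<forall>i<Suc k. snd p i \<le> (g(k := n)) i} \<subseteq> {p\<in>F. \<forall>i<Suc k. snd p i \<le> (g(k := Suc n)) i}"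
        by (auto simp: less_Suc_eq)
      then show "B (Suc k) (g(k := n)) \<subseteq> B (Suc k) (g(k := Suc n))"
        unfolding B_def by (rule image_mono)
    qed
    ultimately have "\<exists>n. ennreal c < net_content t (B (Suc k) (g(k := n)))"
      using net_content_incseq_le[of "\<lambda>n. B (Suc k) (g(k := n))" t c] by (metis not_less)
    then obtain n where "ennreal c < net_content t (B (Suc k) (g(k := n)))" ..
    then show "\<exists>h. ennreal c < net_content t (B (Suc k) h) \<and> (\<forall>i<k. h i = g i)"
      by (intro exI[of _ "g(k := n)"]) auto
  qed
  then obtain gs where gs: "\<And>k. ennreal c < net_content t (B k (gs k))"
      "\<And>k i. i < k \<Longrightarrow> gs (Suc k) i = gs k i" by blast
  define g where "g i = gs (Suc i) i" for i
  have g: "gs k i = g i" if "i < k" for k i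
    using that
  proof (induction k)
    case (Suc k)
    then show ?case using gs(2)[of i k] by (cases "i = k") (auto simp: g_def)
  qed simp
  have Bg: "B k (gs k) = B k g" for k
    unfolding B_def using g[of _ k] by (metis (no_types, lifting))
  define G where "G = F \<inter> cball 0 R \<times> {f. \<forall>i. f i \<le> g i}"
  have "compact G" unfolding G_def
    by (intro closed_Int_compact F compact_Times compact_cball compact_nat_box)
  show ?thesis
  proof (rule that)
    show "compact (fst ` G)"
      by (intro compact_continuous_image continuous_intros \<open>compact G\<close>)
    show "fst ` G \<subseteq> A" unfolding F G_def by blast
    fix V :: "'a set" assume V: "open V" "fst ` G \<subseteq> V"
    have "\<exists>k. B k g \<subseteq> V"
    proof (rule ccontr)
      assume "\<not> (\<exists>k. B k g \<subseteq> V)"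
      then have "\<forall>k. \<exists>p. p \<in> F \<and> (\<forall>i<k. snd p i \<le> g i) \<and> fst p \<notin> V"
        unfolding B_def by blast
      then obtain p where p: "\<And>k. p k \<in> F" "\<And>k i. i < k \<Longrightarrow> snd (p k) i \<le> g i" "\<And>k. fst (p k) \<notin> V"
        by metis
      \<comment> \<open>Only the first \<open>k\<close> entries of \<open>snd (p k)\<close> are
        known to be bounded. Truncation by \<open>g\<close> puts the whole sequence into a compact
        set, and each fixed coordinate is eventually unaffected by it.\<close>
      define q where "q k = (fst (p k), \<lambda>i. min (snd (p k) i) (g i))" for k
      have q: "\<forall>k. q k \<in> cball 0 R \<times> {f. \<forall>i. f i \<le> g i}"
      proof
        fix k
        have "fst (p k) \<in> A" using p(1)[of k] F(2) by blast
        then show "q k \<in> cball 0 R \<times> {f. \<forall>i. f i \<le> g i}" using R by (auto simp: q_def)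
      qed
      have sc: "seq_compact (cball (0::'a) R \<times> {f. \<forall>i. f i \<le> g i})"
        by (intro compact_imp_seq_compact compact_Times compact_cball compact_nat_box)
      obtain l r where l: "l \<in> cball 0 R \<times> {f. \<forall>i. f i \<le> g i}" "strict_mono r" "(q \<circ> r) \<longlonglongrightarrow> l"
        by (rule seq_compactE[OF sc q])
      have l1: "(\<lambda>k. fst (p (r k))) \<longlonglongrightarrow> fst l"
        using tendsto_fst[OF l(3)] by (simp add: q_def o_def)
      have "(\<lambda>k. snd (p (r k)) i) \<longlonglongrightarrow> snd l i" for i
      proof -
        have "(\<lambda>k. min (snd (p (r k)) i) (g i)) \<longlonglongrightarrow> snd l i"
          using tendsto_snd[OF l(3)] by (simp add: q_def o_def tendsto_coordinate)
        moreover have "\<forall>\<^sub>F k in sequentially. min (snd (p (r k)) i) (g i) = snd (p (r k)) i"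
          using eventually_gt_at_top[of i]
        proof eventually_elim
          case (elim k)
          then have "i < r k" using seq_suble[OF l(2), of k] by simp
          then show ?case using p(2)[of i "r k"] by simp
        qed
        ultimately show ?thesis using tendsto_cong by fastforce
      qed
      then have "(\<lambda>k. snd (p (r k))) \<longlonglongrightarrow> snd l"
        by (simp add: tendsto_coordinate)
      then have "(\<lambda>k. (fst (p (r k)), snd (p (r k)))) \<longlonglongrightarrow> (fst l, snd l)"
        using l1 by (intro tendsto_Pair)
      then have "l \<in> F"
        using p(1) by (intro Lim_in_closed_set[OF F(1), of "\<lambda>k. p (r k)"]) auto
      then have "fst l \<in> V" using l(1) V(2) unfolding G_def by blast
      moreover have "fst l \<in> - V"
        using p(3) V(1) l1 by (intro Lim_in_closed_set[of "- V" "\<lambda>k. fst (p (r k))"]) auto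
      ultimately show False by blast
    qed
    then obtain k where "B k g \<subseteq> V" ..
    then have "net_content t (B k g) \<le> net_content t V" by (rule net_content_mono)
    then show "ennreal c < net_content t V" using gs(1)[of k] Bg by (metis order_less_le_trans)
  qed
qed

section \<open>Finite Frostman weights\<close>

text \<open>The weights are raised one point at a time until one of the constraints at that point becomes tight.\<close>

lemma greedy_weights:
  fixes c :: "'i \<Rightarrow> real" and S :: "'i \<Rightarrow> 'a set"
  assumes "finite P" "finite I" "\<And>i. i \<in> I \<Longrightarrow> 0 \<le> c i" "\<And>p. p \<in> P \<Longrightarrow> \<exists>i\<in>I. p \<in> S i"
  shows "\<exists>w. (\<forall>p. 0 \<le> w p) \<and> (\<forall>i\<in>I. sum w (P \<inter> S i) \<le> c i)
           \<and> (\<forall>p\<in>P. \<exists>i\<in>I. p \<in> S i \<and> sum w (P \<inter> S i) = c i)"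
  using assms(1,4)
proof (induction P rule: finite_induct)
  case empty
  then show ?case using assms(3) by (auto intro!: exI[of _ "\<lambda>_. 0"])
next
  case (insert q P)
  then obtain w where w: "\<And>p. 0 \<le> w p" "\<And>i. i \<in> I \<Longrightarrow> sum w (P \<inter> S i) \<le> c i"
      "\<And>p. p \<in> P \<Longrightarrow> \<exists>i\<in>I. p \<in> S i \<and> sum w (P \<inter> S i) = c i"
    by (metis insertI2)
  define J where "J = {i\<in>I. q \<in> S i}"
  define r where "r i = c i - sum w (P \<inter> S i)" for i
  have J: "finite J" "J \<noteq> {}" using assms(2) insert.prems by (auto simp: J_def)
  define m where "m = Min (r ` J)"
  have m_le: "m \<le> r i" if "i \<in> J" for i using that J by (auto simp: m_def)
  have "m \<in> r ` J" unfolding m_def using J by (intro Min_in) auto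
  then obtain j where j: "j \<in> J" "r j = m" by blast
  have m0: "0 \<le> m" using j w(2)[of j] by (auto simp: r_def J_def)
  define w' where "w' = w(q := m)"
  have sum': "sum w' (insert q P \<inter> S i) = sum w (P \<inter> S i) + (if q \<in> S i then m else 0)" for i
  proof -
    have "sum w' (P \<inter> S i) = sum w (P \<inter> S i)"
      using insert.hyps by (intro sum.cong) (auto simp: w'_def)
    then show ?thesis using insert.hyps by (auto simp: w'_def)
  qed
  show ?case
  proof (intro exI[of _ w'] conjI ballI allI)
    fix p show "0 \<le> w' p" using w(1) m0 by (auto simp: w'_def)
  next
    fix i assume i: "i \<in> I"
    show "sum w' (insert q P \<inter> S i) \<le> c i"
      unfolding sum' using w(2)[OF i] m_le[of i] i by (auto simp: J_def r_def)
  next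
    fix p assume p: "p \<in> insert q P"
    show "\<exists>i\<in>I. p \<in> S i \<and> sum w' (insert q P \<inter> S i) = c i"
    proof (cases "p = q")
      case True
      have "j \<in> I" "q \<in> S j" using j by (auto simp: J_def)
      moreover have "sum w' (insert q P \<inter> S j) = c j"
        unfolding sum' using j by (simp add: J_def r_def)
      ultimately show ?thesis using True by blast
    next
      case False
      then obtain i where i: "i \<in> I" "p \<in> S i" "sum w (P \<inter> S i) = c i" using p w(3) by auto
      \<comment> \<open>A constraint through \<open>q\<close> that is already tight leaves no room
        for a raise; then \<open>m = 0\<close>, and the constraint stays tight.\<close>
      moreover have "q \<in> S i \<Longrightarrow> m = 0"
        using m_le[of i] i m0 by (auto simp: J_def r_def)
      ultimately show ?thesis using sum'[of i] by (intro bexI[of _ i]) auto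
    qed
  qed
qed

text \<open>The discrete counterpart, at scale \<open>(1/2) ^ m\<close>, of a measure whose balls of
  radius \<open>r\<close> have mass of order at most \<open>r powr t\<close>. For
  \<open>t > 0\<close> a positive point mass cannot satisfy the bound at all levels, hence the
  restriction to levels up to \<open>m\<close>.\<close>

definition frostman :: "real \<Rightarrow> nat \<Rightarrow> 'a::euclidean_space set \<Rightarrow> ('a \<Rightarrow> real) \<Rightarrow> bool" where
  "frostman t m P w \<longleftrightarrow> finite P \<and> (\<forall>p. 0 \<le> w p) \<and> (\<forall>k\<le>m. \<forall>x. sum w (P \<inter> cell k x) \<le> weight t k)"

lemma frostmanD:
  assumes "frostman t m P w"
  shows "finite P" "0 \<le> w p" "k \<le> m \<Longrightarrow> sum w (P \<inter> cell k x) \<le> weight t k"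
  using assms by (auto simp: frostman_def)

lemma bounded_finite_cells:
  fixes E :: "'a::euclidean_space set"
  assumes "bounded E"
  shows "finite (cell m ` E)"
proof -
  obtain R where R: "\<And>x. x \<in> E \<Longrightarrow> norm x \<le> R" using assms by (auto simp: bounded_iff)
  show ?thesis
  proof (rule cell_image_finite(1)[where Z = "\<lambda>_. {- \<lceil>2 ^ m * R\<rceil> - 1..\<lceil>2 ^ m * R\<rceil> + 1}"])
    fix x b :: 'a assume x: "x \<in> E" and b: "b \<in> Basis"
    have "\<bar>x \<bullet> b\<bar> \<le> R" using Basis_le_norm[OF b, of x] R[OF x] by linarith
    then have "\<bar>2 ^ m * (x \<bullet> b)\<bar> \<le> 2 ^ m * R" by (simp add: abs_mult)
    then show "\<lfloor>2 ^ m * (x \<bullet> b)\<rfloor> \<in> {- \<lceil>2 ^ m * R\<rceil> - 1..\<lceil>2 ^ m * R\<rceil> + 1}"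
      unfolding atLeastAtMost_iff by linarith
  qed simp
qed

text \<open>For weights as in \<open>greedy_weights\<close> the maximal tight cells are disjoint, cover \<open>E\<close>, and carry the total mass.\<close>

lemma frostman_exists:
  fixes E :: "'a::euclidean_space set"
  assumes "bounded E"
  obtains P w where "frostman t m P w" "P \<subseteq> E" "net_content t E \<le> ennreal (sum w P)"
proof -
  \<comment> \<open>One point of \<open>E\<close> is chosen in each cell of level \<open>m\<close>
    that meets \<open>E\<close>. A cell of level at most \<open>m\<close> containing the
    representative of \<open>x\<close> then contains \<open>x\<close>, so covering \<open>P\<close>
    by such cells covers \<open>E\<close>.\<close>
  define rep where "rep Q = (SOME x. x \<in> E \<inter> Q)" for Q
  define P where "P = rep ` cell m ` E"
  have rep: "rep (cell m x) \<in> E \<inter> cell m x" if "x \<in> E" for x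
    unfolding rep_def by (rule someI[of _ x]) (use that in simp)
  have P: "finite P" "P \<subseteq> E"
    using bounded_finite_cells[OF assms] rep by (auto simp: P_def)
  define I where "I = (\<Union>k\<le>m. (\<lambda>p. (k, cell k p)) ` P)"
  have I: "finite I" using P by (auto simp: I_def)
  have Icells: "I \<subseteq> cells" by (auto simp: I_def cells_def)
  have I0: "\<exists>i\<in>I. p \<in> snd i" if "p \<in> P" for p
    using that by (intro bexI[of _ "(0, cell 0 p)"]) (auto simp: I_def)
  have "\<exists>w. (\<forall>p. 0 \<le> w p) \<and> (\<forall>i\<in>I. sum w (P \<inter> snd i) \<le> weight t (fst i))
      \<and> (\<forall>p\<in>P. \<exists>i\<in>I. p \<in> snd i \<and> sum w (P \<inter> snd i) = weight t (fst i))"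
    by (rule greedy_weights[OF P(1) I]) (simp_all add: I0)
  then obtain w where w: "\<And>p. 0 \<le> w p" "\<And>i. i \<in> I \<Longrightarrow> sum w (P \<inter> snd i) \<le> weight t (fst i)"
      "\<And>p. p \<in> P \<Longrightarrow> \<exists>i\<in>I. p \<in> snd i \<and> sum w (P \<inter> snd i) = weight t (fst i)"
    by blast
  have fr: "frostman t m P w"
    unfolding frostman_def
  proof (intro conjI allI impI)
    fix k x assume k: "k \<le> m"
    show "sum w (P \<inter> cell k x) \<le> weight t k"
    proof (cases "P \<inter> cell k x = {}")
      case False
      then obtain p where p: "p \<in> P" "p \<in> cell k x" by auto
      then have "(k, cell k x) \<in> I" using k cell_eq[OF p(2)] by (auto simp: I_def)
      then show ?thesis using w(2) by fastforce
    qed auto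
  qed (use P w in auto)
  define U where "U = {i\<in>I. sum w (P \<inter> snd i) = weight t (fst i)}"
  define M where "M = maximal U"
  have U: "finite U" "U \<subseteq> cells" using I Icells by (auto simp: U_def)
  have M: "finite M" "M \<subseteq> U" using U maximal_subset[of U] finite_subset unfolding M_def by auto
  have PM: "\<exists>i\<in>M. fst i \<le> m \<and> p \<in> snd i" if p: "p \<in> P" for p
  proof -
    obtain i where i: "i \<in> I" "p \<in> snd i" "sum w (P \<inter> snd i) = weight t (fst i)" using w(3)[OF p] by blast
    then have "(fst i, snd i) \<in> U" by (simp add: U_def)
    then obtain l where l: "(l, cell l p) \<in> M"
      using maximal_covers[OF U(2)] i(2) unfolding M_def by metis
    then have "(l, cell l p) \<in> I" using M by (auto simp: U_def)
    then have "l \<le> m" by (auto simp: I_def)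
    then show ?thesis using l by (intro bexI[of _ "(l, cell l p)"]) auto
  qed
  have "M \<in> cover_of E"
    unfolding cover_of_def
  proof (intro CollectI conjI subsetI)
    fix p assume "p \<in> M" then show "p \<in> cells" using M U by blast
  next
    fix x assume x: "x \<in> E"
    let ?p = "rep (cell m x)"
    have "?p \<in> P" using x by (auto simp: P_def)
    then obtain i where i: "i \<in> M" "fst i \<le> m" "?p \<in> snd i" using PM by blast
    have "snd i = cell (fst i) ?p"
      by (rule cells_eqI) (use i M U in auto)
    moreover have "x \<in> cell m ?p" using rep[OF x] cell_sym by blast
    ultimately have "x \<in> snd i" using cell_mono[OF i(2)] by blast
    then show "x \<in> \<Union>(snd ` M)" using i by blast
  qed
  then have "net_content t E \<le> cost t M" by (rule net_content_le)
  also have "\<dots> = ennreal (\<Sum>i\<in>M. weight t (fst i))" by (rule cost_finite[OF M(1)])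
  also have "(\<Sum>i\<in>M. weight t (fst i)) = (\<Sum>i\<in>M. sum w (P \<inter> snd i))"
    using M by (intro sum.cong) (auto simp: U_def)
  also have "\<dots> = sum w (\<Union>i\<in>M. P \<inter> snd i)"
  proof (rule sum.UNION_disjoint[symmetric])
    show "\<forall>i\<in>M. \<forall>j\<in>M. i \<noteq> j \<longrightarrow> P \<inter> snd i \<inter> (P \<inter> snd j) = {}"
      using maximal_disjoint[OF U(2)] unfolding M_def by blast
  qed (use M P in auto)
  also have "(\<Union>i\<in>M. P \<inter> snd i) = P" using PM by blast
  finally show ?thesis using that fr P by blast
qed

text \<open>On either side of \<open>n0\<close> the distances to \<open>n0\<close> are distinct
  natural numbers, and each side is dominated by the geometric series with sum 2.\<close>

lemma sum_exp_int_le: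
  fixes Z :: "int set"
  assumes "finite Z"
  shows "(\<Sum>n\<in>Z. exp (- \<bar>real_of_int (n - n0)\<bar>)) \<le> 4"
proof -
  have half: "exp (- real j) \<le> (1/2) ^ j" for j
  proof -
    have "exp (- real j) = exp (-1) ^ j" by (simp flip: exp_of_nat_mult)
    also have "\<dots> \<le> (1/2) ^ j"
      using exp_ge_add_one_self[of "1::real"] by (intro power_mono) (auto simp: exp_minus field_simps)
    finally show ?thesis .
  qed
  have one: "(\<Sum>n\<in>Y. exp (- \<bar>real_of_int (n - n0)\<bar>)) \<le> 2"
    if Y: "finite Y" "inj_on (\<lambda>n. nat \<bar>n - n0\<bar>) Y" for Y
  proof -
    have "(\<Sum>n\<in>Y. exp (- \<bar>real_of_int (n - n0)\<bar>)) = (\<Sum>j\<in>(\<lambda>n. nat \<bar>n - n0\<bar>) ` Y. exp (- real j))"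
      using Y(2) by (simp add: sum.reindex)
    also have "\<dots> \<le> (\<Sum>j\<in>(\<lambda>n. nat \<bar>n - n0\<bar>) ` Y. (1/2) ^ j)"
      using half by (intro sum_mono)
    also have "\<dots> \<le> (\<Sum>j. (1/2::real) ^ j)"
      using Y(1) by (intro sum_le_suminf) (auto intro: summable_geometric)
    also have "\<dots> = 2" by (simp add: suminf_geometric)
    finally show ?thesis .
  qed
  have "(\<Sum>n\<in>Z. exp (- \<bar>real_of_int (n - n0)\<bar>))
      = (\<Sum>n\<in>Z \<inter> {n0..}. exp (- \<bar>real_of_int (n - n0)\<bar>)) + (\<Sum>n\<in>Z - {n0..}. exp (- \<bar>real_of_int (n - n0)\<bar>))"
    using assms by (rule sum.Int_Diff)
  also have "\<dots> \<le> 2 + 2"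
    using assms by (intro add_mono one) (auto simp: inj_on_def)
  finally show ?thesis by simp
qed

text \<open>The exponential kernel of width \<open>(1/2) ^ k\<close> factorizes over the
  coordinates. Each cell has mass at most \<open>weight t k\<close>, and the remaining sum over
  integer vectors is a product of one-dimensional sums, each at most
  \<open>3 * 4 = 12\<close>.\<close>

lemma frostman_exp_sum:
  fixes P :: "'a::euclidean_space set"
  assumes fr: "frostman t m P w" and k: "k \<le> m"
  shows "(\<Sum>p\<in>P. w p * exp (- (2 ^ k * l1 (p - x)))) \<le> 12 ^ DIM('a) * weight t k"
proof -
  note P = frostmanD(1,2)[OF fr] frostmanD(3)[OF fr k]
  define fl where "fl p = (\<lambda>b\<in>(Basis::'a set). \<lfloor>2 ^ k * (p \<bullet> b)\<rfloor>)" for p :: 'a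
  define n0 where "n0 b = \<lfloor>2 ^ k * (x \<bullet> b)\<rfloor>" for b
  \<comment> \<open>The factor 3 bounds \<open>exp 1\<close>: passing from coordinates to floors
    changes their distance by at most 1.\<close>
  define g where "g b n = 3 * exp (- \<bar>real_of_int (n - n0 b)\<bar>)" for b n
  have g: "exp (- (2 ^ k * l1 (p - x))) \<le> (\<Prod>b\<in>Basis. g b (fl p b))" for p
  proof -
    have "exp (- (2 ^ k * l1 (p - x))) = (\<Prod>b\<in>Basis. exp (- (2 ^ k * \<bar>(p - x) \<bullet> b\<bar>)))"
      by (simp add: sum_distrib_left exp_sum flip: sum_negf)
    also have "\<dots> \<le> (\<Prod>b\<in>Basis. g b (fl p b))"
    proof (intro prod_mono conjI)
      fix b :: 'a assume b: "b \<in> Basis"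
      have "\<bar>real_of_int (fl p b - n0 b)\<bar> \<le> \<bar>2 ^ k * (p \<bullet> b) - 2 ^ k * (x \<bullet> b)\<bar> + 1"
        using b unfolding fl_def n0_def by simp linarith
      also have "\<bar>2 ^ k * (p \<bullet> b) - 2 ^ k * (x \<bullet> b)\<bar> = 2 ^ k * \<bar>(p - x) \<bullet> b\<bar>"
        by (simp add: inner_diff_left abs_mult flip: right_diff_distrib)
      finally have "exp (- (2 ^ k * \<bar>(p - x) \<bullet> b\<bar>)) \<le> exp (1 - \<bar>real_of_int (fl p b - n0 b)\<bar>)"
        by simp
      also have "\<dots> = exp 1 * exp (- \<bar>real_of_int (fl p b - n0 b)\<bar>)" by (simp add: exp_diff exp_minus field_simps)
      also have "\<dots> \<le> g b (fl p b)" unfolding g_def using exp_le by (intro mult_right_mono) auto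
      finally show "exp (- (2 ^ k * \<bar>(p - x) \<bullet> b\<bar>)) \<le> g b (fl p b)" .
    qed auto
    finally show ?thesis .
  qed
  define Z where "Z = (\<Union>b\<in>Basis. (\<lambda>p. fl p b) ` P)"
  have Z: "finite Z" using P by (auto simp: Z_def)
  have g0: "0 \<le> g b n" for b n by (simp add: g_def)
  have fib: "{p\<in>P. fl p = f} = {} \<or> (\<exists>y. {p\<in>P. fl p = f} = P \<inter> cell k y)" for f
  proof (cases "{p\<in>P. fl p = f} = {}")
    case False
    then obtain y where y: "y \<in> P" "fl y = f" by blast
    have iff: "fl p = fl y \<longleftrightarrow> p \<in> cell k y" for p
    proof
      assume fl: "fl p = fl y"
      have "\<lfloor>2 ^ k * (p \<bullet> b)\<rfloor> = \<lfloor>2 ^ k * (y \<bullet> b)\<rfloor>" if "b \<in> Basis" for b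
        using fun_cong[OF fl, of b] that by (simp add: fl_def)
      then show "p \<in> cell k y" unfolding cell_def by blast
    next
      assume "p \<in> cell k y"
      then show "fl p = fl y" unfolding cell_def fl_def by (intro restrict_ext) blast
    qed
    have "{p\<in>P. fl p = f} = P \<inter> cell k y" using iff y(2) by auto
    then show ?thesis by blast
  qed simp
  have "(\<Sum>p\<in>P. w p * exp (- (2 ^ k * l1 (p - x)))) \<le> (\<Sum>p\<in>P. w p * (\<Prod>b\<in>Basis. g b (fl p b)))"
    using P(2) g by (intro sum_mono mult_left_mono)
  also have "\<dots> = (\<Sum>f\<in>fl ` P. \<Sum>p\<in>{p\<in>P. fl p = f}. w p * (\<Prod>b\<in>Basis. g b (fl p b)))"
    using P(1) by (rule sum.image_gen)
  also have "\<dots> = (\<Sum>f\<in>fl ` P. sum w {p\<in>P. fl p = f} * (\<Prod>b\<in>Basis. g b (f b)))"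
    by (intro sum.cong refl) (simp add: sum_distrib_right)
  also have "\<dots> \<le> (\<Sum>f\<in>fl ` P. weight t k * (\<Prod>b\<in>Basis. g b (f b)))"
  proof (intro sum_mono mult_right_mono prod_nonneg)
    fix f show "sum w {p\<in>P. fl p = f} \<le> weight t k"
      using fib[of f]
    proof
      assume "{p\<in>P. fl p = f} = {}"
      then show ?thesis by (simp only: sum.empty weight_pos)
    next
      assume "\<exists>y. {p\<in>P. fl p = f} = P \<inter> cell k y"
      then obtain y where "{p\<in>P. fl p = f} = P \<inter> cell k y" ..
      then show ?thesis using P(3)[of y] by (simp only:)
    qed
  qed (use g0 in auto)
  \<comment> \<open>Enlarging the index set from the vectors that occur to a full product makes the
    sum factorize.\<close>
  also have "\<dots> \<le> (\<Sum>f\<in>PiE Basis (\<lambda>_. Z). weight t k * (\<Prod>b\<in>Basis. g b (f b)))"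
    using Z g0 by (intro sum_mono2 finite_PiE mult_nonneg_nonneg prod_nonneg) (auto simp: Z_def fl_def)
  also have "\<dots> = weight t k * (\<Prod>b\<in>Basis. \<Sum>n\<in>Z. g b n)"
    using Z by (simp add: prod_sum_PiE sum_distrib_left)
  also have "\<dots> \<le> weight t k * (\<Prod>b\<in>(Basis::'a set). 12)"
  proof (intro mult_left_mono prod_mono conjI)
    fix b :: 'a
    have "(\<Sum>n\<in>Z. g b n) = 3 * (\<Sum>n\<in>Z. exp (- \<bar>real_of_int (n - n0 b)\<bar>))"
      by (simp add: g_def sum_distrib_left)
    also have "\<dots> \<le> 12" using sum_exp_int_le[OF Z, of "n0 b"] by simp
    finally show "(\<Sum>n\<in>Z. g b n) \<le> 12" .
  qed (use g0 in \<open>auto intro: sum_nonneg\<close>)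
  also have "\<dots> = 12 ^ DIM('a) * weight t k" by simp
  finally show ?thesis .
qed

text \<open>On \<open>D\<close> the exponential kernel is at least \<open>exp (- c)\<close>, so the
  mass of \<open>D\<close> is controlled by the full exponential sum.\<close>

lemma frostman_near_mass:
  fixes P :: "'a::euclidean_space set"
  assumes fr: "frostman t m P w" and k: "k \<le> m" and D: "D \<subseteq> P"
    and near: "\<And>p. p \<in> D \<Longrightarrow> l1 (p - x) \<le> c * (1/2) ^ k"
  shows "sum w D \<le> exp c * 12 ^ DIM('a) * weight t k"
proof -
  note P = frostmanD(1,2)[OF fr]
  have e: "1 \<le> exp c * exp (- (2 ^ k * l1 (p - x)))" if "p \<in> D" for p
  proof -
    have "2 ^ k * l1 (p - x) \<le> 2 ^ k * (c * (1/2) ^ k)"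
      using near[OF that] by (intro mult_left_mono) auto
    also have "\<dots> = c" by (simp add: power_divide)
    finally show ?thesis by (simp flip: exp_add)
  qed
  have "sum w D \<le> (\<Sum>p\<in>D. w p * (exp c * exp (- (2 ^ k * l1 (p - x)))))"
    using P(2) e by (intro sum_mono) (metis mult_left_mono mult.right_neutral)
  also have "\<dots> \<le> (\<Sum>p\<in>P. w p * (exp c * exp (- (2 ^ k * l1 (p - x)))))"
    using P D by (intro sum_mono2) auto
  also have "\<dots> = exp c * (\<Sum>p\<in>P. w p * exp (- (2 ^ k * l1 (p - x))))"
    by (simp add: sum_distrib_left algebra_simps)
  also have "\<dots> \<le> exp c * (12 ^ DIM('a) * weight t k)"
    by (intro mult_left_mono frostman_exp_sum[OF fr k]) auto
  finally show ?thesis by (simp add: algebra_simps)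
qed

section \<open>Hausdorff null sets\<close>

text \<open>Each term is at most the whole sum. As \<open>t > 0\<close>, a cover of small total cost
  therefore consists of sets of small diameter, and the mesh condition comes for free.\<close>

lemma hausdorff_null_iff:
  assumes t: "0 < t"
  shows "hausdorff_measure t A = 0 \<longleftrightarrow>
    (\<forall>e>0. \<exists>U::nat \<Rightarrow> 'a::metric_space set. A \<subseteq> (\<Union>i. U i) \<and> (\<forall>i. bounded (U i)) \<and> (\<Sum>i. diam_power t (U i)) < ennreal e)"
    (is "_ \<longleftrightarrow> (\<forall>e>0. ?P e)")
proof
  assume *: "hausdorff_measure t A = 0"
  show "\<forall>e>0. ?P e"
  proof (intro allI impI)
    fix e :: real assume "0 < e"
    have "hausdorff_pre_measure t 1 A \<le> hausdorff_measure t A"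
      unfolding hausdorff_measure_def by (rule SUP_upper) simp
    then have "hausdorff_pre_measure t 1 A < ennreal e" using * \<open>0 < e\<close> by simp
    then show "?P e"
      unfolding hausdorff_pre_measure_def INF_less_iff by (auto simp: fine_covers_def)
  qed
next
  assume *: "\<forall>e>0. ?P e"
  have "hausdorff_pre_measure t r A \<le> 0" if r: "0 < r" for r
  proof (rule ennreal_le_epsilon)
    fix e :: real assume e: "0 < e"
    \<comment> \<open>The bound \<open>r powr t\<close> is what forces every diameter to be at most
      \<open>r\<close>.\<close>
    obtain U where U: "A \<subseteq> (\<Union>i. U i)" "\<And>i. bounded (U i)" "(\<Sum>i. diam_power t (U i)) < ennreal (min e (r powr t))"
      using *[rule_format, of "min e (r powr t)"] e r by auto
    have "diameter (U i) \<le> r" for i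
    proof (rule ccontr)
      assume "\<not> diameter (U i) \<le> r"
      then have d: "r < diameter (U i)" by simp
      then have "U i \<noteq> {}" using r by (auto simp: diameter_def)
      then have "ennreal (r powr t) \<le> diam_power t (U i)"
        using d r t by (auto simp: diam_power_def intro!: ennreal_leI powr_mono2)
      also have "\<dots> = (\<Sum>i\<in>{i}. diam_power t (U i))" by simp
      also have "\<dots> \<le> (\<Sum>i. diam_power t (U i))" by (rule sum_le_suminf) auto
      also have "\<dots> < ennreal (r powr t)" using U(3) by (rule order_less_le_trans) (auto intro: ennreal_leI)
      finally show False by simp
    qed
    then have "hausdorff_pre_measure t r A \<le> (\<Sum>i. diam_power t (U i))"
      unfolding hausdorff_pre_measure_def using U by (intro INF_lower) (auto simp: fine_covers_def)
    also have "\<dots> \<le> ennreal e"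
      using U(3) by (rule less_imp_le[OF order_less_le_trans]) (auto intro: ennreal_leI)
    finally show "hausdorff_pre_measure t r A \<le> 0 + ennreal e" by simp
  qed
  then have "hausdorff_measure t A \<le> 0"
    unfolding hausdorff_measure_def by (intro SUP_least) auto
  then show "hausdorff_measure t A = 0" by simp
qed

lemma hausdorff_nullI:
  fixes A :: "'a::metric_space set"
  assumes "0 < t" "\<And>e. 0 < e \<Longrightarrow> \<exists>U::nat \<Rightarrow> 'a set. A \<subseteq> (\<Union>i. U i) \<and> (\<forall>i. bounded (U i)) \<and> (\<Sum>i. diam_power t (U i)) < ennreal e"
  shows "hausdorff_measure t A = 0"
  using assms hausdorff_null_iff by blast

text \<open>In a cover of mesh at most 1 a larger exponent makes each term smaller.\<close>

lemma hausdorff_null_exponent_mono: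
  fixes A :: "'a::metric_space set"
  assumes "hausdorff_measure s A = 0" "0 \<le> s" "s < t"
  shows "hausdorff_measure t A = 0"
proof (rule hausdorff_nullI)
  fix e :: real assume "0 < e"
  have "hausdorff_pre_measure s 1 A \<le> hausdorff_measure s A"
    unfolding hausdorff_measure_def by (rule SUP_upper) simp
  then have "hausdorff_pre_measure s 1 A < ennreal e" using assms \<open>0 < e\<close> by simp
  then obtain U where U: "U \<in> fine_covers 1 A" "(\<Sum>i. diam_power s (U i)) < ennreal e"
    unfolding hausdorff_pre_measure_def INF_less_iff by blast
  have "diam_power t (U i) \<le> diam_power s (U i)" for i
  proof -
    have d: "0 \<le> diameter (U i)" "diameter (U i) \<le> 1"
      using U(1) by (auto simp: fine_covers_def intro: diameter_ge_0)
    then have "diameter (U i) powr t \<le> diameter (U i) powr s" if "s \<noteq> 0"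
      using assms that by (cases "diameter (U i) = 0") (auto intro: powr_mono')
    moreover have "diameter (U i) powr t \<le> 1" using d assms by (intro powr_le1) auto
    ultimately show ?thesis using assms by (auto simp: diam_power_def intro!: ennreal_leI simp flip: ennreal_1)
  qed
  then have "(\<Sum>i. diam_power t (U i)) \<le> (\<Sum>i. diam_power s (U i))" by (intro suminf_le) auto
  then have "(\<Sum>i. diam_power t (U i)) < ennreal e" using U(2) by (rule order_le_less_trans)
  then show "\<exists>U::nat \<Rightarrow> 'a set. A \<subseteq> (\<Union>i. U i) \<and> (\<forall>i. bounded (U i)) \<and> (\<Sum>i. diam_power t (U i)) < ennreal e"
    using U(1) by (auto simp: fine_covers_def intro!: exI[of _ U])
qed (use assms in simp)

lemma hausdorff_null_subset:
  assumes "hausdorff_measure t B = 0" "A \<subseteq> B" "0 < t"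
  shows "hausdorff_measure t A = 0"
proof -
  from assms(2) have "A \<subseteq> X" if "B \<subseteq> X" for X using that by blast
  then show ?thesis using assms(1) unfolding hausdorff_null_iff[OF assms(3)] by metis
qed

lemma diameter_le_dist:
  fixes S :: "'a::metric_space set"
  assumes "S \<noteq> {}" "\<And>x y. x \<in> S \<Longrightarrow> y \<in> S \<Longrightarrow> dist x y \<le> d"
  shows "diameter S \<le> d"
  unfolding diameter_def using assms by (auto intro!: cSUP_least)

lemma hausdorff_null_lipschitz_image:
  fixes f :: "'a::metric_space \<Rightarrow> 'b::metric_space"
  assumes null: "hausdorff_measure t A = 0" and t: "0 < t"
    and lip: "\<And>x y. x \<in> A \<Longrightarrow> y \<in> A \<Longrightarrow> dist (f x) (f y) \<le> L * dist x y" and L: "0 < L"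
  shows "hausdorff_measure t (f ` A) = 0"
proof (rule hausdorff_nullI[OF t])
  fix e :: real assume e: "0 < e"
  have "0 < e / L powr t" using e L by simp
  then obtain U where U: "A \<subseteq> (\<Union>i. U i)" "\<And>i::nat. bounded (U i)" "(\<Sum>i. diam_power t (U i)) < ennreal (e / L powr t)"
    using null unfolding hausdorff_null_iff[OF t] by blast
  \<comment> \<open>The sets are cut down to \<open>A\<close> because \<open>f\<close> is Lipschitz
    only there.\<close>
  define V where "V i = f ` (U i \<inter> A)" for i
  have dist: "dist (f x) (f y) \<le> L * diameter (U i)" if "x \<in> U i \<inter> A" "y \<in> U i \<inter> A" for x y i
  proof -
    have "dist x y \<le> diameter (U i)"
      using that by (intro diameter_bounded_bound U) auto
    then have "L * dist x y \<le> L * diameter (U i)" using L by simp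
    then show ?thesis using lip[of x y] that by simp
  qed
  have bV: "bounded (V i)" for i
    unfolding bounded_two_points V_def using dist[of _ i] by blast
  have "diam_power t (V i) \<le> ennreal (L powr t) * diam_power t (U i)" for i
  proof (cases "V i = {}")
    case False
    then have "U i \<noteq> {}" by (auto simp: V_def)
    have "diameter (V i) \<le> L * diameter (U i)"
      using False dist[of _ i] unfolding V_def by (intro diameter_le_dist) auto
    then have "diameter (V i) powr t \<le> (L * diameter (U i)) powr t"
      using t by (intro powr_mono2) (auto intro: diameter_ge_0 bV)
    also have "\<dots> = L powr t * diameter (U i) powr t"
      using L U(2) by (simp add: powr_mult diameter_ge_0)
    finally show ?thesis
      using False \<open>U i \<noteq> {}\<close> t by (simp add: diam_power_def ennreal_leI flip: ennreal_mult)
  qed (simp add: diam_power_def)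
  then have "(\<Sum>i. diam_power t (V i)) \<le> (\<Sum>i. ennreal (L powr t) * diam_power t (U i))"
    by (intro suminf_le) auto
  also have "\<dots> = ennreal (L powr t) * (\<Sum>i. diam_power t (U i))" by simp
  also have "\<dots> < ennreal (L powr t) * ennreal (e / L powr t)"
    using U(3) L by (intro ennreal_mult_strict_left_mono) auto
  also have "\<dots> = ennreal e" using L e by (simp flip: ennreal_mult)
  finally have "(\<Sum>i. diam_power t (V i)) < ennreal e" .
  moreover have "f ` A \<subseteq> (\<Union>i. V i)" using U(1) unfolding V_def by blast
  ultimately show "\<exists>V::nat \<Rightarrow> 'b set. f ` A \<subseteq> (\<Union>i. V i) \<and> (\<forall>i. bounded (V i)) \<and> (\<Sum>i. diam_power t (V i)) < ennreal e"
    using bV by blast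
qed

lemma weight_eq: "weight t k = ((1/2) ^ k) powr t"
proof -
  have "weight t k = (2 powr (- t)) powr real k" by (simp add: weight_def powr_realpow)
  also have "\<dots> = (2 powr (- real k)) powr t" by (simp add: powr_powr mult.commute)
  also have "2 powr (- real k) = (1/2 :: real) ^ k" by (simp add: powr_minus powr_realpow power_one_over inverse_eq_divide)
  finally show ?thesis .
qed

text \<open>A cell of level \<open>k\<close> has diameter at most \<open>D * (1/2) ^ k\<close>,
  which costs only the factor \<open>D powr t\<close>. Most of the proof turns a countable family of
  cells into a sequence of sets.\<close>

lemma hausdorff_null_of_net_content:
  fixes E :: "'a::euclidean_space set"
  assumes t: "0 < t" and null: "net_content t E = 0"
  shows "hausdorff_measure t E = 0"
proof (rule hausdorff_nullI[OF t])
  fix e :: real assume e: "0 < e"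
  define D where "D = real DIM('a)"
  have D: "0 < D" by (simp add: D_def)
  have "net_content t E < ennreal (e / D powr t)" using null e D by simp
  then obtain U where U: "U \<in> cover_of E" "cost t U < ennreal (e / D powr t)"
    by (rule net_content_less_cover)
  have Uc: "U \<subseteq> cells" "E \<subseteq> \<Union>(snd ` U)" using U(1) by (auto simp: cover_of_def)
  have countable: "countable U" using Uc(1) countable_cells countable_subset by blast
  define idx where "idx = to_nat_on U"
  have inj: "inj_on idx U" unfolding idx_def using countable by (rule inj_on_to_nat_on)
  \<comment> \<open>Indices that name no cell receive the empty set, whose \<open>diam_power\<close>
    is 0.\<close>
  define W where "W i = (if i \<in> idx ` U then snd (inv_into U idx i) else {})" for i
  have W: "W (idx p) = snd p" if "p \<in> U" for p
    using that inj by (simp add: W_def)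
  have dist: "dist x y \<le> D * (1/2) ^ fst p" if p: "p \<in> U" "x \<in> snd p" "y \<in> snd p" for p x y
  proof -
    have "p \<in> cells" using p(1) Uc(1) by blast
    then show ?thesis using cell_norm_diff_le[of x "fst p" _ y] p(2,3) by (auto simp: cells_def D_def dist_norm)
  qed
  have bW: "bounded (W i)" for i
  proof (cases "i \<in> idx ` U")
    case True
    then obtain p where "p \<in> U" "i = idx p" by blast
    then show ?thesis unfolding bounded_two_points using dist[of p] by (auto simp: W)
  qed (simp add: W_def)
  have le: "diam_power t (W (idx p)) \<le> ennreal (D powr t) * ennreal (weight t (fst p))" if p: "p \<in> U" for p
  proof (cases "W (idx p) = {}")
    case False
    have "diameter (W (idx p)) \<le> D * (1/2) ^ fst p"
      using False dist[OF p] by (intro diameter_le_dist) (auto simp: W[OF p])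
    then have "diameter (W (idx p)) powr t \<le> (D * (1/2) ^ fst p) powr t"
      using t by (intro powr_mono2) (auto intro: diameter_ge_0 bW)
    also have "\<dots> = D powr t * weight t (fst p)"
      using D by (simp add: powr_mult weight_eq)
    finally show ?thesis
      using False t by (simp add: diam_power_def ennreal_leI flip: ennreal_mult)
  qed (simp add: diam_power_def)
  have "(\<Sum>i. diam_power t (W i)) = (\<integral>\<^sup>+i. diam_power t (W i) * indicator (idx ` U) i \<partial>count_space UNIV)"
    unfolding nn_integral_count_space_nat[symmetric] by (intro nn_integral_cong) (auto simp: W_def diam_power_def indicator_def)
  also have "\<dots> = (\<integral>\<^sup>+i. diam_power t (W i) \<partial>count_space (idx ` U))"
    by (simp add: nn_integral_count_space_indicator)
  also have "\<dots> = (\<integral>\<^sup>+p. diam_power t (W (idx p)) \<partial>count_space U)"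
    by (rule nn_integral_bij_count_space[symmetric]) (simp add: inj bij_betw_def)
  also have "\<dots> \<le> (\<integral>\<^sup>+p. ennreal (D powr t) * ennreal (weight t (fst p)) \<partial>count_space U)"
    using le by (intro nn_integral_mono) simp
  also have "\<dots> = ennreal (D powr t) * cost t U" unfolding cost_def by (rule nn_integral_cmult) simp
  also have "\<dots> < ennreal (D powr t) * ennreal (e / D powr t)"
    using U(2) D by (intro ennreal_mult_strict_left_mono) auto
  also have "\<dots> = ennreal e" using D e by (simp flip: ennreal_mult)
  finally have "(\<Sum>i. diam_power t (W i)) < ennreal e" .
  moreover have "E \<subseteq> (\<Union>i. W i)"
  proof
    fix x assume "x \<in> E"
    then obtain p where p: "p \<in> U" "x \<in> snd p" using Uc by blast
    then have "x \<in> W (idx p)" by (simp add: W)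
    then show "x \<in> (\<Union>i. W i)" by blast
  qed
  ultimately show "\<exists>W::nat \<Rightarrow> 'a set. E \<subseteq> (\<Union>i. W i) \<and> (\<forall>i. bounded (W i)) \<and> (\<Sum>i. diam_power t (W i)) < ennreal e"
    using bW by blast
qed

section \<open>Open covers and finite dyadic covers of null sets\<close>

lemma pow2_scale:
  assumes "0 < d" "d \<le> 1"
  obtains k where "(1/2) ^ Suc k < d" "d \<le> (1/2::real) ^ k"
proof -
  have "\<exists>n. (1/2) ^ n < d" using real_arch_pow_inv[of d "1/2"] assms by auto
  then have L: "(1/2) ^ (LEAST n. (1/2) ^ n < d) < d" by (rule LeastI_ex)
  then obtain k where k: "(LEAST n. (1/2) ^ n < d) = Suc k"
    using assms by (cases "LEAST n. (1/2) ^ n < d") auto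
  have "\<not> (1/2) ^ k < d" using not_less_Least[of k "\<lambda>n. (1/2) ^ n < d"] k by simp
  then show ?thesis using that[of k] L k by simp
qed

text \<open>Each covering set is thickened to an open set of diameter at most \<open>d i\<close>,
  which costs a summable error, and \<open>d i\<close> is rounded up to a power of 1/2, which costs
  a factor \<open>2 powr t\<close>.\<close>

lemma hausdorff_null_dyadic_open_cover:
  fixes E :: "'a::euclidean_space set"
  assumes t: "0 < t" and null: "hausdorff_measure t E = 0" and e: "0 < e"
  shows "\<exists>(G :: nat \<Rightarrow> 'a set) k. (\<forall>i. open (G i)) \<and> E \<subseteq> (\<Union>i. G i)
    \<and> (\<forall>i. \<forall>x\<in>G i. \<forall>y\<in>G i. norm (x - y) \<le> (1/2) ^ k i) \<and> (\<Sum>i. ennreal (weight t (k i))) \<le> ennreal e"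
proof -
  \<comment> \<open>The bound 1/2 keeps \<open>a i\<close>, and with it \<open>d i\<close>, at most
    1, so that a dyadic level exists. The other bound absorbs the factor \<open>2 powr t\<close> and
    the doubling of \<open>e1\<close> by the added errors.\<close>
  define e1 where "e1 = min (1/2) (e / 2 / 2 powr t)"
  have e1: "0 < e1" "e1 \<le> 1/2" "2 powr t * e1 \<le> e / 2"
    using e by (auto simp: e1_def min_def field_simps)
  obtain U where U: "E \<subseteq> (\<Union>i. U i)" "\<And>i::nat. bounded (U i)" "(\<Sum>i. diam_power t (U i)) < ennreal e1"
    using null e1(1) unfolding hausdorff_null_iff[OF t] by metis
  define dm where "dm i = (if U i = {} then 0 else diameter (U i))" for i
  have dm0: "0 \<le> dm i" for i using U(2) by (simp add: dm_def diameter_ge_0)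
  have dp: "diam_power t (U i) = ennreal (dm i powr t)" for i
    using t by (simp add: diam_power_def dm_def)
  have dle: "dm i powr t \<le> e1" for i
  proof -
    have "ennreal (dm i powr t) = (\<Sum>i\<in>{i}. diam_power t (U i))" using dp by simp
    also have "\<dots> \<le> (\<Sum>i. diam_power t (U i))" by (rule sum_le_suminf) auto
    also have "\<dots> \<le> ennreal e1" using U(3) by simp
    finally show ?thesis using e1 by simp
  qed
  \<comment> \<open>The added term makes \<open>d i\<close> strictly larger than
    \<open>dm i\<close>, even for a set of diameter 0, which leaves room for an open
    neighbourhood.\<close>
  define a where "a i = dm i powr t + e1 * (1/2) ^ Suc i" for i
  have half: "0 < (1/2::real) ^ Suc i" "(1/2::real) ^ Suc i \<le> 1" for i
    by (auto simp: power_le_one simp del: power_Suc)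
  have a: "0 < a i" "a i \<le> 1" "dm i powr t < a i" for i
    using dle[of i] e1 half[of i] mult_mono[of e1 "1/2" "(1/2) ^ Suc i" 1]
    by (auto simp: a_def add_nonneg_pos simp del: power_Suc)
  define d where "d i = a i powr (1 / t)" for i
  have d: "0 < d i" "d i \<le> 1" "d i powr t = a i" "dm i < d i" for i
  proof -
    show "0 < d i" using a(1)[of i] by (simp add: d_def)
    show "d i \<le> 1" using a[of i] t by (simp add: d_def powr_le1)
    show dt: "d i powr t = a i" using a(1)[of i] t by (simp add: d_def powr_powr)
    show "dm i < d i"
    proof (rule ccontr)
      assume "\<not> dm i < d i"
      then have "d i powr t \<le> dm i powr t" using t \<open>0 < d i\<close> by (intro powr_mono2) auto
      then show False using a(3)[of i] dt by simp
    qed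
  qed
  have "\<exists>k. (1/2) ^ Suc k < d i \<and> d i \<le> (1/2) ^ k" for i
    using pow2_scale[OF d(1,2)] by metis
  then obtain k where k: "\<And>i. (1/2) ^ Suc (k i) < d i" "\<And>i. d i \<le> (1/2) ^ k i" by metis
  define G where "G i = (\<Union>x\<in>U i. ball x ((d i - dm i) / 2))" for i
  show ?thesis
  proof (intro exI conjI allI ballI)
    show "open (G i)" for i by (auto simp: G_def)
    show "E \<subseteq> (\<Union>i. G i)"
    proof
      fix x assume "x \<in> E"
      then obtain i where "x \<in> U i" using U(1) by blast
      then have "x \<in> G i" using d(4)[of i] by (force simp: G_def)
      then show "x \<in> (\<Union>i. G i)" by blast
    qed
    show "norm (x - y) \<le> (1/2) ^ k i" if xy: "x \<in> G i" "y \<in> G i" for i x y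
    proof -
      obtain x' where x': "x' \<in> U i" "dist x' x < (d i - dm i) / 2" using xy(1) unfolding G_def UN_iff mem_ball by blast
      obtain y' where y': "y' \<in> U i" "dist y' y < (d i - dm i) / 2" using xy(2) unfolding G_def UN_iff mem_ball by blast
      note * = x' y'
      then have "dist x' y' \<le> dm i"
        using diameter_bounded_bound[OF U(2)] by (auto simp: dm_def)
      then have "dist x y \<le> d i"
        using * dist_triangle[of x y x'] dist_triangle[of x' y y'] by (simp add: dist_commute field_simps)
      then show ?thesis using k(2)[of i] by (simp add: dist_norm)
    qed
    have wk: "weight t (k i) \<le> 2 powr t * a i" for i
    proof -
      have "weight t (k i) = (2 * (1/2) ^ Suc (k i)) powr t" by (simp add: weight_eq)
      also have "\<dots> \<le> (2 * d i) powr t" using k(1)[of i] t by (intro powr_mono2) auto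
      also have "\<dots> = 2 powr t * a i" using d(1,3)[of i] by (simp add: powr_mult)
      finally show ?thesis .
    qed
    have "(\<Sum>i. ennreal (weight t (k i))) \<le> (\<Sum>i. ennreal (2 powr t) * (diam_power t (U i) + ennreal (e1 * (1/2) ^ Suc i)))"
    proof (intro suminf_le)
      fix i
      have "ennreal (weight t (k i)) \<le> ennreal (2 powr t * a i)" by (intro ennreal_leI wk)
      also have "\<dots> = ennreal (2 powr t) * ennreal (a i)"
        using a(1)[of i] by (intro ennreal_mult) auto
      also have "ennreal (a i) = ennreal (dm i powr t) + ennreal (e1 * (1/2) ^ Suc i)"
        unfolding a_def using e1 half[of i] by (intro ennreal_plus) (auto simp del: power_Suc)
      also have "ennreal (dm i powr t) = diam_power t (U i)" by (simp add: dp)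
      finally show "ennreal (weight t (k i)) \<le> ennreal (2 powr t) * (diam_power t (U i) + ennreal (e1 * (1/2) ^ Suc i))" .
    qed auto
    also have "\<dots> = ennreal (2 powr t) * ((\<Sum>i. diam_power t (U i)) + (\<Sum>i. ennreal (e1 * (1/2) ^ Suc i)))"
      by (simp add: suminf_add del: power_Suc)
    also have "(\<Sum>i. ennreal (e1 * (1/2) ^ Suc i)) = ennreal e1"
      using sums_mult[OF power_half_series, of e1] e1 by (intro suminf_ennreal_eq) auto
    also have "ennreal (2 powr t) * ((\<Sum>i. diam_power t (U i)) + ennreal e1) \<le> ennreal (2 powr t) * (ennreal e1 + ennreal e1)"
      using U(3) by (intro mult_left_mono add_mono) auto
    also have "\<dots> = ennreal (2 * (2 powr t * e1))"
      using e1 by (simp flip: ennreal_plus ennreal_mult)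
    also have "\<dots> \<le> ennreal e" using e1 by (intro ennreal_leI) simp
    finally show "(\<Sum>i. ennreal (weight t (k i))) \<le> ennreal e" .
  qed
qed

text \<open>In each coordinate the floors differ from those of a fixed point by at most 1, which
  leaves three values.\<close>

lemma card_cells_small:
  fixes S :: "'a::euclidean_space set"
  assumes "\<And>x y. x \<in> S \<Longrightarrow> y \<in> S \<Longrightarrow> norm (x - y) \<le> (1/2) ^ k"
  shows "finite (cell k ` S) \<and> card (cell k ` S) \<le> 3 ^ DIM('a)"
proof (cases "S = {}")
  case False
  then obtain x0 where x0: "x0 \<in> S" by blast
  define Z where "Z b = {\<lfloor>2 ^ k * (x0 \<bullet> b)\<rfloor> - 1..\<lfloor>2 ^ k * (x0 \<bullet> b)\<rfloor> + 1}" for b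
  have "\<lfloor>2 ^ k * (x \<bullet> b)\<rfloor> \<in> Z b" if x: "x \<in> S" and b: "b \<in> Basis" for x b
  proof -
    have "\<bar>(x - x0) \<bullet> b\<bar> \<le> (1/2) ^ k" using Basis_le_norm[OF b, of "x - x0"] assms[OF x x0] by linarith
    then have "2 ^ k * \<bar>(x - x0) \<bullet> b\<bar> \<le> 2 ^ k * (1/2) ^ k" by (intro mult_left_mono) auto
    also have "2 ^ k * (1/2::real) ^ k = 1" by (simp add: power_divide)
    also have "2 ^ k * \<bar>(x - x0) \<bullet> b\<bar> = \<bar>2 ^ k * (x \<bullet> b) - 2 ^ k * (x0 \<bullet> b)\<bar>"
      by (simp add: inner_diff_left abs_mult flip: right_diff_distrib)
    finally show ?thesis unfolding Z_def atLeastAtMost_iff by linarith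
  qed
  from cell_image_finite[of S k Z, OF this] show ?thesis by (simp add: Z_def)
qed auto

definition cells_meeting :: "nat \<Rightarrow> 'a::euclidean_space set \<Rightarrow> (nat \<times> 'a set) set" where
  "cells_meeting k S = (\<lambda>x. (k, cell k x)) ` S"

lemma cost_cells_meeting:
  fixes S :: "'a::euclidean_space set"
  assumes "\<And>x y. x \<in> S \<Longrightarrow> y \<in> S \<Longrightarrow> norm (x - y) \<le> (1/2) ^ k"
  shows "finite (cells_meeting k S)" "cost t (cells_meeting k S) \<le> ennreal (3 ^ DIM('a) * weight t k)"
proof -
  have eq: "cells_meeting k S = Pair k ` cell k ` S" by (auto simp: cells_meeting_def)
  have c: "finite (cell k ` S)" "card (cell k ` S) \<le> 3 ^ DIM('a)" using card_cells_small[of S k] assms by auto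
  then show fin: "finite (cells_meeting k S)" by (simp add: eq)
  have "card (cells_meeting k S) \<le> 3 ^ DIM('a)" using c card_image_le[OF c(1), of "Pair k"] unfolding eq by linarith
  moreover have "(\<Sum>p\<in>cells_meeting k S. weight t (fst p)) = real (card (cells_meeting k S)) * weight t k"
    by (subst sum.cong[OF refl, where h = "\<lambda>_. weight t k"]) (auto simp: cells_meeting_def)
  moreover have "real (3 ^ DIM('a)) = 3 ^ DIM('a)" by simp
  ultimately show "cost t (cells_meeting k S) \<le> ennreal (3 ^ DIM('a) * weight t k)"
    unfolding cost_finite[OF fin] by (intro ennreal_leI) (metis mult_right_mono of_nat_mono weight_pos(2))
qed

text \<open>Cells are half-open, so the union of a cheap cover by cells need not be a neighbourhood.
  The open set comes from a Hausdorff cover, each member of which meets at most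
  \<open>3 ^ DIM('a)\<close> cells of its level.\<close>

lemma hausdorff_null_open_superset:
  fixes E :: "'a::euclidean_space set"
  assumes t: "0 < t" and null: "hausdorff_measure t E = 0" and e: "0 < e"
  shows "\<exists>V. open V \<and> E \<subseteq> V \<and> net_content t V \<le> ennreal e"
proof -
  have e3: "0 < e / 3 ^ DIM('a)" using e by simp
  obtain G k where G: "\<And>i. open (G i)" "E \<subseteq> (\<Union>i. G i)"
      "\<And>i x y. x \<in> G i \<Longrightarrow> y \<in> G i \<Longrightarrow> norm (x - y) \<le> (1/2) ^ k i"
      "(\<Sum>i. ennreal (weight t (k i))) \<le> ennreal (e / 3 ^ DIM('a))"
    using hausdorff_null_dyadic_open_cover[OF t null e3] by blast
  have "(\<Union>i. cells_meeting (k i) (G i)) \<in> cover_of (\<Union>i. G i)"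
    unfolding cover_of_def
  proof (intro CollectI conjI subsetI)
    fix p assume "p \<in> (\<Union>i. cells_meeting (k i) (G i))"
    then show "p \<in> cells" by (auto simp: cells_meeting_def cells_def)
  next
    fix x assume "x \<in> (\<Union>i. G i)"
    then obtain i where "x \<in> G i" by blast
    then have "(k i, cell (k i) x) \<in> (\<Union>i. cells_meeting (k i) (G i))" by (auto simp: cells_meeting_def)
    then show "x \<in> \<Union>(snd ` (\<Union>i. cells_meeting (k i) (G i)))" by force
  qed
  then have "net_content t (\<Union>i. G i) \<le> cost t (\<Union>i. cells_meeting (k i) (G i))" by (rule net_content_le)
  also have "\<dots> \<le> (\<Sum>i. cost t (cells_meeting (k i) (G i)))" by (rule cost_UN_le)
  also have "\<dots> \<le> (\<Sum>i. ennreal (3 ^ DIM('a)) * ennreal (weight t (k i)))"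
    using cost_cells_meeting(2)[OF G(3)] by (intro suminf_le) (auto simp flip: ennreal_mult)
  also have "\<dots> = ennreal (3 ^ DIM('a)) * (\<Sum>i. ennreal (weight t (k i)))" by simp
  also have "\<dots> \<le> ennreal (3 ^ DIM('a)) * ennreal (e / 3 ^ DIM('a))"
    using G(4) by (intro mult_left_mono) auto
  also have "\<dots> = ennreal e" using e by (simp flip: ennreal_mult)
  finally show ?thesis using G(1,2) by (intro exI[of _ "\<Union>i. G i"]) auto
qed

text \<open>The finite subcover is extracted from open sets, and only afterwards replaced by cells,
  which are not open.\<close>

lemma compact_null_finite_cells:
  fixes K :: "'a::euclidean_space set"
  assumes t: "0 < t" and null: "hausdorff_measure t K = 0" and K: "compact K" and e: "0 < e"
  obtains U where "finite U" "U \<subseteq> cells" "K \<subseteq> \<Union>(snd ` U)" "(\<Sum>p\<in>U. weight t (fst p)) \<le> e"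
proof -
  have e3: "0 < e / 3 ^ DIM('a)" using e by simp
  obtain G k where G: "\<And>i. open (G i)" "K \<subseteq> (\<Union>i. G i)"
      "\<And>i x y. x \<in> G i \<Longrightarrow> y \<in> G i \<Longrightarrow> norm (x - y) \<le> (1/2) ^ k i"
      "(\<Sum>i. ennreal (weight t (k i))) \<le> ennreal (e / 3 ^ DIM('a))"
    using hausdorff_null_dyadic_open_cover[OF t null e3] by blast
  obtain I where I: "finite I" "K \<subseteq> (\<Union>i\<in>I. G i)"
    using compactE_image[OF K, of UNIV G] G(1,2) by auto
  define U where "U = (\<Union>i\<in>I. cells_meeting (k i) (G i))"
  have fU: "finite U" using I cost_cells_meeting(1)[OF G(3)] by (auto simp: U_def)
  show ?thesis
  proof (rule that)
    show "finite U" by fact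
    show "U \<subseteq> cells" by (auto simp: U_def cells_meeting_def cells_def)
    show "K \<subseteq> \<Union>(snd ` U)"
    proof
      fix x assume "x \<in> K"
      then obtain i where "i \<in> I" "x \<in> G i" using I(2) by blast
      then have "(k i, cell (k i) x) \<in> U" by (auto simp: U_def cells_meeting_def)
      then show "x \<in> \<Union>(snd ` U)" by force
    qed
    have "cost t U \<le> (\<Sum>i. cost t (if i \<in> I then cells_meeting (k i) (G i) else {}))"
    proof -
      have "U = (\<Union>i. if i \<in> I then cells_meeting (k i) (G i) else {})" by (auto simp: U_def split: if_splits)
      then show ?thesis using cost_UN_le[of t "\<lambda>i. if i \<in> I then cells_meeting (k i) (G i) else {}"] by simp
    qed
    also have "\<dots> \<le> (\<Sum>i. ennreal (3 ^ DIM('a)) * ennreal (weight t (k i)))"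
      using cost_cells_meeting(2)[OF G(3)] by (intro suminf_le) (auto simp flip: ennreal_mult)
    also have "\<dots> = ennreal (3 ^ DIM('a)) * (\<Sum>i. ennreal (weight t (k i)))" by simp
    also have "\<dots> \<le> ennreal (3 ^ DIM('a)) * ennreal (e / 3 ^ DIM('a))"
      using G(4) by (intro mult_left_mono) auto
    also have "\<dots> = ennreal e" using e by (simp flip: ennreal_mult)
    finally show "(\<Sum>p\<in>U. weight t (fst p)) \<le> e"
      using e by (simp add: cost_finite[OF fU] ennreal_le_iff)
  qed
qed

section \<open>Discretized exceptional sets\<close>

lemma weight_less_one: "0 < t \<Longrightarrow> 2 powr (- t) < (1::real)"
  by (simp add: powr_less_one)

lemma weight_mono: "0 \<le> t \<Longrightarrow> k \<le> l \<Longrightarrow> weight t l \<le> weight t k"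
  unfolding weight_def by (rule power_decreasing) (auto simp: powr_minus inverse_le_1_iff ge_one_powr_ge_zero)

lemma weight_add: "weight t (k + l) = weight t k * weight t l"
  by (simp add: weight_def power_add)

lemma weight_mult: "weight s k * weight t k = weight (s + t) k"
  unfolding weight_def power_mult_distrib[symmetric] powr_add[symmetric] by simp

lemma weight_divide: "weight s k / weight t k = weight (s - t) k"
  using weight_mult[of "s - t" k t] by (simp add: field_simps)

lemma weight_zero [simp]: "weight t 0 = 1"
  by (simp add: weight_def)

lemma sum_weight_le:
  assumes "0 < t"
  shows "(\<Sum>k\<le>m. weight t k) \<le> 1 / (1 - 2 powr (- t))"
proof -
  have "(\<Sum>k\<le>m. weight t k) \<le> (\<Sum>k. weight t k)"
    unfolding weight_def using weight_less_one[OF assms]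
    by (intro sum_le_suminf summable_geometric) auto
  also have "\<dots> = 1 / (1 - 2 powr (- t))"
    unfolding weight_def using weight_less_one[OF assms] by (intro suminf_geometric) auto
  finally show ?thesis .
qed

lemma sum_Basis_real2: "l1 (z::real^2) = \<bar>z $ 1\<bar> + \<bar>z $ 2\<bar>"
proof -
  have B: "(Basis :: (real^2) set) = {axis 1 1, axis 2 1}"
    by (auto simp: Basis_vec_def UNIV_2)
  have "axis 1 (1::real) \<noteq> (axis 2 1 :: real^2)"
    by (simp add: axis_eq_axis)
  then have "l1 z = \<bar>z \<bullet> axis 1 1\<bar> + \<bar>z \<bullet> axis 2 1\<bar>"
    unfolding B by (subst sum.insert) auto
  then show ?thesis by (simp add: inner_axis)
qed

abbreviation energy :: "(real^2) set \<Rightarrow> (real^2 \<Rightarrow> real) \<Rightarrow> (real^2 \<Rightarrow> real) \<Rightarrow> real" where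
  "energy P w K \<equiv> \<Sum>p\<in>P. \<Sum>q\<in>P. w p * w q * K (p - q)"

text \<open>Up to the factor \<open>sqrt (1 + b\<^sup>2)\<close> this is the orthogonal projection
  onto the line spanned by \<open>(1, b)\<close>.\<close>

definition lproj :: "real \<Rightarrow> real^2 \<Rightarrow> real" where
  "lproj b x = x $ 1 + b * x $ 2"

lemma lproj_diff: "lproj b (x - y) = lproj b x - lproj b y"
  by (simp add: lproj_def algebra_simps)

lemma continuous_on_lproj: "continuous_on S (lproj b)"
  unfolding lproj_def by (intro continuous_intros)

text \<open>The bound \<open>m\<close> on the levels matches the levels at which weights with
  \<open>frostman t m\<close> are controlled.\<close>

definition covered :: "real \<Rightarrow> nat \<Rightarrow> real \<Rightarrow> real set \<Rightarrow> bool" where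
  "covered t m e S \<longleftrightarrow> (\<exists>U. finite U \<and> U \<subseteq> cells \<and> (\<forall>p\<in>U. fst p \<le> m) \<and> S \<subseteq> \<Union>(snd ` U)
      \<and> (\<Sum>p\<in>U. weight t (fst p)) \<le> e)"

lemma covered_subset:
  assumes "covered t m e T" "S \<subseteq> T"
  shows "covered t m e S"
proof -
  obtain U where "finite U" "U \<subseteq> cells" "\<forall>p\<in>U. fst p \<le> m" "T \<subseteq> \<Union>(snd ` U)" "(\<Sum>p\<in>U. weight t (fst p)) \<le> e"
    using assms(1) unfolding covered_def by blast
  moreover from this have "S \<subseteq> \<Union>(snd ` U)" using assms(2) by blast
  ultimately show ?thesis unfolding covered_def by blast
qed

lemma ennreal_pos_lower:
  fixes x :: ennreal
  assumes "0 < x"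
  obtains c where "0 < c" "ennreal c < x"
proof -
  obtain y where y: "0 < y" "y < x" using dense[OF assms] by blast
  then have "y < \<top>" by (simp add: order_less_le_trans[OF _ top_greatest])
  then obtain c where "y = ennreal c" "0 \<le> c" by (cases y) auto
  then show ?thesis using that[of c] y by (cases "c = 0") auto
qed

text \<open>The form shared by both classical estimates: \<open>w\<close> lives on the set,
  \<open>\<nu>\<close> on the exceptional slopes, and \<open>e\<close> bounds the cost of the covers
  of the projections. What matters is that \<open>C\<close> depends on neither \<open>m\<close> nor
  \<open>e\<close>.\<close>

definition discrete_bound :: "real \<Rightarrow> real \<Rightarrow> real \<Rightarrow> real \<Rightarrow> real \<Rightarrow> bool" where
  "discrete_bound s t \<tau> R C \<longleftrightarrow> (\<forall>m P w Q \<nu> e. frostman s m P w \<longrightarrow> frostman \<tau> m Q \<nu> \<longrightarrow> P \<subseteq> cball 0 R \<longrightarrow>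
     Q \<subseteq> {-1..1} \<longrightarrow> 0 < e \<longrightarrow> (\<forall>b\<in>Q. covered t m e (lproj b ` P)) \<longrightarrow> (sum w P)\<^sup>2 * sum \<nu> Q \<le> C * e)"

text \<open>The sets \<open>F m\<close> in the proof, where finite covers by cells of level at most \<open>m\<close> suffice, increase to the
  exceptional set. Their contents are bounded uniformly in \<open>m\<close>, and no measurability of them is needed.\<close>

lemma exceptional_null:
  fixes A :: "(real^2) set"
  assumes A: "A \<in> sets borel" "hausdorff_measure s A \<noteq> 0" and pos: "0 < s" "0 < t" "0 < \<tau>"
    and key: "\<And>R. 0 < R \<Longrightarrow> \<exists>C\<ge>0. discrete_bound s t \<tau> R C"
  shows "hausdorff_measure \<tau> {b\<in>{-1..1}. hausdorff_measure t (lproj b ` A) = 0} = 0"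
proof -
  have "net_content s A \<noteq> 0" using A pos hausdorff_null_of_net_content by blast
  moreover have "A = (\<Union>n. A \<inter> cball 0 (real n))"
    using real_arch_simple by (fastforce simp: mem_cball)
  ultimately obtain n where n: "net_content s (A \<inter> cball 0 (real n)) \<noteq> 0"
    using net_content_UN_null[of s "\<lambda>n. A \<inter> cball 0 (real n)"] by metis
  define R where "R = real n + 1"
  have "0 < net_content s (A \<inter> cball 0 (real n))" using n by (simp add: zero_less_iff_neq_zero)
  then obtain c where c: "0 < c" "ennreal c < net_content s (A \<inter> cball 0 (real n))"
    by (rule ennreal_pos_lower)
  have sA: "souslin (A \<inter> cball 0 (real n))" using A(1) by (intro souslin_borel) auto
  have bA: "bounded (A \<inter> cball 0 (real n))" by (simp add: bounded_Int)
  obtain K where K: "compact K" "K \<subseteq> A \<inter> cball 0 (real n)"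
      "\<And>V. open V \<Longrightarrow> K \<subseteq> V \<Longrightarrow> ennreal c < net_content s V"
    using souslin_compact_approx[OF sA bA c(2)] by metis
  have KR: "K \<subseteq> cball 0 R" using K(2) by (auto simp: R_def)
  \<comment> \<open>So far only the open neighbourhoods of \<open>K\<close> are known to have
    content above \<open>c\<close>. If \<open>K\<close> were null, one of them would have content at
    most \<open>c\<close>.\<close>
  have "net_content s K \<noteq> 0"
  proof
    assume "net_content s K = 0"
    then have "hausdorff_measure s K = 0" using pos hausdorff_null_of_net_content by blast
    then obtain V where "open V" "K \<subseteq> V" "net_content s V \<le> ennreal c"
      using hausdorff_null_open_superset[of s K c] pos c by blast
    then show False using K(3)[of V] by simp
  qed
  then have "0 < net_content s K" by (simp add: zero_less_iff_neq_zero)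
  then obtain c0 where c0: "0 < c0" "ennreal c0 < net_content s K" by (rule ennreal_pos_lower)
  have "0 < R" by (simp add: R_def)
  then obtain C where C: "0 \<le> C" "discrete_bound s t \<tau> R C" using key by blast
  define E where "E = {b\<in>{-1..1}. hausdorff_measure t (lproj b ` A) = 0}"
  have main: "net_content \<tau> E \<le> ennreal (C * e / c0\<^sup>2)" if e: "0 < e" for e
  proof -
    define F where "F m = {b\<in>{-1..1}. covered t m e (lproj b ` K)}" for m
    have "incseq F"
    proof (rule incseq_SucI)
      fix m
      have "covered t (Suc m) e S" if "covered t m e S" for S
        using that unfolding covered_def by (meson le_SucI)
      then show "F m \<subseteq> F (Suc m)" by (auto simp: F_def)
    qed
    have EF: "E \<subseteq> (\<Union>m. F m)"
    proof
      fix b assume b: "b \<in> E"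
      then have "hausdorff_measure t (lproj b ` K) = 0"
        using K(2) pos by (intro hausdorff_null_subset[of t "lproj b ` A" "lproj b ` K"]) (auto simp: E_def)
      moreover have "compact (lproj b ` K)"
        by (intro compact_continuous_image continuous_on_lproj K)
      ultimately obtain U where U: "finite U" "U \<subseteq> cells" "lproj b ` K \<subseteq> \<Union>(snd ` U)" "(\<Sum>p\<in>U. weight t (fst p)) \<le> e"
        using compact_null_finite_cells[OF pos(2) _ _ e] by metis
      obtain m where "\<And>p. p \<in> U \<Longrightarrow> fst p \<le> m"
        using finite_nat_set_iff_bounded_le[of "fst ` U"] U(1) by auto
      then have "b \<in> F m" using U b unfolding F_def covered_def E_def by blast
      then show "b \<in> (\<Union>m. F m)" by blast
    qed
    have "net_content \<tau> (F m) \<le> ennreal (C * e / c0\<^sup>2)" for m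
    proof -
      obtain P w where P: "frostman s m P w" "P \<subseteq> K" "net_content s K \<le> ennreal (sum w P)"
        using frostman_exists[OF compact_imp_bounded[OF K(1)]] by blast
      have "bounded (F m)"
        by (rule bounded_subset[of "{-1..1::real}"]) (auto simp: F_def)
      then obtain Q \<nu> where Q: "frostman \<tau> m Q \<nu>" "Q \<subseteq> F m" "net_content \<tau> (F m) \<le> ennreal (sum \<nu> Q)"
        using frostman_exists by blast
      have "ennreal c0 < ennreal (sum w P)" using c0(2) P(3) by (rule order_less_le_trans)
      then have cP: "c0 \<le> sum w P" using c0(1) by (simp add: ennreal_less_iff)
      have nu0: "0 \<le> sum \<nu> Q" using Q(1) by (auto simp: frostman_def intro: sum_nonneg)
      have "\<forall>b\<in>Q. covered t m e (lproj b ` P)"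
      proof
        fix b assume "b \<in> Q"
        then have "covered t m e (lproj b ` K)" using Q(2) by (auto simp: F_def)
        then show "covered t m e (lproj b ` P)"
          by (rule covered_subset) (rule image_mono[OF P(2)])
      qed
      moreover have "P \<subseteq> cball 0 R" "Q \<subseteq> {-1..1}" using P(2) KR Q(2) by (auto simp: F_def)
      ultimately have "(sum w P)\<^sup>2 * sum \<nu> Q \<le> C * e"
        using C(2) P(1) Q(1) e unfolding discrete_bound_def by blast
      moreover have "c0\<^sup>2 * sum \<nu> Q \<le> (sum w P)\<^sup>2 * sum \<nu> Q"
        using c0 cP nu0 by (intro mult_right_mono power_mono) auto
      ultimately have "sum \<nu> Q \<le> C * e / c0\<^sup>2" using c0 by (simp add: field_simps)
      then show ?thesis using Q(3) ennreal_leI order_trans by blast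
    qed
    then have "net_content \<tau> (\<Union>m. F m) \<le> ennreal (C * e / c0\<^sup>2)"
      using \<open>incseq F\<close> by (intro net_content_incseq_le)
    then show ?thesis using net_content_mono[OF EF] order_trans by blast
  qed
  have "net_content \<tau> E \<le> 0"
  proof (rule ennreal_le_epsilon)
    fix d :: real assume d: "0 < d"
    \<comment> \<open>\<open>main\<close> is used with \<open>e = d * c0\<^sup>2 / (C + 1)\<close>;
      the summand 1 avoids division by zero when \<open>C = 0\<close>.\<close>
    have "net_content \<tau> E \<le> ennreal (C * (d * c0\<^sup>2 / (C + 1)) / c0\<^sup>2)"
      using d c0 C(1) by (intro main) (simp add: add_nonneg_pos)
    also have "\<dots> \<le> ennreal d"
    proof (intro ennreal_leI)
      have "C * (d * c0\<^sup>2 / (C + 1)) / c0\<^sup>2 = d * (C / (C + 1))" using c0 by simp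
      also have "\<dots> \<le> d * 1" using d C(1) by (intro mult_left_mono) auto
      finally show "C * (d * c0\<^sup>2 / (C + 1)) / c0\<^sup>2 \<le> d" by simp
    qed
    finally show "net_content \<tau> E \<le> 0 + ennreal d" by simp
  qed
  then have "hausdorff_measure \<tau> E = 0"
    using pos(3) by (intro hausdorff_null_of_net_content) auto
  then show ?thesis by (simp add: E_def)
qed

section \<open>From a cheap cover to an energy bound\<close>

lemma cauchy_schwarz_weighted:
  fixes x a :: "'i \<Rightarrow> real"
  assumes "\<And>i. i \<in> I \<Longrightarrow> 0 < a i"
  shows "(\<Sum>i\<in>I. x i)\<^sup>2 \<le> (\<Sum>i\<in>I. a i) * (\<Sum>i\<in>I. (x i)\<^sup>2 / a i)"
proof -
  have "(\<Sum>i\<in>I. x i)\<^sup>2 = (\<Sum>i\<in>I. sqrt (a i) * (x i / sqrt (a i)))\<^sup>2"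
    using assms by (intro arg_cong[where f = "\<lambda>u. u\<^sup>2"] sum.cong) (auto simp: less_imp_neq[THEN not_sym])
  also have "\<dots> \<le> (\<Sum>i\<in>I. (sqrt (a i))\<^sup>2) * (\<Sum>i\<in>I. (x i / sqrt (a i))\<^sup>2)"
    by (rule Cauchy_Schwarz_ineq_sum)
  also have "\<dots> = (\<Sum>i\<in>I. a i) * (\<Sum>i\<in>I. (x i)\<^sup>2 / a i)"
    using assms by (intro arg_cong2[where f = "(*)"] sum.cong) (auto simp: power_divide less_imp_le)
  finally show ?thesis .
qed

text \<open>Cauchy-Schwarz over the cover bounds the squared mass by \<open>e\<close> times the sum
  of \<open>(M u)\<^sup>2 / weight t (fst u)\<close>. Expanding the square counts pairs in a common
  cell. For a given pair each level contributes at most one cell, and then the two values are within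
  \<open>(1/2) ^ k\<close>.\<close>

lemma cover_energy:
  fixes f :: "'a \<Rightarrow> real"
  assumes P: "finite P" "\<And>p. 0 \<le> w p"
    and U: "finite U" "U \<subseteq> cells" "f ` P \<subseteq> \<Union>(snd ` U)" "(\<Sum>u\<in>U. weight t (fst u)) \<le> e"
    and J: "finite J" "fst ` U \<subseteq> J"
  shows "(sum w P)\<^sup>2 \<le> e * (\<Sum>p\<in>P. \<Sum>q\<in>P. w p * w q * (\<Sum>k\<in>J. of_bool (\<bar>f p - f q\<bar> \<le> (1/2) ^ k) / weight t k))"
proof -
  define M where "M u = (\<Sum>p\<in>P. w p * of_bool (f p \<in> snd u))" for u :: "nat \<times> real set"
  have "sum w P \<le> (\<Sum>p\<in>P. \<Sum>u\<in>U. w p * of_bool (f p \<in> snd u))"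
  proof (intro sum_mono)
    fix p assume "p \<in> P"
    then obtain u where u: "u \<in> U" "f p \<in> snd u" using U(3) by blast
    then have "w p = (\<Sum>u\<in>{u}. w p * of_bool (f p \<in> snd u))" by simp
    also have "\<dots> \<le> (\<Sum>u\<in>U. w p * of_bool (f p \<in> snd u))"
      using U(1) u P by (intro sum_mono2) auto
    finally show "w p \<le> (\<Sum>u\<in>U. w p * of_bool (f p \<in> snd u))" .
  qed
  also have "\<dots> = (\<Sum>u\<in>U. M u)" unfolding M_def by (rule sum.swap)
  finally have "(sum w P)\<^sup>2 \<le> (\<Sum>u\<in>U. M u)\<^sup>2"
    using P by (intro power_mono) (auto intro: sum_nonneg)
  also have "\<dots> \<le> (\<Sum>u\<in>U. weight t (fst u)) * (\<Sum>u\<in>U. (M u)\<^sup>2 / weight t (fst u))"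
    by (rule cauchy_schwarz_weighted) simp
  also have "\<dots> \<le> e * (\<Sum>u\<in>U. (M u)\<^sup>2 / weight t (fst u))"
    using U(4) by (intro mult_right_mono sum_nonneg) auto
  also have "(\<Sum>u\<in>U. (M u)\<^sup>2 / weight t (fst u))
      = (\<Sum>u\<in>U. \<Sum>p\<in>P. \<Sum>q\<in>P. w p * w q * (of_bool (f p \<in> snd u \<and> f q \<in> snd u) / weight t (fst u)))"
    unfolding M_def power2_eq_square sum_product sum_divide_distrib by (intro sum.cong refl) (simp add: of_bool_conj)
  also have "\<dots> = (\<Sum>p\<in>P. \<Sum>u\<in>U. \<Sum>q\<in>P. w p * w q * (of_bool (f p \<in> snd u \<and> f q \<in> snd u) / weight t (fst u)))"
    by (rule sum.swap)
  also have "\<dots> = (\<Sum>p\<in>P. \<Sum>q\<in>P. \<Sum>u\<in>U. w p * w q * (of_bool (f p \<in> snd u \<and> f q \<in> snd u) / weight t (fst u)))"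
    by (intro sum.cong refl sum.swap)
  also have "\<dots> \<le> (\<Sum>p\<in>P. \<Sum>q\<in>P. w p * w q * (\<Sum>k\<in>J. of_bool (\<bar>f p - f q\<bar> \<le> (1/2) ^ k) / weight t k))"
    unfolding sum_distrib_left[symmetric]
  proof (intro sum_mono mult_left_mono)
    fix p q
    have cell: "u = (fst u, cell (fst u) (f p))" if "u \<in> U" "f p \<in> snd u" for u
      using cells_eqI[of "fst u" "snd u" "f p"] that U(2) by (auto simp: prod_eq_iff)
    define V where "V = {u\<in>U. f p \<in> snd u \<and> f q \<in> snd u}"
    have inj: "inj_on fst V" using cell unfolding V_def inj_on_def by (metis (no_types, lifting) mem_Collect_eq)
    have "(\<Sum>u\<in>U. of_bool (f p \<in> snd u \<and> f q \<in> snd u) / weight t (fst u)) = (\<Sum>u\<in>V. 1 / weight t (fst u))"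
      using U(1) by (intro sum.mono_neutral_cong_right) (auto simp: V_def)
    also have "\<dots> = (\<Sum>k\<in>fst ` V. 1 / weight t k)" using inj by (simp add: sum.reindex)
    also have "\<dots> \<le> (\<Sum>k\<in>fst ` V. of_bool (\<bar>f p - f q\<bar> \<le> (1/2) ^ k) / weight t k)"
    proof (intro sum_mono)
      fix k assume "k \<in> fst ` V"
      then obtain u where u: "u \<in> V" "k = fst u" by blast
      then have "f q \<in> cell k (f p)" using cell[of u] unfolding V_def by (metis (no_types, lifting) mem_Collect_eq snd_conv)
      then have "\<bar>f p - f q\<bar> \<le> (1/2) ^ k" using cell_norm_diff_le[of "f p" k "f p" "f q"] by simp
      then show "1 / weight t k \<le> of_bool (\<bar>f p - f q\<bar> \<le> (1/2) ^ k) / weight t k" by simp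
    qed
    also have "\<dots> \<le> (\<Sum>k\<in>J. of_bool (\<bar>f p - f q\<bar> \<le> (1/2) ^ k) / weight t k)"
      using J by (intro sum_mono2) (auto simp: V_def)
    finally show "(\<Sum>u\<in>U. of_bool (f p \<in> snd u \<and> f q \<in> snd u) / weight t (fst u))
        \<le> (\<Sum>k\<in>J. of_bool (\<bar>f p - f q\<bar> \<le> (1/2) ^ k) / weight t k)" .
  qed (use P in auto)
  finally show ?thesis
    using U(4) P sum_nonneg[of U "\<lambda>u. weight t (fst u)"] by (simp add: mult_left_mono)
qed

section \<open>Kaufman's estimate\<close>

text \<open>The near-mass bound at level 0 around the origin: \<open>2 * R\<close> bounds the
  \<open>l1\<close> norm in the plane, and \<open>144 = 12 ^ 2\<close>.\<close>

lemma frostman_total_mass_le: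
  fixes P :: "(real^2) set"
  assumes "frostman s m P w" "P \<subseteq> cball 0 R"
  shows "sum w P \<le> exp (2 * R) * 144"
proof -
  have "l1 (p - 0) \<le> 2 * R * (1/2) ^ 0" if "p \<in> P" for p
  proof -
    have "norm p \<le> R" using that assms(2) by auto
    then show ?thesis
      using component_le_norm_cart[of p 1] component_le_norm_cart[of p 2]
      unfolding sum_Basis_real2 by simp
  qed
  then show ?thesis
    using frostman_near_mass[OF assms(1) le0 order_refl, of 0 "2 * R"] by simp
qed

lemma frostman_slopes_total_mass_le:
  fixes Q :: "real set"
  assumes "frostman \<tau> m Q \<nu>" "Q \<subseteq> {-1..1}"
  shows "sum \<nu> Q \<le> exp 1 * 12"
proof -
  have "l1 (p - 0) \<le> 1 * (1/2) ^ 0" if "p \<in> Q" for p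
  proof -
    have "p \<in> {-1..1}" using that assms(2) by blast
    then show ?thesis by (simp add: abs_le_iff)
  qed
  then show ?thesis
    using frostman_near_mass[OF assms(1) le0 order_refl, of 0 1] by simp
qed

text \<open>For \<open>z = (z1, z2)\<close> the set of slopes \<open>b\<close> with \<open>\<bar>z1 + b z2\<bar> \<le> 2^-k\<close> is an interval of length
  comparable to \<open>2^-k / \<bar>z\<bar>\<close>, since \<open>z2\<close> is comparable to \<open>z\<close> whenever that set is nonempty and \<open>z\<close> is not too small.\<close>

lemma slopes_mass_le:
  fixes z :: "real^2"
  assumes fr: "frostman \<tau> m Q \<nu>" and Q: "Q \<subseteq> {-1..1}" and k: "k \<le> m" and tau: "0 < \<tau>"
    and z: "\<bar>z $ 1\<bar> + \<bar>z $ 2\<bar> \<le> B" and B: "1 \<le> B"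
  shows "(\<Sum>b\<in>Q. \<nu> b * of_bool (\<bar>lproj b z\<bar> \<le> (1/2) ^ k))
     \<le> exp 1 * 12 / weight \<tau> 3 * weight \<tau> k *
       (\<Sum>l\<le>m. (1 / weight \<tau> l) * of_bool (\<bar>z $ 1\<bar> + \<bar>z $ 2\<bar> \<le> B * (1/2) ^ l))"
proof -
  let ?n = "\<bar>z $ 1\<bar> + \<bar>z $ 2\<bar>"
  define D where "D = {b\<in>Q. \<bar>lproj b z\<bar> \<le> (1/2) ^ k}"
  note nu = frostmanD(1,2)[OF fr]
  have lhs: "(\<Sum>b\<in>Q. \<nu> b * of_bool (\<bar>lproj b z\<bar> \<le> (1/2) ^ k)) = sum \<nu> D"
    unfolding D_def using nu by (intro sum.mono_neutral_cong_right) auto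
  have DQ: "D \<subseteq> Q" by (auto simp: D_def)
  \<comment> \<open>\<open>l\<close> records the dyadic size of \<open>z\<close>: \<open>?n\<close>
    is at most \<open>B * (1/2) ^ l\<close>, and for \<open>l < m\<close> it exceeds half of
    that.\<close>
  define l where "l = Max {l. l \<le> m \<and> ?n \<le> B * (1/2) ^ l}"
  have fin: "finite {l. l \<le> m \<and> ?n \<le> B * (1/2) ^ l}" by simp
  have "l \<in> {l. l \<le> m \<and> ?n \<le> B * (1/2) ^ l}"
    unfolding l_def using z by (intro Max_in fin) (auto intro!: exI[of _ 0])
  then have l: "l \<le> m" "?n \<le> B * (1/2) ^ l" by auto
  have lmax: "j \<le> l" if "j \<le> m" "?n \<le> B * (1/2) ^ j" for j
    unfolding l_def using that by (intro Max_ge fin) simp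
  have "1 / weight \<tau> l = (\<Sum>l\<in>{l}. (1 / weight \<tau> l) * of_bool (?n \<le> B * (1/2) ^ l))"
    using l by simp
  also have "\<dots> \<le> (\<Sum>l\<le>m. (1 / weight \<tau> l) * of_bool (?n \<le> B * (1/2) ^ l))"
    using l by (intro sum_mono2) auto
  finally have rhs: "1 / weight \<tau> l \<le> (\<Sum>l\<le>m. (1 / weight \<tau> l) * of_bool (?n \<le> B * (1/2) ^ l))" .
  have "sum \<nu> D \<le> exp 1 * 12 / weight \<tau> 3 * weight \<tau> k * (1 / weight \<tau> l)"
  \<comment> \<open>For \<open>k \<le> l + 3\<close> the total mass of \<open>\<nu>\<close> is
    already good enough; the factor \<open>1 / weight \<tau> 3\<close> in the constant pays for the
    three extra levels.\<close>
  proof (cases "k \<le> l + 3 \<or> D = {}")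
    case True
    show ?thesis
    proof (cases "D = {}")
      case False
      then have "weight \<tau> (l + 3) \<le> weight \<tau> k" using True tau by (intro weight_mono) auto
      then have "1 \<le> weight \<tau> k / (weight \<tau> l * weight \<tau> 3)" by (simp add: weight_add field_simps)
      then have "exp 1 * 12 * 1 \<le> exp 1 * 12 * (weight \<tau> k / (weight \<tau> l * weight \<tau> 3))"
        by (intro mult_left_mono) auto
      moreover have "sum \<nu> D \<le> sum \<nu> Q" using nu DQ by (intro sum_mono2) auto
      ultimately show ?thesis
        using frostman_slopes_total_mass_le[OF fr Q] by (simp add: mult_ac)
    qed simp
  next
    case False
    then have kl: "l + 3 < k" by simp
    obtain b1 where b1: "b1 \<in> Q" "\<bar>lproj b1 z\<bar> \<le> (1/2) ^ k" using False by (auto simp: D_def)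
    have "\<not> ?n \<le> B * (1/2) ^ Suc l"
      using lmax[of "Suc l"] kl k by auto
    moreover have "(1/2) ^ Suc l \<le> B * (1/2) ^ Suc l"
      using B mult_right_mono[of 1 B "(1/2) ^ Suc l"] by (simp del: power_Suc)
    ultimately have n_gt: "(1/2) ^ Suc l < ?n" by linarith
    have "\<bar>b1 * z $ 2\<bar> \<le> \<bar>z $ 2\<bar>"
      using b1 Q by (auto simp: abs_mult abs_le_iff intro!: mult_left_le_one_le)
    then have z1: "\<bar>z $ 1\<bar> \<le> (1/2) ^ k + \<bar>z $ 2\<bar>" using b1(2) unfolding lproj_def by linarith
    have "(1/2::real) ^ k \<le> (1/2) ^ (l + 4)" using kl by (intro power_decreasing) auto
    also have "\<dots> = (1/2) ^ Suc l / 8" by (simp add: power_add power_divide)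
    finally have kk: "(1/2::real) ^ k \<le> (1/2) ^ Suc l / 8" .
    have z2: "(1/2) ^ Suc l / 4 \<le> \<bar>z $ 2\<bar>" using z1 n_gt kk by linarith
    have z2': "(1/2) ^ (l + 3) \<le> \<bar>z $ 2\<bar>" using z2 by (simp add: power_add power_divide)
    have z20: "0 < \<bar>z $ 2\<bar>" using z2' by (rule less_le_trans[rotated]) simp
    \<comment> \<open>All admissible slopes lie near the root \<open>- z $ 1 / z $ 2\<close> of
      \<open>lproj b z\<close>, at distance at most
      \<open>(1/2) ^ k / \<bar>z $ 2\<bar>\<close>.\<close>
    have near: "l1 (b - (- z $ 1 / z $ 2)) \<le> 1 * (1/2) ^ (k - (l + 3))" if "b \<in> D" for b
    proof -
      have "\<bar>b - (- z $ 1 / z $ 2)\<bar> * \<bar>z $ 2\<bar> = \<bar>lproj b z\<bar>"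
        using z20 by (simp add: lproj_def field_simps flip: abs_mult)
      also have "\<dots> \<le> (1/2) ^ k" using that by (simp add: D_def)
      also have "\<dots> = (1/2) ^ (k - (l + 3)) * (1/2) ^ (l + 3)" using kl by (simp flip: power_add)
      also have "\<dots> \<le> (1/2) ^ (k - (l + 3)) * \<bar>z $ 2\<bar>" using z2' by (intro mult_left_mono) auto
      finally have "\<bar>b - (- z $ 1 / z $ 2)\<bar> \<le> (1/2) ^ (k - (l + 3))" using z20 by simp
      then show ?thesis by simp
    qed
    have "sum \<nu> D \<le> exp 1 * 12 ^ DIM(real) * weight \<tau> (k - (l + 3))"
      using k near by (intro frostman_near_mass[OF fr _ DQ, where x = "- z $ 1 / z $ 2" and c = 1]) auto
    also have "weight \<tau> (k - (l + 3)) = weight \<tau> k / (weight \<tau> l * weight \<tau> 3)"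
      using kl weight_add[of \<tau> "k - (l + 3)" "l + 3"] by (simp add: weight_add field_simps)
    finally show ?thesis by (simp add: field_simps)
  qed
  also have "\<dots> \<le> exp 1 * 12 / weight \<tau> 3 * weight \<tau> k * (\<Sum>l\<le>m. (1 / weight \<tau> l) * of_bool (?n \<le> B * (1/2) ^ l))"
    using rhs by (intro mult_left_mono) auto
  finally show ?thesis unfolding lhs .
qed

text \<open>The sum over \<open>l\<close> is a dyadic version of the Riesz kernel of order
  \<open>\<tau>\<close>, truncated at scale \<open>(1/2) ^ m\<close>. Against weights of exponent
  \<open>s\<close> the level \<open>l\<close> contributes a multiple of
  \<open>weight (s - \<tau>) l\<close>, a geometric series since \<open>\<tau> < s\<close>.\<close>

lemma truncated_energy_le:
  fixes P :: "(real^2) set"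
  assumes fr: "frostman s m P w" and R: "P \<subseteq> cball 0 R" and st: "\<tau> < s"
  shows "(\<Sum>p\<in>P. \<Sum>q\<in>P. w p * w q * (\<Sum>l\<le>m. (1 / weight \<tau> l) * of_bool (\<bar>(p - q) $ 1\<bar> + \<bar>(p - q) $ 2\<bar> \<le> B * (1/2) ^ l)))
    \<le> exp (2 * R) * 144 * (exp B * 144 / (1 - 2 powr (- (s - \<tau>))))"
proof -
  note P = frostmanD(1,2)[OF fr]
  let ?n = "\<lambda>p q :: real^2. \<bar>(p - q) $ 1\<bar> + \<bar>(p - q) $ 2\<bar>"
  have inner: "(\<Sum>q\<in>P. w q * (\<Sum>l\<le>m. (1 / weight \<tau> l) * of_bool (?n p q \<le> B * (1/2) ^ l)))
      \<le> exp B * 144 / (1 - 2 powr (- (s - \<tau>)))" for p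
  proof -
    have "(\<Sum>q\<in>P. w q * (\<Sum>l\<le>m. (1 / weight \<tau> l) * of_bool (?n p q \<le> B * (1/2) ^ l)))
        = (\<Sum>l\<le>m. (1 / weight \<tau> l) * (\<Sum>q\<in>P. w q * of_bool (?n p q \<le> B * (1/2) ^ l)))"
      unfolding sum_distrib_left by (subst sum.swap) (simp add: algebra_simps)
    also have "\<dots> \<le> (\<Sum>l\<le>m. (1 / weight \<tau> l) * (exp B * 144 * weight s l))"
    proof (intro sum_mono mult_left_mono)
      fix l assume l: "l \<in> {..m}"
      have "(\<Sum>q\<in>P. w q * of_bool (?n p q \<le> B * (1/2) ^ l)) = sum w {q\<in>P. ?n p q \<le> B * (1/2) ^ l}"
        using P by (intro sum.mono_neutral_cong_right) auto
      also have "\<dots> \<le> exp B * 12 ^ DIM(real^2) * weight s l"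
      proof (rule frostman_near_mass[OF fr, where x = p])
        fix q assume "q \<in> {q\<in>P. ?n p q \<le> B * (1/2) ^ l}"
        then show "l1 (q - p) \<le> B * (1/2) ^ l"
          unfolding sum_Basis_real2 by (simp add: abs_minus_commute)
      qed (use l in auto)
      finally show "(\<Sum>q\<in>P. w q * of_bool (?n p q \<le> B * (1/2) ^ l)) \<le> exp B * 144 * weight s l" by simp
    qed auto
    also have "\<dots> = exp B * 144 * (\<Sum>l\<le>m. weight (s - \<tau>) l)"
      unfolding sum_distrib_left weight_divide[symmetric] by (simp add: field_simps)
    also have "\<dots> \<le> exp B * 144 * (1 / (1 - 2 powr (- (s - \<tau>))))"
      using st by (intro mult_left_mono sum_weight_le) auto
    finally show ?thesis by simp
  qed
  have "(\<Sum>p\<in>P. \<Sum>q\<in>P. w p * w q * (\<Sum>l\<le>m. (1 / weight \<tau> l) * of_bool (?n p q \<le> B * (1/2) ^ l)))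
      = (\<Sum>p\<in>P. w p * (\<Sum>q\<in>P. w q * (\<Sum>l\<le>m. (1 / weight \<tau> l) * of_bool (?n p q \<le> B * (1/2) ^ l))))"
    by (simp add: sum_distrib_left mult.assoc)
  also have "\<dots> \<le> (\<Sum>p\<in>P. w p * (exp B * 144 / (1 - 2 powr (- (s - \<tau>)))))"
    using P inner by (intro sum_mono mult_left_mono)
  also have "\<dots> = sum w P * (exp B * 144 / (1 - 2 powr (- (s - \<tau>))))"
    by (rule sum_distrib_right[symmetric])
  also have "\<dots> \<le> exp (2 * R) * 144 * (exp B * 144 / (1 - 2 powr (- (s - \<tau>))))"
    using frostman_total_mass_le[OF fr R] weight_less_one[of "s - \<tau>"] st by (intro mult_right_mono) auto
  finally show ?thesis .
qed

text \<open>\<open>cover_energy\<close> is averaged over the slopes. By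
  \<open>slopes_mass_le\<close> the average at level \<open>k\<close> is at most
  \<open>C1 * weight \<tau> k\<close> times the dyadic Riesz kernel \<open>L\<close>. The sum over
  \<open>k\<close> converges because \<open>t < \<tau>\<close>, and the energy of \<open>L\<close>
  is bounded because \<open>\<tau> < s\<close>.\<close>

lemma kaufman_estimate:
  assumes pos: "0 < t" "t < \<tau>" "\<tau> < s" and R: "0 < R"
  shows "\<exists>C\<ge>0. discrete_bound s t \<tau> R C"
proof -
  \<comment> \<open>\<open>4 * R\<close> bounds the \<open>l1\<close> norm of a difference of two
    points of the disc; the summand 1 ensures \<open>1 \<le> B\<close>.\<close>
  define B where "B = 4 * R + 1"
  define C1 where "C1 = exp 1 * 12 / weight \<tau> 3"
  define C2 where "C2 = 1 / (1 - 2 powr (- (\<tau> - t)))"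
  define C3 where "C3 = exp (2 * R) * 144 * (exp B * 144 / (1 - 2 powr (- (s - \<tau>))))"
  have C: "0 \<le> C1" "0 \<le> C2" "0 \<le> C3"
    using pos weight_less_one[of "\<tau> - t"] weight_less_one[of "s - \<tau>"] by (auto simp: C1_def C2_def C3_def)
  have "discrete_bound s t \<tau> R (C1 * C2 * C3)"
    unfolding discrete_bound_def
  proof (intro allI impI)
    fix m P w Q \<nu> e
    assume fP: "frostman s m P w" and fQ: "frostman \<tau> m Q \<nu>" and PR: "P \<subseteq> cball 0 R"
      and QI: "Q \<subseteq> {-1..1}" and e: "0 < e" and cov: "\<forall>b\<in>Q. covered t m e (lproj b ` P)"
    note P = frostmanD(1,2)[OF fP]
    note nu = frostmanD(1,2)[OF fQ]
    define L where "L p q = (\<Sum>l\<le>m. (1 / weight \<tau> l) * of_bool (\<bar>(p - q) $ 1\<bar> + \<bar>(p - q) $ 2\<bar> \<le> B * (1/2) ^ l))" for p q :: "real^2"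
    have L0: "0 \<le> L p q" for p q by (auto simp: L_def intro!: sum_nonneg)
    define I where "I b k p q = (of_bool (\<bar>lproj b (p - q)\<bar> \<le> (1/2) ^ k) :: real)" for b k p q
    have one: "(sum w P)\<^sup>2 \<le> e * (\<Sum>p\<in>P. \<Sum>q\<in>P. w p * w q * (\<Sum>k\<le>m. I b k p q / weight t k))" if "b \<in> Q" for b
    proof -
      have "covered t m e (lproj b ` P)" using cov \<open>b \<in> Q\<close> by blast
      then obtain U where "finite U" "U \<subseteq> cells" "\<forall>u\<in>U. fst u \<le> m" "lproj b ` P \<subseteq> \<Union>(snd ` U)" "(\<Sum>u\<in>U. weight t (fst u)) \<le> e"
        unfolding covered_def by blast
      then show ?thesis
        unfolding I_def lproj_diff using P by (intro cover_energy[where U = U and J = "{..m}"] finite_atMost) auto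
    qed
    have "(sum w P)\<^sup>2 * sum \<nu> Q = (\<Sum>b\<in>Q. \<nu> b * (sum w P)\<^sup>2)"
      by (simp add: sum_distrib_right mult.commute)
    also have "\<dots> \<le> (\<Sum>b\<in>Q. \<nu> b * (e * (\<Sum>p\<in>P. \<Sum>q\<in>P. w p * w q * (\<Sum>k\<le>m. I b k p q / weight t k))))"
      using nu one by (intro sum_mono mult_left_mono)
    also have "\<dots> = e * (\<Sum>b\<in>Q. \<Sum>p\<in>P. \<Sum>q\<in>P. w p * w q * (\<nu> b * (\<Sum>k\<le>m. I b k p q / weight t k)))"
      by (simp add: sum_distrib_left mult_ac)
    also have "\<dots> = e * (\<Sum>p\<in>P. \<Sum>q\<in>P. \<Sum>b\<in>Q. w p * w q * (\<nu> b * (\<Sum>k\<le>m. I b k p q / weight t k)))"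
      by (subst sum.swap) (intro arg_cong[where f = "(*) e"] sum.cong refl sum.swap)
    also have "\<dots> \<le> e * (\<Sum>p\<in>P. \<Sum>q\<in>P. w p * w q * (C1 * C2 * L p q))"
      unfolding sum_distrib_left[symmetric]
    proof (intro mult_left_mono sum_mono)
      fix p q assume pq: "p \<in> P" "q \<in> P"
      have n: "\<bar>(p - q) $ 1\<bar> + \<bar>(p - q) $ 2\<bar> \<le> B"
      proof -
        have "norm p \<le> R" "norm q \<le> R" using pq PR by auto
        then have "norm (p - q) \<le> 2 * R" using norm_triangle_ineq4[of p q] by linarith
        then show ?thesis
          using component_le_norm_cart[of "p - q" 1] component_le_norm_cart[of "p - q" 2]
          unfolding B_def by linarith
      qed
      have "(\<Sum>b\<in>Q. \<nu> b * (\<Sum>k\<le>m. I b k p q / weight t k)) = (\<Sum>k\<le>m. (1 / weight t k) * (\<Sum>b\<in>Q. \<nu> b * I b k p q))"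
        unfolding sum_distrib_left by (subst sum.swap) simp
      also have "\<dots> \<le> (\<Sum>k\<le>m. (1 / weight t k) * (C1 * weight \<tau> k * L p q))"
        unfolding C1_def L_def I_def using n R pos
        by (intro sum_mono mult_left_mono slopes_mass_le[OF fQ QI]) (auto simp: B_def)
      also have "\<dots> = C1 * L p q * (\<Sum>k\<le>m. weight (\<tau> - t) k)"
        unfolding sum_distrib_left weight_divide[symmetric] by (simp add: field_simps)
      also have "\<dots> \<le> C1 * L p q * C2"
        unfolding C2_def using pos C(1) L0 by (intro mult_left_mono sum_weight_le) auto
      finally show "(\<Sum>b\<in>Q. \<nu> b * (\<Sum>k\<le>m. I b k p q / weight t k)) \<le> C1 * C2 * L p q"
        by (simp add: mult_ac)
    qed (use e P in auto)
    also have "\<dots> = e * (C1 * C2) * (\<Sum>p\<in>P. \<Sum>q\<in>P. w p * w q * L p q)"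
      by (simp add: sum_distrib_left mult_ac)
    also have "\<dots> \<le> e * (C1 * C2) * C3"
      unfolding C3_def L_def using e C pos by (intro mult_left_mono truncated_energy_le[OF fP PR]) auto
    finally show "(sum w P)\<^sup>2 * sum \<nu> Q \<le> C1 * C2 * C3 * e" by (simp add: mult_ac)
  qed
  then show ?thesis using C by (intro exI[of _ "C1 * C2 * C3"]) auto
qed

lemma kaufman_slopes:
  fixes A :: "(real^2) set"
  assumes "A \<in> sets borel" "hausdorff_measure s A \<noteq> 0" "0 < t" "t < \<tau>" "\<tau> < s"
  shows "hausdorff_measure \<tau> {b\<in>{-1..1}. hausdorff_measure t (lproj b ` A) = 0} = 0"
  using assms by (intro exceptional_null[where s = s] kaufman_estimate) auto

section \<open>Falconer's estimate\<close>

text \<open>Real and imaginary parts of the characteristic function of the standard normal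
  distribution, combined by the addition formula.\<close>

lemma std_normal_cos:
  "has_bochner_integral lborel (\<lambda>x. cos (a + t * x) * std_normal_density x) (cos a * exp (- t\<^sup>2 / 2))"
proof -
  have int: "integrable lborel (\<lambda>x. std_normal_density x *\<^sub>R iexp (t * x))"
    by (rule Bochner_Integration.integrable_bound[where f = std_normal_density])
       (auto intro!: integrable_normal_density)
  have "(CLBINT x. std_normal_density x *\<^sub>R iexp (t * x)) = exp (- (complex_of_real t)\<^sup>2 / 2)"
    using fun_cong[OF char_std_normal_distribution, of t]
    unfolding char_def by (subst (asm) integral_density) (auto simp: of_real_exp simp flip: exp_of_real)
  then have I: "has_bochner_integral lborel (\<lambda>x. std_normal_density x *\<^sub>R iexp (t * x)) (complex_of_real (exp (- t\<^sup>2 / 2)))"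
    using int by (simp add: has_bochner_integral_iff flip: exp_of_real)
  have Re: "has_bochner_integral lborel (\<lambda>x. std_normal_density x * cos (t * x)) (exp (- t\<^sup>2 / 2))"
    using has_bochner_integral_bounded_linear[OF bounded_linear_Re I] by (simp add: Re_exp)
  have Im: "has_bochner_integral lborel (\<lambda>x. std_normal_density x * sin (t * x)) 0"
    using has_bochner_integral_bounded_linear[OF bounded_linear_Im I] by (simp add: Im_exp)
  have "has_bochner_integral lborel (\<lambda>x. cos a * (std_normal_density x * cos (t * x)) - sin a * (std_normal_density x * sin (t * x)))
      (cos a * exp (- t\<^sup>2 / 2) - sin a * 0)"
    by (intro has_bochner_integral_diff has_bochner_integral_mult_right Re Im)
  then show ?thesis by (simp add: cos_add algebra_simps)
qed

lemma gauss_cos: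
  assumes c: "0 < c"
  shows "has_bochner_integral lborel (\<lambda>r. cos (a + y * r) * exp (- (c * r\<^sup>2))) (cos a * sqrt (pi / c) * exp (- y\<^sup>2 / (4 * c)))"
proof -
  define d where "d = sqrt (2 * c)"
  have d: "0 < d" "d\<^sup>2 = 2 * c" using c by (auto simp: d_def)
  have "has_bochner_integral lborel (\<lambda>r. cos (a + (y / d) * (0 + d * r)) * std_normal_density (0 + d * r))
      ((cos a * exp (- (y / d)\<^sup>2 / 2)) /\<^sub>R \<bar>d\<bar>)"
    using lborel_has_bochner_integral_real_affine_iff[of d "\<lambda>x. cos (a + (y / d) * x) * std_normal_density x"
        "cos a * exp (- (y / d)\<^sup>2 / 2)" 0] std_normal_cos[of a "y / d"] d by blast
  then have hbi: "has_bochner_integral lborel (\<lambda>r. sqrt (2 * pi) * (cos (a + (y / d) * (0 + d * r)) * std_normal_density (0 + d * r)))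
      (sqrt (2 * pi) * ((cos a * exp (- (y / d)\<^sup>2 / 2)) /\<^sub>R \<bar>d\<bar>))"
    by (rule has_bochner_integral_mult_right) 
  have e1: "sqrt (2 * pi) * (cos (a + (y / d) * (0 + d * r)) * std_normal_density (0 + d * r)) = cos (a + y * r) * exp (- (c * r\<^sup>2))" for r
    using d by (simp add: std_normal_density_def power_mult_distrib)
  have e2: "sqrt (2 * pi) * ((cos a * exp (- (y / d)\<^sup>2 / 2)) /\<^sub>R \<bar>d\<bar>) = cos a * sqrt (pi / c) * exp (- y\<^sup>2 / (4 * c))"
  proof -
    have "sqrt (2 * pi) / d = sqrt (pi / c)"
      using c by (simp add: d_def flip: real_sqrt_divide)
    moreover have "(y / d)\<^sup>2 / 2 = y\<^sup>2 / (4 * c)" using d by (simp add: power_divide)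
    ultimately show ?thesis using d by (simp add: field_simps)
  qed
  show ?thesis using hbi by (simp only: e1 e2)
qed

lemma gauss_cos_shift:
  "has_bochner_integral lborel (\<lambda>x. cos (a + y * x) * exp (- (x - \<mu>)\<^sup>2 / 2)) (cos (a + y * \<mu>) * sqrt (2 * pi) * exp (- y\<^sup>2 / 2))"
proof -
  have "has_bochner_integral lborel (\<lambda>x. cos ((a + y * \<mu>) + y * (- \<mu> + 1 * x)) * exp (- (1/2 * (- \<mu> + 1 * x)\<^sup>2)))
     ((cos (a + y * \<mu>) * sqrt (pi / (1/2)) * exp (- y\<^sup>2 / (4 * (1/2)))) /\<^sub>R \<bar>1\<bar>)"
    using lborel_has_bochner_integral_real_affine_iff[of 1 "\<lambda>x. cos ((a + y * \<mu>) + y * x) * exp (- (1/2 * x\<^sup>2))"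
        "cos (a + y * \<mu>) * sqrt (pi / (1/2)) * exp (- y\<^sup>2 / (4 * (1/2)))" "- \<mu>"] gauss_cos[of "1/2" "a + y * \<mu>" y] by simp
  then show ?thesis by (simp add: algebra_simps)
qed

text \<open>The squared modulus of the exponential sum with coefficients \<open>v p\<close> and
  phases \<open>\<theta> p\<close>. It shows that the cosine kernel is positive
  semidefinite.\<close>

lemma sum_cos_diff_eq:
  "(\<Sum>p\<in>P. \<Sum>q\<in>P. v p * v q * cos (\<theta> p - \<theta> q)) = (\<Sum>p\<in>P. v p * cos (\<theta> p))\<^sup>2 + (\<Sum>p\<in>P. v p * sin (\<theta> p))\<^sup>2"
  for v \<theta> :: "'a \<Rightarrow> real"
  unfolding power2_eq_square sum_product
  by (simp add: cos_diff sum.distrib[symmetric] algebra_simps)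

lemma sum_cos_diff_nonneg: "0 \<le> (\<Sum>p\<in>P. \<Sum>q\<in>P. v p * v q * cos (\<theta> p - \<theta> q))"
  for v \<theta> :: "'a \<Rightarrow> real"
  by (simp add: sum_cos_diff_eq)

text \<open>Schur products with the positive semidefinite powers of \<open>x p * x q\<close> stay positive semidefinite.\<close>

lemma sum_cos_diff_le_exp:
  fixes v \<theta> x :: "'a \<Rightarrow> real"
  assumes "finite P"
  shows "(\<Sum>p\<in>P. \<Sum>q\<in>P. v p * v q * cos (\<theta> p - \<theta> q)) \<le> (\<Sum>p\<in>P. \<Sum>q\<in>P. v p * v q * cos (\<theta> p - \<theta> q) * exp (x p * x q))"
proof -
  define f where "f n = (\<Sum>p\<in>P. \<Sum>q\<in>P. v p * v q * cos (\<theta> p - \<theta> q) * ((x p * x q) ^ n /\<^sub>R fact n))" for n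
  have "f sums (\<Sum>p\<in>P. \<Sum>q\<in>P. v p * v q * cos (\<theta> p - \<theta> q) * exp (x p * x q))"
    unfolding f_def by (intro sums_sum sums_mult exp_converges)
  moreover have "0 \<le> f n" for n
  proof -
    have "f n = (\<Sum>p\<in>P. \<Sum>q\<in>P. (v p * x p ^ n) * (v q * x q ^ n) * cos (\<theta> p - \<theta> q)) / fact n"
      unfolding f_def sum_divide_distrib by (simp add: power_mult_distrib field_simps)
    then show ?thesis using sum_cos_diff_nonneg[where P = P and v = "\<lambda>p. v p * x p ^ n" and \<theta> = \<theta>] by simp
  qed
  \<comment> \<open>All terms of the exponential series contribute nonnegatively, and only the term
    of order 0 is kept.\<close>
  ultimately have "sum f {0} \<le> (\<Sum>p\<in>P. \<Sum>q\<in>P. v p * v q * cos (\<theta> p - \<theta> q) * exp (x p * x q))"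
    using sum_le_suminf[of f "{0}"] by (auto simp: sums_iff)
  then show ?thesis by (simp add: f_def)
qed

text \<open>\<open>j\<close> is chosen with \<open>2 ^ j\<close> comparable to
  \<open>\<bar>r\<bar>\<close>, within the range from 0 to \<open>m\<close>. The Gaussian in
  \<open>\<eta> - b * r\<close> is split into two equal factors. One confines \<open>b\<close> to a
  neighbourhood of \<open>\<eta> / r\<close> of size about \<open>(1/2) ^ j\<close>, whose mass is
  controlled by the Frostman bound. The other, together with \<open>\<bar>b\<bar> \<le> 1\<close>,
  supplies the decay in \<open>(r, \<eta>)\<close> at scale \<open>2 ^ j\<close>.\<close>

lemma frequency_weight_le:
  assumes fr: "frostman \<tau> m Q \<nu>" and Q: "Q \<subseteq> {-1..1}"
  shows "(\<Sum>b\<in>Q. \<nu> b * exp (- ((1/4) ^ m / 2 * r\<^sup>2)) * exp (- (\<eta> - b * r)\<^sup>2 / 2))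
    \<le> 12 * exp 5 * (\<Sum>j\<le>m. weight \<tau> j * exp (- ((1/4) ^ j / 8 * (r\<^sup>2 + \<eta>\<^sup>2))))"
proof -
  note nu = frostmanD(1,2)[OF fr]
  have "\<exists>j\<le>m. (j = 0 \<or> 2 ^ j < 2 * \<bar>r\<bar>) \<and> (j = m \<or> \<bar>r\<bar> \<le> 2 ^ j)"
  proof (cases "\<bar>r\<bar> \<le> 2 ^ m")
    case True
    define j where "j = (LEAST j. \<bar>r\<bar> \<le> 2 ^ j)"
    have j: "\<bar>r\<bar> \<le> 2 ^ j" unfolding j_def using True by (rule LeastI)
    have "j \<le> m" unfolding j_def using True by (rule Least_le)
    moreover have "2 ^ j < 2 * \<bar>r\<bar>" if j0: "j \<noteq> 0"
    proof -
      obtain i where i: "j = Suc i" using j0 by (cases j) auto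
      have "\<not> \<bar>r\<bar> \<le> 2 ^ i" using not_less_Least[of i "\<lambda>j. \<bar>r\<bar> \<le> 2 ^ j"] i unfolding j_def by simp
      then show ?thesis using i by simp
    qed
    ultimately show ?thesis using j by (intro exI[of _ j]) auto
  next
    case False
    then show ?thesis by (intro exI[of _ m]) auto
  qed
  then obtain j where j: "j \<le> m" "j = 0 \<or> 2 ^ j < 2 * \<bar>r\<bar>" "j = m \<or> \<bar>r\<bar> \<le> 2 ^ j" by blast
  define \<kappa> where "\<kappa> = (1/4::real) ^ j"
  have \<kappa>: "0 < \<kappa>" "\<kappa> \<le> 1" by (auto simp: \<kappa>_def power_le_one)
  have one: "exp (- ((1/4) ^ m / 2 * r\<^sup>2)) * exp (- (\<eta> - b * r)\<^sup>2 / 4) \<le> exp 1 * exp (- (\<kappa> / 8 * (r\<^sup>2 + \<eta>\<^sup>2)))" if b: "b \<in> Q" for b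
  proof -
    have "\<bar>b\<bar> \<le> 1" using subsetD[OF Q b] by (simp add: abs_le_iff)
    then have "b\<^sup>2 \<le> 1" by (simp add: abs_square_le_1)
    then have br: "(b * r)\<^sup>2 \<le> r\<^sup>2" by (simp add: power_mult_distrib mult_left_le_one_le)
    have "0 \<le> (\<eta> - 2 * (b * r))\<^sup>2" by simp
    then have "\<eta>\<^sup>2 \<le> 2 * (\<eta> - b * r)\<^sup>2 + 2 * (b * r)\<^sup>2" by (simp add: power2_eq_square algebra_simps)
    then have e1: "\<eta>\<^sup>2 / 2 - r\<^sup>2 \<le> (\<eta> - b * r)\<^sup>2" using br by simp
    have "\<kappa> * (\<eta>\<^sup>2 / 2 - r\<^sup>2) \<le> \<kappa> * (\<eta> - b * r)\<^sup>2" using e1 \<kappa> by (intro mult_left_mono) auto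
    also have "\<dots> \<le> 1 * (\<eta> - b * r)\<^sup>2" using \<kappa> by (intro mult_right_mono) auto
    finally have e2: "\<kappa> * \<eta>\<^sup>2 / 2 - \<kappa> * r\<^sup>2 \<le> (\<eta> - b * r)\<^sup>2" by (simp add: algebra_simps)
    \<comment> \<open>The coefficient is \<open>1/8 + 1/4\<close>: the decay wanted in
      \<open>r\<close>, plus the loss in \<open>e2\<close>. For \<open>j = m\<close> the size of
      \<open>r\<close> is unbounded and the smoothing factor pays; otherwise
      \<open>\<kappa> * r\<^sup>2 \<le> 1\<close>.\<close>
    have e3: "3 / 8 * (\<kappa> * r\<^sup>2) \<le> 1 + (1/4) ^ m / 2 * r\<^sup>2"
    proof (cases "j = m")
      case True
      have "0 \<le> \<kappa> * r\<^sup>2" using \<kappa> by simp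
      moreover have "(1/4) ^ m / 2 * r\<^sup>2 = \<kappa> * r\<^sup>2 / 2" using True by (simp add: \<kappa>_def)
      ultimately show ?thesis by linarith
    next
      case False
      then have "\<bar>r\<bar>\<^sup>2 \<le> (2 ^ j)\<^sup>2" using j by (intro power_mono) auto
      then have "r\<^sup>2 \<le> 4 ^ j" by (simp flip: power_mult power_mult_distrib add: power2_eq_square)
      then have "\<kappa> * r\<^sup>2 \<le> \<kappa> * 4 ^ j" using \<kappa> by (intro mult_left_mono) auto
      also have "\<dots> = 1" by (simp add: \<kappa>_def power_divide)
      finally have "\<kappa> * r\<^sup>2 \<le> 1" .
      moreover have "0 \<le> (1/4) ^ m / 2 * r\<^sup>2" by simp
      ultimately show ?thesis by linarith
    qed
    have "- ((1/4) ^ m / 2 * r\<^sup>2) + (- (\<eta> - b * r)\<^sup>2 / 4) \<le> 1 + (- (\<kappa> / 8 * (r\<^sup>2 + \<eta>\<^sup>2)))"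
      using e2 e3 by (simp add: algebra_simps)
    then show ?thesis by (simp flip: exp_add)
  qed
  have two: "(\<Sum>b\<in>Q. \<nu> b * exp (- (\<eta> - b * r)\<^sup>2 / 4)) \<le> 12 * exp 4 * weight \<tau> j"
  proof (cases "j = 0")
    case True
    have "(\<Sum>b\<in>Q. \<nu> b * exp (- (\<eta> - b * r)\<^sup>2 / 4)) \<le> (\<Sum>b\<in>Q. \<nu> b * 1)"
      using nu by (intro sum_mono mult_left_mono) auto
    also have "\<dots> \<le> exp 1 * 12" using frostman_slopes_total_mass_le[OF fr Q] by simp
    also have "\<dots> \<le> 12 * exp 4 * weight \<tau> j" using True by simp
    finally show ?thesis .
  next
    case False
    then have r: "2 ^ j < 2 * \<bar>r\<bar>" using j by blast
    have r0: "r \<noteq> 0" using r by (auto simp: not_less)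
    have "exp (- (\<eta> - b * r)\<^sup>2 / 4) \<le> exp 4 * exp (- (2 ^ j * l1 (b - \<eta> / r)))" for b
    proof -
      \<comment> \<open>Completing a square trades the Gaussian for the exponential kernel of
        \<open>frostman_exp_sum\<close>, at the price of \<open>exp 4\<close>.\<close>
      define v where "v = 2 ^ j * \<bar>b - \<eta> / r\<bar>"
      have "v \<le> (2 * \<bar>r\<bar>) * \<bar>b - \<eta> / r\<bar>" unfolding v_def using r by (intro mult_right_mono) auto
      also have "\<dots> = 2 * \<bar>\<eta> - b * r\<bar>"
        using r0 by (simp add: abs_mult[symmetric] algebra_simps abs_minus_commute)
      finally have "v\<^sup>2 \<le> (2 * \<bar>\<eta> - b * r\<bar>)\<^sup>2" by (intro power_mono) (auto simp: v_def)
      then have "v\<^sup>2 / 16 \<le> (\<eta> - b * r)\<^sup>2 / 4" by (simp add: power_mult_distrib)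
      moreover have "0 \<le> (v / 4 - 2)\<^sup>2" by simp
      then have "v \<le> 4 + v\<^sup>2 / 16" by (simp add: power2_eq_square algebra_simps)
      ultimately have "- (\<eta> - b * r)\<^sup>2 / 4 \<le> 4 - v" by simp
      then have "exp (- (\<eta> - b * r)\<^sup>2 / 4) \<le> exp (4 - v)" by simp
      then show ?thesis by (simp add: v_def flip: exp_add)
    qed
    then have "(\<Sum>b\<in>Q. \<nu> b * exp (- (\<eta> - b * r)\<^sup>2 / 4)) \<le> (\<Sum>b\<in>Q. \<nu> b * (exp 4 * exp (- (2 ^ j * l1 (b - \<eta> / r)))))"
      using nu by (intro sum_mono mult_left_mono)
    also have "\<dots> = exp 4 * (\<Sum>b\<in>Q. \<nu> b * exp (- (2 ^ j * l1 (b - \<eta> / r))))"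
      by (simp add: sum_distrib_left mult_ac)
    also have "\<dots> \<le> exp 4 * (12 ^ DIM(real) * weight \<tau> j)"
      by (intro mult_left_mono frostman_exp_sum[OF fr j(1)]) auto
    finally show ?thesis by (simp add: mult_ac)
  qed
  have "(\<Sum>b\<in>Q. \<nu> b * exp (- ((1/4) ^ m / 2 * r\<^sup>2)) * exp (- (\<eta> - b * r)\<^sup>2 / 2))
      \<le> (\<Sum>b\<in>Q. \<nu> b * exp (- (\<eta> - b * r)\<^sup>2 / 4) * (exp 1 * exp (- (\<kappa> / 8 * (r\<^sup>2 + \<eta>\<^sup>2)))))"
  proof (intro sum_mono)
    fix b assume b: "b \<in> Q"
    have "exp (- (\<eta> - b * r)\<^sup>2 / 2) = exp (- (\<eta> - b * r)\<^sup>2 / 4) * exp (- (\<eta> - b * r)\<^sup>2 / 4)"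
      by (simp flip: exp_add)
    then have "\<nu> b * exp (- ((1/4) ^ m / 2 * r\<^sup>2)) * exp (- (\<eta> - b * r)\<^sup>2 / 2)
        = \<nu> b * exp (- (\<eta> - b * r)\<^sup>2 / 4) * (exp (- ((1/4) ^ m / 2 * r\<^sup>2)) * exp (- (\<eta> - b * r)\<^sup>2 / 4))"
      by simp
    also have "\<dots> \<le> \<nu> b * exp (- (\<eta> - b * r)\<^sup>2 / 4) * (exp 1 * exp (- (\<kappa> / 8 * (r\<^sup>2 + \<eta>\<^sup>2))))"
      using nu one[OF b] by (intro mult_left_mono) auto
    finally show "\<nu> b * exp (- ((1/4) ^ m / 2 * r\<^sup>2)) * exp (- (\<eta> - b * r)\<^sup>2 / 2)
        \<le> \<nu> b * exp (- (\<eta> - b * r)\<^sup>2 / 4) * (exp 1 * exp (- (\<kappa> / 8 * (r\<^sup>2 + \<eta>\<^sup>2))))" .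
  qed
  also have "\<dots> = (\<Sum>b\<in>Q. \<nu> b * exp (- (\<eta> - b * r)\<^sup>2 / 4)) * (exp 1 * exp (- (\<kappa> / 8 * (r\<^sup>2 + \<eta>\<^sup>2))))"
    by (rule sum_distrib_right[symmetric])
  also have "\<dots> \<le> 12 * exp 4 * weight \<tau> j * (exp 1 * exp (- (\<kappa> / 8 * (r\<^sup>2 + \<eta>\<^sup>2))))"
    using two by (intro mult_right_mono) auto
  also have "\<dots> = 12 * exp 5 * (weight \<tau> j * exp (- (\<kappa> / 8 * (r\<^sup>2 + \<eta>\<^sup>2))))"
    by (simp add: mult_ac flip: exp_add)
  also have "\<dots> = 12 * exp 5 * (\<Sum>j\<in>{j}. weight \<tau> j * exp (- ((1/4) ^ j / 8 * (r\<^sup>2 + \<eta>\<^sup>2))))"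
    by (simp add: \<kappa>_def)
  also have "\<dots> \<le> 12 * exp 5 * (\<Sum>j\<le>m. weight \<tau> j * exp (- ((1/4) ^ j / 8 * (r\<^sup>2 + \<eta>\<^sup>2))))"
    using j by (intro mult_left_mono sum_mono2) auto
  finally show ?thesis .
qed

text \<open>For each coordinate, \<open>2 * y\<^sup>2 \<ge> y - 1/8\<close> dominates the Gaussian
  by the exponential kernel of \<open>frostman_exp_sum\<close>; the two coordinates together lose
  \<open>exp (1/4)\<close>.\<close>

lemma gaussian_mass_le:
  fixes P :: "(real^2) set"
  assumes fr: "frostman s m P w" and j: "j \<le> m"
  shows "(\<Sum>q\<in>P. w q * exp (- (2 * 4 ^ j * (((p - q) $ 1)\<^sup>2 + ((p - q) $ 2)\<^sup>2)))) \<le> exp (1/4) * 144 * weight s j"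
proof -
  note w = frostmanD(2)[OF fr]
  have el: "- (2 * 4 ^ j * y\<^sup>2) \<le> 1/8 - 2 ^ j * \<bar>y\<bar>" for y :: real
  proof -
    have "0 \<le> 2 * (2 ^ j * \<bar>y\<bar> - 1/4)\<^sup>2" by simp
    moreover have "(2 ^ j * \<bar>y\<bar>)\<^sup>2 = 4 ^ j * y\<^sup>2"
    proof -
      have "(2 ^ j)\<^sup>2 = (4::real) ^ j" by (simp add: power2_eq_square flip: power_mult_distrib)
      then show ?thesis by (simp add: power_mult_distrib)
    qed
    ultimately show ?thesis by (simp add: power2_diff field_simps power2_eq_square)
  qed
  have "exp (- (2 * 4 ^ j * (((p - q) $ 1)\<^sup>2 + ((p - q) $ 2)\<^sup>2))) \<le> exp (1/4) * exp (- (2 ^ j * l1 (q - p)))" for q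
  proof -
    have "- (2 * 4 ^ j * (((p - q) $ 1)\<^sup>2 + ((p - q) $ 2)\<^sup>2)) \<le> 1/4 - 2 ^ j * (\<bar>(p - q) $ 1\<bar> + \<bar>(p - q) $ 2\<bar>)"
      using el[of "(p - q) $ 1"] el[of "(p - q) $ 2"] by (simp add: distrib_left)
    also have "\<bar>(p - q) $ 1\<bar> + \<bar>(p - q) $ 2\<bar> = l1 (q - p)"
      unfolding sum_Basis_real2 by (simp add: abs_minus_commute)
    finally show ?thesis by (simp flip: exp_add)
  qed
  then have "(\<Sum>q\<in>P. w q * exp (- (2 * 4 ^ j * (((p - q) $ 1)\<^sup>2 + ((p - q) $ 2)\<^sup>2))))
      \<le> (\<Sum>q\<in>P. w q * (exp (1/4) * exp (- (2 ^ j * l1 (q - p)))))"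
    using w by (intro sum_mono mult_left_mono)
  also have "\<dots> = exp (1/4) * (\<Sum>q\<in>P. w q * exp (- (2 ^ j * l1 (q - p))))"
    by (simp add: sum_distrib_left mult_ac)
  also have "\<dots> \<le> exp (1/4) * (12 ^ DIM(real^2) * weight s j)"
    by (intro mult_left_mono frostman_exp_sum[OF fr j]) auto
  finally show ?thesis by (simp add: mult_ac)
qed

text \<open>Falconer's \<open>L\<^sup>2\<close> estimate for the projections, smoothed at scale \<open>2^-m\<close>. Replacing \<open>w\<close> by
  \<open>w p * exp (p$2^2 / 2)\<close> allows averaging the squared Fourier transform over a unit
  interval in the second frequency variable (the uncertainty principle), which smooths out \<open>\<nu>\<close>.\<close>

lemma smoothed_energy_le:
  fixes P :: "(real^2) set"
  assumes fP: "frostman s m P w" and fQ: "frostman \<tau> m Q \<nu>" and PR: "P \<subseteq> cball 0 R" and QI: "Q \<subseteq> {-1..1}"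
    and st: "2 < \<tau> + s"
  shows "2 ^ m * (\<Sum>b\<in>Q. \<nu> b * (energy P w (\<lambda>z. exp (- (4 ^ m / 2 * (lproj b z)\<^sup>2)))))
    \<le> 12 * exp 5 * 8 * pi * (exp (2 * R) * 144 * exp (R\<^sup>2) * (exp (1/4) * 144)) / (1 - 2 powr (- (\<tau> + s - 2)))"
proof -
  note P = frostmanD(1,2)[OF fP]
  note nu = frostmanD(1,2)[OF fQ]
  define Y where "Y = 2 ^ m * (\<Sum>b\<in>Q. \<nu> b * (energy P w (\<lambda>z. exp (- (4 ^ m / 2 * (lproj b z)\<^sup>2)))))"
  \<comment> \<open>\<open>c0\<close> is dual to the smoothing scale,
    \<open>1 / (4 * c0) = 4 ^ m / 2\<close>, and \<open>c j\<close> is the exponent produced by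
    \<open>frequency_weight_le\<close>.\<close>
  define c0 where "c0 = (1/4::real) ^ m / 2"
  define c where "c j = (1/4::real) ^ j / 8" for j
  have c0: "0 < c0" and c: "0 < c j" for j by (auto simp: c0_def c_def)
  define v where "v p = w p * exp ((p $ 2)\<^sup>2 / 2)" for p :: "real^2"
  have v0: "0 \<le> v p" for p using P by (simp add: v_def)
  let ?z = "\<lambda>p q i. (p - q :: real^2) $ i"
  \<comment> \<open>\<open>F r \<eta>\<close> is the squared modulus of the Fourier transform of the
    weights \<open>v\<close> at the frequency \<open>(r, \<eta>)\<close>; \<open>H\<close> below is
    the frequency-side integrand of the smoothed energies, averaged over the slopes.\<close>
  define F where "F r \<eta> = (energy P v (\<lambda>z. cos (r * z $ 1 + z $ 2 * \<eta>)))" for r \<eta>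
  have F0: "0 \<le> F r \<eta>" for r \<eta>
    using sum_cos_diff_nonneg[where P = P and v = v and \<theta> = "\<lambda>p. r * p $ 1 + p $ 2 * \<eta>"] by (simp add: F_def algebra_simps)
  define H where "H r = (\<Sum>b\<in>Q. \<nu> b * (energy P w (\<lambda>z. (cos (0 + lproj b z * r) * exp (- (c0 * r\<^sup>2))))))" for r
  have sqrt0: "sqrt (pi / c0) = sqrt (2 * pi) * 2 ^ m"
  proof -
    have "pi / c0 = (2 * pi) * (2 ^ m)\<^sup>2"
      by (simp add: c0_def power_divide power2_eq_square flip: power_mult_distrib)
    then show ?thesis by (simp add: real_sqrt_mult)
  qed
  have intH: "has_bochner_integral lborel H (sqrt (2 * pi) * Y)"
  proof -
    have "has_bochner_integral lborel H (\<Sum>b\<in>Q. \<nu> b * (\<Sum>p\<in>P. \<Sum>q\<in>P. w p * w q *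
        (cos 0 * sqrt (pi / c0) * exp (- (lproj b (p - q))\<^sup>2 / (4 * c0)))))"
      unfolding H_def using c0
      by (intro has_bochner_integral_sum has_bochner_integral_mult_right gauss_cos)
    moreover have "- (lproj b z)\<^sup>2 / (4 * c0) = - (4 ^ m / 2 * (lproj b z)\<^sup>2)" for b z
      by (simp add: c0_def power_divide)
    ultimately show ?thesis
      unfolding sqrt0 Y_def by (simp only: sum_distrib_left mult_ac cos_zero mult_1)
  qed
  define M where "M r = 12 * exp 5 * (\<Sum>j\<le>m. weight \<tau> j * (\<Sum>p\<in>P. \<Sum>q\<in>P. v p * v q *
      (sqrt (pi / c j) * exp (- (?z p q 2)\<^sup>2 / (4 * c j))) * (cos (0 + ?z p q 1 * r) * exp (- (c j * r\<^sup>2)))))" for r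
  have H_le: "sqrt (2 * pi) * H r \<le> M r" for r
  proof -
    \<comment> \<open>The factor \<open>exp (p $ 2 * q $ 2)\<close> splits into two factors absorbed
      by \<open>v\<close> and a Gaussian in the difference. The latter is the transform of a
      Gaussian in \<open>\<eta>\<close> centred at \<open>b * r\<close>, which is how
      \<open>intX\<close> introduces the average over \<open>\<eta>\<close>.\<close>
    have step: "(energy P w (\<lambda>z. cos (lproj b z * r)))
       \<le> (energy P v (\<lambda>z. (cos (r * z $ 1 + z $ 2 * (b * r)) * exp (- (z $ 2)\<^sup>2 / 2))))" for b
    proof -
      have "(\<Sum>p\<in>P. \<Sum>q\<in>P. w p * w q * cos (lproj b p * r - lproj b q * r))
         \<le> (\<Sum>p\<in>P. \<Sum>q\<in>P. w p * w q * cos (lproj b p * r - lproj b q * r) * exp (p $ 2 * q $ 2))"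
        by (rule sum_cos_diff_le_exp[OF P(1)])
      also have "\<dots> = (energy P v (\<lambda>z. (cos (r * z $ 1 + z $ 2 * (b * r)) * exp (- (z $ 2)\<^sup>2 / 2))))"
      proof (intro sum.cong refl)
        fix p q
        have "(p $ 2)\<^sup>2 / 2 + (q $ 2)\<^sup>2 / 2 + (- (?z p q 2)\<^sup>2 / 2) = p $ 2 * q $ 2"
          by (simp add: power2_eq_square field_simps)
        then have "exp (p $ 2 * q $ 2) = exp ((p $ 2)\<^sup>2 / 2) * exp ((q $ 2)\<^sup>2 / 2) * exp (- (?z p q 2)\<^sup>2 / 2)"
          by (simp flip: exp_add)
        moreover have "lproj b p * r - lproj b q * r = r * ?z p q 1 + ?z p q 2 * (b * r)"
          by (simp add: lproj_def algebra_simps)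
        ultimately show "w p * w q * cos (lproj b p * r - lproj b q * r) * exp (p $ 2 * q $ 2)
          = v p * v q * (cos (r * ?z p q 1 + ?z p q 2 * (b * r)) * exp (- (?z p q 2)\<^sup>2 / 2))"
          by (simp add: v_def)
      qed
      finally show ?thesis by (simp add: lproj_diff left_diff_distrib)
    qed
    define X where "X b = (energy P v (\<lambda>z. (cos (r * z $ 1 + z $ 2 * (b * r)) * sqrt (2 * pi) * exp (- (z $ 2)\<^sup>2 / 2))))" for b
    have intX: "has_bochner_integral lborel (\<lambda>\<eta>. F r \<eta> * exp (- (\<eta> - b * r)\<^sup>2 / 2)) (X b)" for b
    proof -
      have "has_bochner_integral lborel (\<lambda>\<eta>. \<Sum>p\<in>P. \<Sum>q\<in>P. v p * v q * (cos (r * ?z p q 1 + ?z p q 2 * \<eta>) * exp (- (\<eta> - b * r)\<^sup>2 / 2))) (X b)"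
        unfolding X_def by (intro has_bochner_integral_sum has_bochner_integral_mult_right gauss_cos_shift)
      then show ?thesis by (simp add: F_def sum_distrib_right mult.assoc)
    qed
    have intL: "has_bochner_integral lborel (\<lambda>\<eta>. F r \<eta> * (\<Sum>b\<in>Q. \<nu> b * exp (- (c0 * r\<^sup>2)) * exp (- (\<eta> - b * r)\<^sup>2 / 2)))
        (\<Sum>b\<in>Q. \<nu> b * exp (- (c0 * r\<^sup>2)) * X b)"
    proof -
      have "has_bochner_integral lborel (\<lambda>\<eta>. \<Sum>b\<in>Q. \<nu> b * exp (- (c0 * r\<^sup>2)) * (F r \<eta> * exp (- (\<eta> - b * r)\<^sup>2 / 2)))
          (\<Sum>b\<in>Q. \<nu> b * exp (- (c0 * r\<^sup>2)) * X b)"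
        by (intro has_bochner_integral_sum has_bochner_integral_mult_right intX)
      then show ?thesis by (simp add: sum_distrib_left mult_ac)
    qed
    have intU: "has_bochner_integral lborel (\<lambda>\<eta>. F r \<eta> * (12 * exp 5 * (\<Sum>j\<le>m. weight \<tau> j * exp (- (c j * (r\<^sup>2 + \<eta>\<^sup>2)))))) (M r)"
    proof -
      have hb: "has_bochner_integral lborel (\<lambda>\<eta>. 12 * exp 5 * (\<Sum>j\<le>m. weight \<tau> j * (exp (- (c j * r\<^sup>2)) *
          (energy P v (\<lambda>z. (cos (r * z $ 1 + z $ 2 * \<eta>) * exp (- (c j * \<eta>\<^sup>2))))))))
        (12 * exp 5 * (\<Sum>j\<le>m. weight \<tau> j * (exp (- (c j * r\<^sup>2)) *
          (energy P v (\<lambda>z. (cos (r * z $ 1) * sqrt (pi / c j) * exp (- (z $ 2)\<^sup>2 / (4 * c j))))))))"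
        using c by (intro has_bochner_integral_sum has_bochner_integral_mult_right gauss_cos)
      have e1: "12 * exp 5 * (\<Sum>j\<le>m. weight \<tau> j * (exp (- (c j * r\<^sup>2)) *
          (energy P v (\<lambda>z. (cos (r * z $ 1) * sqrt (pi / c j) * exp (- (z $ 2)\<^sup>2 / (4 * c j))))))) = M r"
        unfolding M_def by (simp add: sum_distrib_left mult_ac)
      have e2: "12 * exp 5 * (\<Sum>j\<le>m. weight \<tau> j * (exp (- (c j * r\<^sup>2)) *
          (energy P v (\<lambda>z. (cos (r * z $ 1 + z $ 2 * \<eta>) * exp (- (c j * \<eta>\<^sup>2)))))))
          = F r \<eta> * (12 * exp 5 * (\<Sum>j\<le>m. weight \<tau> j * exp (- (c j * (r\<^sup>2 + \<eta>\<^sup>2)))))" for \<eta>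
      proof -
        have "exp (- (c j * (r\<^sup>2 + \<eta>\<^sup>2))) = exp (- (c j * r\<^sup>2)) * exp (- (c j * \<eta>\<^sup>2))" for j
          by (simp add: distrib_left flip: exp_add)
        moreover have "(energy P v (\<lambda>z. (cos (r * z $ 1 + z $ 2 * \<eta>) * exp (- (c j * \<eta>\<^sup>2)))))
            = F r \<eta> * exp (- (c j * \<eta>\<^sup>2))" for j
          unfolding F_def sum_distrib_right by (simp add: mult.assoc)
        ultimately show ?thesis by (simp add: sum_distrib_left mult_ac)
      qed
      show ?thesis using hb by (simp only: e1 e2)
    qed
    have "sqrt (2 * pi) * H r = (\<Sum>b\<in>Q. \<nu> b * exp (- (c0 * r\<^sup>2)) * (sqrt (2 * pi) * (energy P w (\<lambda>z. cos (lproj b z * r)))))"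
      unfolding H_def by (simp add: sum_distrib_left mult_ac)
    also have "\<dots> \<le> (\<Sum>b\<in>Q. \<nu> b * exp (- (c0 * r\<^sup>2)) * (sqrt (2 * pi) * (energy P v (\<lambda>z. (cos (r * z $ 1 + z $ 2 * (b * r)) * exp (- (z $ 2)\<^sup>2 / 2))))))"
    proof (rule sum_mono)
      fix b
      show "\<nu> b * exp (- (c0 * r\<^sup>2)) * (sqrt (2 * pi) * (energy P w (\<lambda>z. cos (lproj b z * r))))
        \<le> \<nu> b * exp (- (c0 * r\<^sup>2)) * (sqrt (2 * pi) * (energy P v (\<lambda>z. (cos (r * z $ 1 + z $ 2 * (b * r)) * exp (- (z $ 2)\<^sup>2 / 2)))))"
        using nu(2) by (intro mult_left_mono[OF mult_left_mono[OF step]]) auto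
    qed
    also have "\<dots> = (\<Sum>b\<in>Q. \<nu> b * exp (- (c0 * r\<^sup>2)) * X b)"
      unfolding X_def by (simp add: sum_distrib_left mult_ac)
    also have "\<dots> = (LBINT \<eta>. F r \<eta> * (\<Sum>b\<in>Q. \<nu> b * exp (- (c0 * r\<^sup>2)) * exp (- (\<eta> - b * r)\<^sup>2 / 2)))"
      using intL by (simp add: has_bochner_integral_iff)
    \<comment> \<open>The slopes now enter only through a weight multiplying the nonnegative
      \<open>F r \<eta>\<close>, so that weight can be replaced by its pointwise majorant.\<close>
    also have "\<dots> \<le> (LBINT \<eta>. F r \<eta> * (12 * exp 5 * (\<Sum>j\<le>m. weight \<tau> j * exp (- (c j * (r\<^sup>2 + \<eta>\<^sup>2))))))"
      using intL intU unfolding has_bochner_integral_iff c0_def c_def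
      by (intro integral_mono mult_left_mono frequency_weight_le[OF fQ QI] F0) auto
    also have "\<dots> = M r" using intU by (simp add: has_bochner_integral_iff)
    finally show ?thesis .
  qed
  \<comment> \<open>Integrating the majorant over both frequencies returns to the plane, with
    Gaussians of width comparable to \<open>(1/2) ^ j\<close> in both coordinates.\<close>
  define T where "T = 12 * exp 5 * (\<Sum>j\<le>m. weight \<tau> j * (\<Sum>p\<in>P. \<Sum>q\<in>P. v p * v q *
      (sqrt (pi / c j) * exp (- (?z p q 2)\<^sup>2 / (4 * c j))) * (cos 0 * sqrt (pi / c j) * exp (- (?z p q 1)\<^sup>2 / (4 * c j)))))"
  have intM: "has_bochner_integral lborel M T"
    unfolding M_def T_def using c by (intro has_bochner_integral_sum has_bochner_integral_mult_right gauss_cos)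
  have "sqrt (2 * pi) * (sqrt (2 * pi) * Y) = sqrt (2 * pi) * (LBINT r. H r)"
    using intH by (simp add: has_bochner_integral_iff)
  also have "\<dots> = (LBINT r. sqrt (2 * pi) * H r)" by simp
  also have "\<dots> \<le> (LBINT r. M r)"
    using intH intM H_le unfolding has_bochner_integral_iff by (intro integral_mono) auto
  also have "\<dots> = T" using intM by (simp add: has_bochner_integral_iff)
  finally have le_T: "2 * pi * Y \<le> T"
    by (simp flip: mult.assoc)
  have v_le: "v p \<le> exp (R\<^sup>2 / 2) * w p" if "p \<in> P" for p
  proof -
    have "norm p \<le> R" using that PR by auto
    then have "\<bar>p $ 2\<bar> \<le> R" using component_le_norm_cart[of p 2] by linarith
    then have "(p $ 2)\<^sup>2 \<le> R\<^sup>2" by (metis abs_ge_zero power2_abs power_mono)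
    then show ?thesis using P(2)[of p] by (simp add: v_def mult.commute mult_left_mono)
  qed
  have inner: "(\<Sum>p\<in>P. \<Sum>q\<in>P. v p * v q * (sqrt (pi / c j) * exp (- (?z p q 2)\<^sup>2 / (4 * c j))) * (cos 0 * sqrt (pi / c j) * exp (- (?z p q 1)\<^sup>2 / (4 * c j))))
      \<le> 8 * pi * 4 ^ j * (exp (2 * R) * 144 * exp (R\<^sup>2) * (exp (1/4) * 144 * weight s j))" if j: "j \<le> m" for j
  proof -
    define g where "g p q = exp (- (2 * 4 ^ j * ((?z p q 1)\<^sup>2 + (?z p q 2)\<^sup>2)))" for p q
    have pc: "pi / c j = 8 * pi * 4 ^ j" by (simp add: c_def power_divide)
    have g: "exp (- (?z p q 2)\<^sup>2 / (4 * c j)) * exp (- (?z p q 1)\<^sup>2 / (4 * c j)) = g p q" for p q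
      unfolding g_def c_def by (simp add: field_simps power_divide flip: exp_add)
    have sq: "sqrt (pi / c j) * sqrt (pi / c j) = 8 * pi * 4 ^ j"
      using c[of j] by (simp add: pc flip: power2_eq_square)
    have "v p * v q * (sqrt (pi / c j) * exp (- (?z p q 2)\<^sup>2 / (4 * c j))) * (cos 0 * sqrt (pi / c j) * exp (- (?z p q 1)\<^sup>2 / (4 * c j)))
        = 8 * pi * 4 ^ j * (v p * (v q * g p q))" for p q
      unfolding g[symmetric] sq[symmetric] by (simp only: mult_ac cos_zero mult_1)
    then have "(\<Sum>p\<in>P. \<Sum>q\<in>P. v p * v q * (sqrt (pi / c j) * exp (- (?z p q 2)\<^sup>2 / (4 * c j))) * (cos 0 * sqrt (pi / c j) * exp (- (?z p q 1)\<^sup>2 / (4 * c j))))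
        = 8 * pi * 4 ^ j * (\<Sum>p\<in>P. v p * (\<Sum>q\<in>P. v q * g p q))"
      by (simp only: sum_distrib_left)
    also have "\<dots> \<le> 8 * pi * 4 ^ j * (\<Sum>p\<in>P. (exp (R\<^sup>2 / 2) * w p) * (\<Sum>q\<in>P. (exp (R\<^sup>2 / 2) * w q) * g p q))"
      using v_le v0 P(2) by (intro mult_left_mono sum_mono mult_mono sum_nonneg mult_right_mono) (auto simp: g_def)
    also have "\<dots> = 8 * pi * 4 ^ j * (\<Sum>p\<in>P. w p * (exp (R\<^sup>2 / 2) * exp (R\<^sup>2 / 2)) * (\<Sum>q\<in>P. w q * g p q))"
    proof -
      have "(\<Sum>q\<in>P. (exp (R\<^sup>2 / 2) * w q) * g p q) = exp (R\<^sup>2 / 2) * (\<Sum>q\<in>P. w q * g p q)" for p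
        by (simp only: sum_distrib_left mult.assoc)
      then show ?thesis by (simp only: mult_ac)
    qed
    also have "\<dots> \<le> 8 * pi * 4 ^ j * (\<Sum>p\<in>P. w p * (exp (R\<^sup>2 / 2) * exp (R\<^sup>2 / 2)) * (exp (1/4) * 144 * weight s j))"
      unfolding g_def using P(2) by (intro mult_left_mono sum_mono gaussian_mass_le[OF fP j]) auto
    also have "\<dots> = 8 * pi * 4 ^ j * (sum w P * (exp (R\<^sup>2) * (exp (1/4) * 144 * weight s j)))"
      by (simp add: sum_distrib_right mult.assoc flip: exp_add)
    also have "\<dots> \<le> 8 * pi * 4 ^ j * ((exp (2 * R) * 144) * (exp (R\<^sup>2) * (exp (1/4) * 144 * weight s j)))"
      using frostman_total_mass_le[OF fP PR] by (intro mult_left_mono mult_right_mono) auto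
    finally show ?thesis by (simp add: mult_ac)
  qed
  define D where "D = exp (2 * R) * 144 * exp (R\<^sup>2) * (exp (1/4) * 144)"
  \<comment> \<open>\<open>4 ^ j\<close> stems from the area of the frequency region of scale
    \<open>2 ^ j\<close>. The two Frostman decays outweigh it because
    \<open>2 < \<tau> + s\<close>.\<close>
  have w4: "4 ^ j * (weight \<tau> j * weight s j) = weight (\<tau> + s - 2) j" for j
  proof -
    have "weight (- 2) j = 4 ^ j" by (simp add: weight_def)
    then show ?thesis using weight_mult[of "- 2" j "\<tau> + s"] by (simp add: weight_mult add.commute)
  qed
  have "T \<le> 12 * exp 5 * (\<Sum>j\<le>m. weight \<tau> j * (8 * pi * 4 ^ j * (exp (2 * R) * 144 * exp (R\<^sup>2) * (exp (1/4) * 144 * weight s j))))"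
    unfolding T_def using inner by (intro mult_left_mono sum_mono) auto
  also have "\<dots> = 12 * exp 5 * 8 * pi * D * (\<Sum>j\<le>m. weight (\<tau> + s - 2) j)"
    unfolding D_def w4[symmetric] sum_distrib_left by (simp only: mult_ac)
  also have "\<dots> \<le> 12 * exp 5 * 8 * pi * D * (1 / (1 - 2 powr (- (\<tau> + s - 2))))"
    using st by (intro mult_left_mono sum_weight_le) (auto simp: D_def)
  finally have T: "T \<le> 12 * exp 5 * 8 * pi * D / (1 - 2 powr (- (\<tau> + s - 2)))" by simp
  have "0 \<le> Y" unfolding Y_def using nu P by (intro mult_nonneg_nonneg sum_nonneg) auto
  then have "1 * Y \<le> 2 * pi * Y" using pi_gt3 by (intro mult_right_mono) auto
  then have "Y \<le> T" using le_T by linarith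
  then show ?thesis using T unfolding Y_def D_def by simp
qed

text \<open>With exponent 1, subdividing an interval of level \<open>k\<close> into its
  \<open>2 ^ (m - k)\<close> subintervals of level \<open>m\<close> does not change the cost. The
  cover may thus be taken at the single level \<open>m\<close>, where \<open>cover_energy\<close>
  leaves one term.\<close>

lemma covered_scale_energy:
  fixes f :: "'a \<Rightarrow> real"
  assumes P: "finite P" "\<And>p. 0 \<le> w p" and cov: "covered 1 m e (f ` P)"
  shows "(sum w P)\<^sup>2 \<le> e * 2 ^ m * (\<Sum>p\<in>P. \<Sum>q\<in>P. w p * w q * of_bool (\<bar>f p - f q\<bar> \<le> (1/2) ^ m))"
proof -
  obtain U where U: "finite U" "U \<subseteq> cells" "\<forall>u\<in>U. fst u \<le> m" "f ` P \<subseteq> \<Union>(snd ` U)" "(\<Sum>u\<in>U. weight 1 (fst u)) \<le> e"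
    using cov unfolding covered_def by blast
  define c where "c p = (m, cell m (f p))" for p
  have one: "real (card (c ` {p\<in>P. f p \<in> snd u})) \<le> 2 ^ m * weight 1 (fst u)" if u: "u \<in> U" for u
  proof -
    have "u \<in> cells" using u U(2) by blast
    then obtain k y where ky: "u = (k, cell k y)" by (auto simp: cells_def)
    have km: "k \<le> m" using U(3) u ky by auto
    let ?a = "\<lfloor>2 ^ k * y\<rfloor>" and ?d = "2 ^ (m - k) :: int"
    have z: "\<lfloor>2 ^ m * z\<rfloor> \<in> {?a * ?d..<(?a + 1) * ?d}" if "z \<in> cell k y" for z :: real
    proof -
      have "\<lfloor>2 ^ m * z\<rfloor> div ?d = ?a" using floor_pow2_div[OF km, of z] that by (simp add: cell_def)
      then have "\<lfloor>2 ^ m * z\<rfloor> = ?a * ?d + \<lfloor>2 ^ m * z\<rfloor> mod ?d" using div_mult_mod_eq[of "\<lfloor>2 ^ m * z\<rfloor>" ?d] by simp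
      moreover have "0 \<le> \<lfloor>2 ^ m * z\<rfloor> mod ?d" "\<lfloor>2 ^ m * z\<rfloor> mod ?d < ?d" by auto
      ultimately show ?thesis unfolding atLeastLessThan_iff distrib_right mult_1 by linarith
    qed
    have fin: "finite (cell m ` cell k y)" "card (cell m ` cell k y) \<le> 2 ^ (m - k)"
      using cell_image_finite[of "cell k y" m "\<lambda>_. {?a * ?d..<(?a + 1) * ?d}"] z by (auto simp: distrib_right nat_power_eq)
    have sub: "c ` {p\<in>P. f p \<in> snd u} \<subseteq> Pair m ` cell m ` cell k y" by (auto simp: c_def ky)
    have "card (c ` {p\<in>P. f p \<in> snd u}) \<le> card (Pair m ` cell m ` cell k y)" using sub fin(1) by (intro card_mono) auto
    also have "\<dots> \<le> card (cell m ` cell k y)" using fin(1) by (rule card_image_le)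
    also note fin(2)
    finally have "real (card (c ` {p\<in>P. f p \<in> snd u})) \<le> real (2 ^ (m - k))" by (rule of_nat_mono)
    also have "\<dots> = (2::real) ^ (m - k)" by simp
    also have "\<dots> = 2 ^ m * weight 1 k" using km by (simp add: weight_def powr_minus power_diff field_simps)
    finally show ?thesis using ky by simp
  qed
  have "card (c ` P) \<le> card (\<Union>u\<in>U. c ` {p\<in>P. f p \<in> snd u})"
  proof (rule card_mono)
    show "finite (\<Union>u\<in>U. c ` {p\<in>P. f p \<in> snd u})" using P(1) U(1) by simp
    show "c ` P \<subseteq> (\<Union>u\<in>U. c ` {p\<in>P. f p \<in> snd u})"
    proof (rule image_subsetI)
      fix p assume p: "p \<in> P"
      then obtain u where "u \<in> U" "f p \<in> snd u" using U(4) by blast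
      then show "c p \<in> (\<Union>u\<in>U. c ` {p\<in>P. f p \<in> snd u})" using p by blast
    qed
  qed
  also have "\<dots> \<le> (\<Sum>u\<in>U. card (c ` {p\<in>P. f p \<in> snd u}))" using U(1) by (rule card_UN_le)
  finally have "real (card (c ` P)) \<le> real (\<Sum>u\<in>U. card (c ` {p\<in>P. f p \<in> snd u}))" by (rule of_nat_mono)
  also have "\<dots> \<le> (\<Sum>u\<in>U. 2 ^ m * weight 1 (fst u))" unfolding of_nat_sum by (intro sum_mono one)
  also have "\<dots> = 2 ^ m * (\<Sum>u\<in>U. weight 1 (fst u))" by (rule sum_distrib_left[symmetric])
  also have "\<dots> \<le> 2 ^ m * e" using U(5) by (intro mult_left_mono) auto
  finally have card: "real (card (c ` P)) \<le> 2 ^ m * e" .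
  have w1: "weight 1 m = 1 / 2 ^ m" by (simp add: weight_eq power_one_over)
  have "(\<Sum>u\<in>c ` P. weight 1 (fst u)) = real (card (c ` P)) * weight 1 m"
    by (subst sum.cong[OF refl, where h = "\<lambda>_. weight 1 m"]) (auto simp: c_def)
  also have "\<dots> \<le> e" using card by (simp add: w1 field_simps)
  finally have "(sum w P)\<^sup>2 \<le> e * (\<Sum>p\<in>P. \<Sum>q\<in>P. w p * w q * (\<Sum>k\<in>{m}. of_bool (\<bar>f p - f q\<bar> \<le> (1/2) ^ k) / weight 1 k))"
    using P by (intro cover_energy[where U = "c ` P"]) (auto simp: c_def cells_def)
  moreover have "(\<Sum>k\<in>{m}. g k) = g m" for g :: "nat \<Rightarrow> real" by simp
  ultimately show ?thesis by (simp only: w1) (simp add: sum_distrib_left mult_ac)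
qed

text \<open>The indicator of \<open>\<bar>lproj b z\<bar> \<le> (1/2) ^ m\<close> is at most
  \<open>exp (1/2)\<close> times a Gaussian of that width, which links
  \<open>covered_scale_energy\<close> to \<open>smoothed_energy_le\<close>.\<close>

lemma falconer_estimate:
  assumes st: "2 < \<tau> + s" and R: "0 < R"
  shows "\<exists>C\<ge>0. discrete_bound s 1 \<tau> R C"
proof -
  define C where "C = 12 * exp 5 * 8 * pi * (exp (2 * R) * 144 * exp (R\<^sup>2) * (exp (1/4) * 144)) / (1 - 2 powr (- (\<tau> + s - 2)))"
  have C: "0 \<le> C"
    using weight_less_one[of "\<tau> + s - 2"] st by (simp add: C_def)
  have "discrete_bound s 1 \<tau> R (exp (1/2) * C)"
    unfolding discrete_bound_def
  proof (intro allI impI)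
    fix m P w Q \<nu> e
    assume fP: "frostman s m P w" and fQ: "frostman \<tau> m Q \<nu>" and PR: "P \<subseteq> cball 0 R"
      and QI: "Q \<subseteq> {-1..1}" and e: "0 < e" and cov: "\<forall>b\<in>Q. covered 1 m e (lproj b ` P)"
    note P = frostmanD(1,2)[OF fP]
    note nu = frostmanD(1,2)[OF fQ]
    define S where "S b = (energy P w (\<lambda>z. exp (- (4 ^ m / 2 * (lproj b z)\<^sup>2))))" for b
    have one: "(sum w P)\<^sup>2 \<le> e * 2 ^ m * (exp (1/2) * S b)" if b: "b \<in> Q" for b
    proof -
      have "(sum w P)\<^sup>2 \<le> e * 2 ^ m * (\<Sum>p\<in>P. \<Sum>q\<in>P. w p * w q * of_bool (\<bar>lproj b p - lproj b q\<bar> \<le> (1/2) ^ m))"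
        using P cov b by (intro covered_scale_energy) auto
      also have "\<dots> \<le> e * 2 ^ m * (energy P w (\<lambda>z. (exp (1/2) * exp (- (4 ^ m / 2 * (lproj b z)\<^sup>2)))))"
      proof (intro mult_left_mono sum_mono)
        fix p q
        show "of_bool (\<bar>lproj b p - lproj b q\<bar> \<le> (1/2) ^ m) \<le> exp (1/2) * exp (- (4 ^ m / 2 * (lproj b (p - q))\<^sup>2))"
        proof (cases "\<bar>lproj b p - lproj b q\<bar> \<le> (1/2) ^ m")
          case True
          then have "\<bar>lproj b (p - q)\<bar>\<^sup>2 \<le> ((1/2) ^ m)\<^sup>2" by (intro power_mono) (auto simp: lproj_diff)
          also have "((1/2::real) ^ m)\<^sup>2 = (1/4) ^ m" by (simp add: power2_eq_square flip: power_mult_distrib)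
          finally have "4 ^ m / 2 * (lproj b (p - q))\<^sup>2 \<le> 4 ^ m / 2 * (1/4) ^ m" by (intro mult_left_mono) auto
          then have "4 ^ m / 2 * (lproj b (p - q))\<^sup>2 \<le> 1/2" by (simp add: power_divide)
          then show ?thesis using True by (simp flip: exp_add)
        qed simp
      qed (use P e in auto)
      also have "\<dots> = e * 2 ^ m * (exp (1/2) * S b)"
        by (simp add: S_def sum_distrib_left mult_ac)
      finally show ?thesis .
    qed
    have "(sum w P)\<^sup>2 * sum \<nu> Q = (\<Sum>b\<in>Q. \<nu> b * (sum w P)\<^sup>2)" by (simp add: sum_distrib_right mult.commute)
    also have "\<dots> \<le> (\<Sum>b\<in>Q. \<nu> b * (e * 2 ^ m * (exp (1/2) * S b)))"
      using nu one by (intro sum_mono mult_left_mono)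
    also have "\<dots> = e * exp (1/2) * (2 ^ m * (\<Sum>b\<in>Q. \<nu> b * S b))" by (simp add: sum_distrib_left mult_ac)
    also have "\<dots> \<le> e * exp (1/2) * C"
      unfolding S_def C_def using e by (intro mult_left_mono smoothed_energy_le[OF fP fQ PR QI st]) auto
    finally show "(sum w P)\<^sup>2 * sum \<nu> Q \<le> exp (1/2) * C * e" by (simp add: mult_ac)
  qed
  then show ?thesis using C by (intro exI[of _ "exp (1/2) * C"]) auto
qed

lemma falconer_slopes:
  fixes A :: "(real^2) set"
  assumes "A \<in> sets borel" "hausdorff_measure s A \<noteq> 0" "0 < s" "0 < \<tau>" "2 < \<tau> + s"
  shows "hausdorff_measure \<tau> {b\<in>{-1..1}. hausdorff_measure 1 (lproj b ` A) = 0} = 0"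
  using assms by (intro exceptional_null[where s = s] falconer_estimate) auto

section \<open>Closest-point projections\<close>

lemma is_normD:
  assumes "is_norm N"
  shows "0 \<le> N x" "N x = 0 \<longleftrightarrow> x = 0" "N (c *\<^sub>R x) = \<bar>c\<bar> * N x" "N (x + y) \<le> N x + N y"
  using assms by (auto simp: is_norm_def)

lemma is_norm_minus: "is_norm N \<Longrightarrow> N (- x) = N x"
  using is_normD(3)[of N "-1" x] by simp

lemma is_norm_pos: "is_norm N \<Longrightarrow> x \<noteq> 0 \<Longrightarrow> 0 < N x"
  using is_normD(1,2)[of N x] by (simp add: less_le)

lemma is_norm_diff: "is_norm N \<Longrightarrow> \<bar>N x - N y\<bar> \<le> N (x - y)"
  using is_normD(4)[of N "x - y" y] is_normD(4)[of N "y - x" x] is_norm_minus[of N "x - y"] by simp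

lemma real2_expand: "(x :: real^2) = x $ 1 *\<^sub>R axis 1 1 + x $ 2 *\<^sub>R axis 2 1"
  by (simp add: vec_eq_iff forall_2 axis_def)

lemma is_norm_continuous:
  fixes N :: "real^2 \<Rightarrow> real"
  assumes "is_norm N"
  shows "continuous_on S N"
proof -
  define C where "C = N (axis 1 1) + N (axis 2 1)"
  have le: "N x \<le> C * norm x" for x
  proof -
    have "N x \<le> N (x $ 1 *\<^sub>R axis 1 1) + N (x $ 2 *\<^sub>R axis 2 1)"
      using is_normD(4)[OF assms, of "x $ 1 *\<^sub>R axis 1 1" "x $ 2 *\<^sub>R axis 2 1"] real2_expand[of x] by simp
    also have "\<dots> = \<bar>x $ 1\<bar> * N (axis 1 1) + \<bar>x $ 2\<bar> * N (axis 2 1)"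
      using is_normD(3)[OF assms] by simp
    also have "\<dots> \<le> norm x * N (axis 1 1) + norm x * N (axis 2 1)"
      using is_normD(1)[OF assms] component_le_norm_cart by (intro add_mono mult_right_mono)
    finally show ?thesis by (simp add: C_def algebra_simps)
  qed
  have C: "0 \<le> C" using is_normD(1)[OF assms] by (simp add: C_def)
  have "C-lipschitz_on S N"
  proof (rule lipschitz_onI[OF _ C])
    fix x y
    have "\<bar>N x - N y\<bar> \<le> N (x - y)" by (rule is_norm_diff[OF assms])
    also have "\<dots> \<le> C * norm (x - y)" by (rule le)
    finally show "dist (N x) (N y) \<le> C * dist x y" by (simp add: dist_norm)
  qed
  then show ?thesis by (rule lipschitz_on_continuous_on)
qed

section \<open>The gradient of a norm and strict convexity\<close>

lemma C_k_on_2_differentiable: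
  fixes N :: "real^2 \<Rightarrow> real"
  assumes "C_k_on 2 N (UNIV - {0})" "x \<noteq> 0"
  shows "N differentiable at x"
  using assms unfolding C_k_on_def by (auto dest!: spec[of _ "[]"] simp: iter_partial_deriv_def)

definition grad :: "(real^2 \<Rightarrow> real) \<Rightarrow> real^2 \<Rightarrow> real^2" where
  "grad N x = (\<Sum>b\<in>Basis. partial_deriv b N x *\<^sub>R b)"

lemma has_derivative_grad:
  assumes "N differentiable at x"
  shows "(N has_derivative (\<lambda>h. grad N x \<bullet> h)) (at x)"
proof -
  let ?D = "frechet_derivative N (at x)"
  have D: "(N has_derivative ?D) (at x)" using assms frechet_derivative_works by blast
  interpret linear ?D using D by (rule has_derivative_linear)
  have "?D h = grad N x \<bullet> h" for h
  proof -
    have "?D h = ?D (\<Sum>b\<in>Basis. (h \<bullet> b) *\<^sub>R b)" by (simp add: euclidean_representation)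
    also have "\<dots> = (\<Sum>b\<in>Basis. (h \<bullet> b) * ?D b)" by (simp add: sum scale)
    also have "\<dots> = (\<Sum>b\<in>Basis. ?D b * (b \<bullet> h))" by (simp add: inner_commute mult.commute)
    also have "\<dots> = grad N x \<bullet> h" by (simp add: grad_def inner_sum_left partial_deriv_def)
    finally show ?thesis .
  qed
  then show ?thesis using D by (metis (no_types, lifting) ext)
qed

text \<open>Euler's relation for functions homogeneous of degree 1: along its own ray
  \<open>N\<close> is the linear function \<open>(1 + t) * N x\<close> near
  \<open>t = 0\<close>.\<close>

lemma grad_inner_self:
  assumes N: "is_norm N" and d: "N differentiable at x"
  shows "grad N x \<bullet> x = N x"
proof -
  have "((\<lambda>t::real. N (x + t *\<^sub>R x)) has_derivative (\<lambda>t. grad N x \<bullet> (t *\<^sub>R x))) (at 0)"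
    by (rule has_derivative_compose[where g = N]) (auto intro!: derivative_eq_intros has_derivative_grad[OF d])
  then have "((\<lambda>t::real. N (x + t *\<^sub>R x)) has_real_derivative (grad N x \<bullet> x)) (at 0)"
    by (simp add: has_field_derivative_def mult.commute[of _ "grad N x \<bullet> x"] mult_commute_abs)
  moreover have "((\<lambda>t::real. N (x + t *\<^sub>R x)) has_real_derivative N x) (at 0)"
  proof -
    have der: "((\<lambda>t::real. (1 + t) * N x) has_real_derivative N x) (at 0)"
      by (auto intro!: derivative_eq_intros)
    have ev: "\<forall>\<^sub>F t in nhds (0::real). (1 + t) * N x = N (x + t *\<^sub>R x)"
    proof -
      have "\<forall>\<^sub>F t in nhds (0::real). -1 < t" by (rule order_tendstoD(1)[OF filterlim_ident]) simp
      then show ?thesis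
      proof eventually_elim
        case (elim t)
        have "x + t *\<^sub>R x = (1 + t) *\<^sub>R x" by (simp add: scaleR_add_left)
        then show ?case using elim is_normD(3)[OF N, of "1 + t" x] by simp
      qed
    qed
    show ?thesis using der unfolding DERIV_cong_ev[OF refl ev refl] .
  qed
  ultimately show ?thesis by (rule DERIV_unique)
qed

lemma grad_nonzero:
  assumes "is_norm N" "N differentiable at x" "x \<noteq> 0"
  shows "grad N x \<noteq> 0"
  using grad_inner_self[OF assms(1,2)] is_norm_pos[OF assms(1,3)] by auto

text \<open>A convex function lies above its tangent; along the line from \<open>x\<close> to
  \<open>y\<close> this is the claim, once the terms in \<open>x\<close> cancel by Euler's
  relation.\<close>

lemma grad_support:
  assumes N: "is_norm N" and d: "N differentiable at x"
  shows "grad N x \<bullet> y \<le> N y"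
proof -
  let ?\<phi> = "\<lambda>t::real. N (x + t *\<^sub>R (y - x))"
  have "(?\<phi> has_derivative (\<lambda>t. grad N x \<bullet> (t *\<^sub>R (y - x)))) (at 0)"
    by (rule has_derivative_compose[where g = N]) (auto intro!: derivative_eq_intros has_derivative_grad[OF d])
  then have "(?\<phi> has_real_derivative (grad N x \<bullet> (y - x))) (at 0)"
    by (simp add: has_field_derivative_def mult_commute_abs)
  moreover have "convex_on UNIV ?\<phi>"
  proof (rule convex_onI)
    fix t a b :: real assume t: "0 < t" "t < 1"
    have "x + ((1 - t) *\<^sub>R a + t *\<^sub>R b) *\<^sub>R (y - x) = (1 - t) *\<^sub>R (x + a *\<^sub>R (y - x)) + t *\<^sub>R (x + b *\<^sub>R (y - x))"
      by (simp add: algebra_simps)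
    then have "?\<phi> ((1 - t) *\<^sub>R a + t *\<^sub>R b) \<le> N ((1 - t) *\<^sub>R (x + a *\<^sub>R (y - x))) + N (t *\<^sub>R (x + b *\<^sub>R (y - x)))"
      using is_normD(4)[OF N] by metis
    also have "\<dots> = (1 - t) * ?\<phi> a + t * ?\<phi> b" using t is_normD(3)[OF N] by simp
    finally show "?\<phi> ((1 - t) *\<^sub>R a + t *\<^sub>R b) \<le> (1 - t) * ?\<phi> a + t * ?\<phi> b" .
  qed simp
  ultimately have "?\<phi> 1 - ?\<phi> 0 \<ge> (grad N x \<bullet> (y - x)) * (1 - 0)"
    by (intro convex_on_imp_above_tangent[where A = UNIV]) auto
  then show ?thesis using grad_inner_self[OF N d] by (simp add: inner_diff_right)
qed

lemma sphere_frontier_unit_ball: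
  fixes N :: "real^2 \<Rightarrow> real"
  assumes N: "is_norm N"
  shows "{x. N x = 1} \<subseteq> frontier (unit_ball N)" "frontier (unit_ball N) \<subseteq> {x. N x \<le> 1}"
proof -
  show "{x. N x = 1} \<subseteq> frontier (unit_ball N)"
  proof (rule subsetI, unfold frontier_def, intro DiffI)
    fix x assume x: "x \<in> {x. N x = 1}"
    then show "x \<in> closure (unit_ball N)" using closure_subset[of "unit_ball N"] by (auto simp: unit_ball_def)
    have x0: "x \<noteq> 0" using x is_normD(2)[OF N, of x] by auto
    show "x \<notin> interior (unit_ball N)"
    proof
      assume "x \<in> interior (unit_ball N)"
      then obtain e where e: "0 < e" "ball x e \<subseteq> unit_ball N" by (meson mem_interior)
      define c where "c = 1 + e / (2 * norm x)"
      have c: "1 < c" using e x0 by (simp add: c_def)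
      have "dist x (c *\<^sub>R x) = e / 2"
      proof -
        have "x - c *\<^sub>R x = (1 - c) *\<^sub>R x" by (simp add: scaleR_diff_left)
        then show ?thesis using e x0 by (simp add: dist_norm c_def)
      qed
      then have "c *\<^sub>R x \<in> unit_ball N" using e by (intro subsetD[OF e(2)]) simp
      then show False using c x is_normD(3)[OF N, of c x] by (simp add: unit_ball_def)
    qed
  qed
  have "closed (unit_ball N)"
    unfolding unit_ball_def by (intro closed_Collect_le is_norm_continuous N continuous_on_const)
  then show "frontier (unit_ball N) \<subseteq> {x. N x \<le> 1}"
    using frontier_subset_closed by (auto simp: unit_ball_def)
qed

text \<open>Both the limit and the difference quotients may be taken along \<open>T\<close>, where
  they vanish.\<close>

lemma derivative_zero_at_limit_of_zeros:
  fixes f :: "real \<Rightarrow> real"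
  assumes "t islimpt T" "\<And>x. x \<in> T \<Longrightarrow> f x = 0" "(f has_real_derivative D) (at t)"
  shows "f t = 0" "D = 0"
proof -
  have nt: "at t within T \<noteq> bot" using assms(1) by (simp add: trivial_limit_within)
  have "isCont f t" using assms(3) by (rule DERIV_isCont)
  then have "(f \<longlongrightarrow> f t) (at t)" by (simp add: isCont_def)
  then have "(f \<longlongrightarrow> f t) (at t within T)" by (rule tendsto_within_subset) simp
  moreover have "(f \<longlongrightarrow> 0) (at t within T)"
    by (rule tendsto_eventually) (auto simp: eventually_at_filter assms(2))
  ultimately show ft: "f t = 0" using tendsto_unique[OF nt] by blast
  have "(f has_real_derivative D) (at t within T)"
    using assms(3) by (rule has_field_derivative_subset) simp
  then have "((\<lambda>y. (f y - f t) / (y - t)) \<longlongrightarrow> D) (at t within T)"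
    by (simp add: has_field_derivative_iff)
  moreover have "((\<lambda>y. (f y - f t) / (y - t)) \<longlongrightarrow> 0) (at t within T)"
    by (rule tendsto_eventually) (auto simp: eventually_at_filter assms(2) ft)
  ultimately show "D = 0" using tendsto_unique[OF nt] by blast
qed

text \<open>\<open>n\<close> and \<open>u\<close> form an orthogonal basis of the plane. The
  argument runs through the determinant \<open>cr\<close> and Lagrange's identity.\<close>

lemma orthogonal_real2:
  fixes n u k :: "real^2"
  assumes "n \<noteq> 0" "u \<noteq> 0" "n \<bullet> u = 0" "n \<bullet> k = 0" "u \<bullet> k = 0"
  shows "k = 0"
proof -
  have in2: "x \<bullet> y = x $ 1 * y $ 1 + x $ 2 * y $ 2" for x y :: "real^2"
    by (simp add: inner_vec_def sum_2)
  define cr where "cr x y = x $ 1 * y $ 2 - x $ 2 * y $ 1" for x y :: "real^2"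
  have lag: "(x \<bullet> x) * (y \<bullet> y) = (x \<bullet> y)\<^sup>2 + (cr x y)\<^sup>2" for x y
    unfolding in2 cr_def by (simp add: power2_eq_square algebra_simps)
  have "(n \<bullet> n) * (u \<bullet> k) = (n \<bullet> u) * (n \<bullet> k) + cr n u * cr n k"
    unfolding in2 cr_def by (simp add: algebra_simps)
  then have "cr n u * cr n k = 0" using assms by simp
  moreover have "cr n u \<noteq> 0" using lag[of n u] assms by auto
  ultimately have "cr n k = 0" by simp
  then show ?thesis using lag[of n k] assms by auto
qed

text \<open>If the unit sphere contained a segment, the supporting functional \<open>n\<close> would be constant on an
  infinite set of points of the curve. At a limit point both \<open>n \<bullet> \<gamma>'\<close> and \<open>n \<bullet> \<gamma>''\<close> vanish, and
  \<open>\<gamma>''\<close> is also orthogonal to \<open>\<gamma>'\<close>, so the curvature is zero there.\<close>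

lemma strictly_convex_of_curvature:
  fixes N :: "real^2 \<Rightarrow> real"
  assumes N: "is_norm N" and d: "\<And>x. x \<noteq> 0 \<Longrightarrow> N differentiable at x"
    and curv: "strictly_positive_curvature (frontier (unit_ball N))"
    and ab: "N a = 1" "N b = 1" "a \<noteq> b"
  shows "N ((1/2) *\<^sub>R (a + b)) < 1"
proof (rule ccontr)
  assume neg: "\<not> N ((1/2) *\<^sub>R (a + b)) < 1"
  define c where "c = (1/2) *\<^sub>R (a + b)"
  have "N c \<ge> 1" using neg by (simp add: c_def)
  moreover have "N c \<le> 1" using is_normD(3)[OF N, of "1/2" "a + b"] is_normD(4)[OF N, of a b] ab by (simp add: c_def)
  ultimately have Nc: "N c = 1" by simp
  then have c0: "c \<noteq> 0" using is_normD(2)[OF N, of c] by auto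
  define n where "n = grad N c"
  have n0: "n \<noteq> 0" unfolding n_def by (rule grad_nonzero[OF N d[OF c0] c0])
  have nle: "n \<bullet> y \<le> N y" for y unfolding n_def by (rule grad_support[OF N d[OF c0]])
  have nc: "n \<bullet> c = 1" unfolding n_def using grad_inner_self[OF N d[OF c0]] Nc by simp
  have nab: "n \<bullet> a = 1" "n \<bullet> b = 1"
    using nle[of a] nle[of b] ab nc by (auto simp: c_def inner_add_right)
  define x where "x s = a + s *\<^sub>R (b - a)" for s :: real
  have nx: "n \<bullet> x s = 1" for s using nab by (simp add: x_def inner_add_right inner_diff_right)
  have Nx: "N (x s) = 1" if "s \<in> {0..1}" for s
  proof -
    have "x s = (1 - s) *\<^sub>R a + s *\<^sub>R b" by (simp add: x_def algebra_simps)
    then have "N (x s) \<le> (1 - s) * N a + s * N b"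
      using is_normD(4)[OF N, of "(1 - s) *\<^sub>R a" "s *\<^sub>R b"] is_normD(3)[OF N] that by simp
    then show ?thesis using nle[of "x s"] nx[of s] ab by simp
  qed
  define F where "F = x ` {0..1}"
  have "inj x" using ab by (auto simp: x_def inj_on_def)
  then have infF: "infinite F"
    unfolding F_def using finite_image_iff[of x "{0..1}"] inj_on_subset[of x UNIV "{0..1}"] infinite_Icc[of "0::real" 1] by auto
  obtain \<gamma> L where arc: "arclength_parametrization \<gamma> L (frontier (unit_ball N))" and pos: "\<And>t. 0 < curvature \<gamma> t"
    using curv by (auto simp: strictly_positive_curvature_def)
  have Ck: "C_k_on 2 \<gamma> UNIV" and unit: "\<And>t. norm (vector_derivative \<gamma> (at t)) = 1"
    and img: "\<gamma> ` {0..<L} = frontier (unit_ball N)"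
    using arc by (auto simp: arclength_parametrization_def)
  define \<gamma>1 where "\<gamma>1 t = vector_derivative \<gamma> (at t)" for t
  define \<gamma>2 where "\<gamma>2 t = vector_derivative \<gamma>1 (at t)" for t
  have diff0: "\<gamma> differentiable at t" for t
    using Ck unfolding C_k_on_def by (auto dest!: spec[of _ "[]"] simp: iter_partial_deriv_def)
  have "partial_deriv 1 \<gamma> = \<gamma>1"
    by (rule ext) (simp add: partial_deriv_def \<gamma>1_def frechet_derivative_eq_vector_derivative[OF diff0])
  moreover have "partial_deriv 1 \<gamma> differentiable at t" for t
    using Ck unfolding C_k_on_def by (auto dest!: spec[of _ "[1]"] simp: iter_partial_deriv_def)
  ultimately have diff1: "\<gamma>1 differentiable at t" for t by simp
  have D0: "(\<gamma> has_vector_derivative \<gamma>1 t) (at t)" for t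
    unfolding \<gamma>1_def using diff0 vector_derivative_works by blast
  have D1: "(\<gamma>1 has_vector_derivative \<gamma>2 t) (at t)" for t
    unfolding \<gamma>2_def using diff1 vector_derivative_works by blast
  have curv2: "\<gamma>2 t \<noteq> 0" for t
    using pos[of t] unfolding curvature_def \<gamma>2_def \<gamma>1_def by auto
  have perp: "\<gamma>1 t \<bullet> \<gamma>2 t = 0" for t
  proof -
    have "((\<lambda>t. \<gamma>1 t \<bullet> \<gamma>1 t) has_vector_derivative (\<gamma>1 t \<bullet> \<gamma>2 t + \<gamma>2 t \<bullet> \<gamma>1 t)) (at t)"
      by (rule bounded_bilinear.has_vector_derivative[OF bounded_bilinear_inner D1 D1])
    moreover have "(\<lambda>t. \<gamma>1 t \<bullet> \<gamma>1 t) = (\<lambda>t. 1)"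
      using unit by (auto simp: \<gamma>1_def dot_square_norm)
    ultimately have "((\<lambda>t::real. 1::real) has_vector_derivative (\<gamma>1 t \<bullet> \<gamma>2 t + \<gamma>2 t \<bullet> \<gamma>1 t)) (at t)" by simp
    then have "\<gamma>1 t \<bullet> \<gamma>2 t + \<gamma>2 t \<bullet> \<gamma>1 t = 0"
      using vector_derivative_unique_at[OF _ has_vector_derivative_const] by blast
    then show ?thesis by (simp add: inner_commute)
  qed
  \<comment> \<open>On the open parameter interval every point of \<open>T\<close> is an interior
    maximum of \<open>n \<bullet> \<gamma>\<close>; omitting 0 loses at most one point of
    \<open>F\<close>. The limit point may be an endpoint, which is harmless because
    \<open>\<gamma>\<close> is differentiable on the whole line.\<close>
  define T where "T = {t\<in>{0<..<L}. \<gamma> t \<in> F}"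
  have "F \<subseteq> frontier (unit_ball N)"
    using Nx sphere_frontier_unit_ball(1)[OF N] by (auto simp: F_def)
  have "F \<subseteq> \<gamma> ` insert 0 T"
  proof
    fix y assume y: "y \<in> F"
    then have "y \<in> \<gamma> ` {0..<L}" using \<open>F \<subseteq> _\<close> img by blast
    then obtain r where "r \<in> {0..<L}" "y = \<gamma> r" by blast
    then show "y \<in> \<gamma> ` insert 0 T" using y by (cases "r = 0") (auto simp: T_def)
  qed
  then have "infinite (insert 0 T)" using infF finite_surj by blast
  then have "infinite T" by simp
  moreover have "T \<subseteq> {0..L}" by (auto simp: T_def)
  ultimately obtain t where t: "t islimpt T"
    using compact_Icc[of 0 L] unfolding compact_eq_Bolzano_Weierstrass by blast
  have gle: "n \<bullet> \<gamma> r \<le> 1" if "r \<in> {0..<L}" for r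
    using nle[of "\<gamma> r"] that img sphere_frontier_unit_ball(2)[OF N] by fastforce
  have dg: "((\<lambda>r. n \<bullet> \<gamma> r) has_real_derivative (n \<bullet> \<gamma>1 r)) (at r)" for r
    using bounded_linear.has_vector_derivative[OF bounded_linear_inner_right D0, of n]
    by (simp add: has_real_derivative_iff_has_vector_derivative)
  have dg1: "((\<lambda>r. n \<bullet> \<gamma>1 r) has_real_derivative (n \<bullet> \<gamma>2 r)) (at r)" for r
    using bounded_linear.has_vector_derivative[OF bounded_linear_inner_right D1, of n]
    by (simp add: has_real_derivative_iff_has_vector_derivative)
  have zero: "n \<bullet> \<gamma>1 r = 0" if "r \<in> T" for r
  proof -
    have "n \<bullet> \<gamma> r = 1" using that nx by (auto simp: T_def F_def)
    moreover have "0 < min r (L - r)" using that by (simp add: T_def)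
    moreover have "\<bar>r - y\<bar> < min r (L - r) \<Longrightarrow> y \<in> {0..<L}" for y by auto
    ultimately show ?thesis using gle by (intro DERIV_local_max[OF dg, of "min r (L - r)"]) (auto simp del: atLeastLessThan_iff)
  qed
  have "n \<bullet> \<gamma>1 t = 0" "n \<bullet> \<gamma>2 t = 0"
    using derivative_zero_at_limit_of_zeros[OF t zero dg1] by auto
  moreover have "\<gamma>1 t \<noteq> 0" using unit[of t] by (auto simp: \<gamma>1_def)
  ultimately have "\<gamma>2 t = 0" using orthogonal_real2[OF n0 _ _ _ perp] by blast
  then show False using curv2 by blast
qed

text \<open>\<open>\<kappa>\<close> is the dual norm of \<open>v\<close>: the maximum of
  \<open>v \<bullet> u / N u\<close>, attained on the compact Euclidean circle and extended to all
  vectors by homogeneity.\<close>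

lemma norm_support_exists:
  fixes N :: "real^2 \<Rightarrow> real"
  assumes N: "is_norm N" and v: "norm v = 1"
  obtains u \<kappa> where "norm u = 1" "0 < \<kappa>" "v \<bullet> u = \<kappa> * N u" "\<And>z. v \<bullet> z \<le> \<kappa> * N z"
proof -
  have cont: "continuous_on (sphere 0 1) (\<lambda>u. v \<bullet> u / N u)"
  proof (intro continuous_on_divide continuous_on_inner continuous_on_const continuous_on_id is_norm_continuous[OF N] ballI)
    fix x :: "real^2" assume "x \<in> sphere 0 1"
    then have "x \<noteq> 0" by auto
    then show "N x \<noteq> 0" using is_normD(2)[OF N, of x] by blast
  qed
  obtain u where u: "u \<in> sphere 0 1" "\<And>y. y \<in> sphere 0 1 \<Longrightarrow> v \<bullet> y / N y \<le> v \<bullet> u / N u"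
  proof -
    have "sphere (0::real^2) 1 \<noteq> {}" using v by (auto simp: dist_norm)
    then show ?thesis
      using continuous_attains_sup[OF compact_sphere _ cont] that by blast
  qed
  define \<kappa> where "\<kappa> = v \<bullet> u / N u"
  have Nu: "0 < N u" using u(1) by (intro is_norm_pos N) auto
  have le: "v \<bullet> z \<le> \<kappa> * N z" for z
  proof (cases "z = 0")
    case False
    have "v \<bullet> sgn z / N (sgn z) \<le> \<kappa>" unfolding \<kappa>_def using False by (intro u) (simp add: norm_sgn)
    moreover have "N (sgn z) = N z / norm z" using is_normD(3)[OF N, of "inverse (norm z)" z] by (simp add: sgn_div_norm divide_inverse)
    moreover have "v \<bullet> sgn z = v \<bullet> z / norm z" by (simp add: sgn_div_norm divide_inverse)
    ultimately have "v \<bullet> z / N z \<le> \<kappa>" using False by simp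
    then show ?thesis using is_norm_pos[OF N False] by (simp add: field_simps)
  qed (use is_normD(2)[OF N, of 0] in simp)
  have v0: "v \<noteq> 0" using v by auto
  have "0 < v \<bullet> v" using v0 by simp
  then have "0 < \<kappa> * N v" using le[of v] by linarith
  then have "0 < \<kappa>" using is_norm_pos[OF N v0] by (simp add: zero_less_mult_iff)
  moreover have "v \<bullet> u = \<kappa> * N u" using Nu by (simp add: \<kappa>_def)
  ultimately show ?thesis using that[of u \<kappa>] u(1) le by auto
qed

text \<open>The function \<open>\<kappa> * N y - v \<bullet> y\<close> has its minimum 0 at
  \<open>z\<close>, so its gradient vanishes there and \<open>v\<close> is a positive multiple of
  \<open>grad N z\<close>.\<close>

lemma sgn_grad_of_support:
  assumes d: "N differentiable at z" and v: "norm v = 1" and k: "0 < \<kappa>" and eq: "v \<bullet> z = \<kappa> * N z"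
    and le: "\<And>y. v \<bullet> y \<le> \<kappa> * N y"
  shows "v = sgn (grad N z)"
proof -
  let ?f = "\<lambda>y. \<kappa> * N y - v \<bullet> y"
  have fd: "(?f has_derivative (\<lambda>h. \<kappa> * (grad N z \<bullet> h) - v \<bullet> h)) (at z)"
    by (intro derivative_intros has_derivative_grad[OF d])
  have "\<forall>y\<in>UNIV. ?f z \<le> ?f y" using eq le by simp
  then have zero: "(\<lambda>h. \<kappa> * (grad N z \<bullet> h) - v \<bullet> h) = (\<lambda>h. 0)"
    by (intro differential_zero_maxmin[OF UNIV_I open_UNIV fd] disjI2)
  have "(\<kappa> *\<^sub>R grad N z - v) \<bullet> h = 0" for h
    using fun_cong[OF zero, of h] by (simp add: inner_diff_left)
  then have "(\<kappa> *\<^sub>R grad N z - v) \<bullet> (\<kappa> *\<^sub>R grad N z - v) = 0" by blast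
  then have "v = \<kappa> *\<^sub>R grad N z" by simp
  then have "sgn v = sgn (grad N z)" using k by (simp add: sgn_scaleR)
  then show ?thesis using v by (simp add: sgn_div_norm)
qed

text \<open>By duality the \<open>N\<close>-distance from \<open>x\<close> to the line is
  \<open>\<bar>v \<bullet> x\<bar> / \<kappa>\<close>, and moving along \<open>u\<close> attains it.
  For two distinct minimizers, strict convexity would make their midpoint closer.\<close>

lemma norm_proj_eq:
  fixes N :: "real^2 \<Rightarrow> real"
  assumes N: "is_norm N"
    and strict: "\<And>a b. N a = 1 \<Longrightarrow> N b = 1 \<Longrightarrow> a \<noteq> b \<Longrightarrow> N ((1/2) *\<^sub>R (a + b)) < 1"
    and k: "0 < \<kappa>" and u: "u \<noteq> 0" and eq: "v \<bullet> u = \<kappa> * N u" and le: "\<And>y. v \<bullet> y \<le> \<kappa> * N y"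
  shows "norm_proj N v x = x - (v \<bullet> x / (v \<bullet> u)) *\<^sub>R u"
proof -
  define p where "p = x - (v \<bullet> x / (v \<bullet> u)) *\<^sub>R u"
  have vu: "0 < v \<bullet> u" using k is_norm_pos[OF N u] by (simp add: eq)
  have p: "p \<in> orth_line v" using vu by (simp add: p_def orth_line_def inner_diff_right)
  have Np: "N (x - p) = \<bar>v \<bullet> x\<bar> / \<kappa>"
    using is_normD(3)[OF N, of "v \<bullet> x / (v \<bullet> u)" u] vu k is_norm_pos[OF N u] by (simp add: p_def eq field_simps)
  have min: "N (x - p) \<le> N (x - q)" if "q \<in> orth_line v" for q
  proof -
    have "v \<bullet> (x - q) = v \<bullet> x" using that by (simp add: orth_line_def inner_diff_right)
    then have "\<bar>v \<bullet> x\<bar> \<le> \<kappa> * N (x - q)"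
      using le[of "x - q"] le[of "- (x - q)"] is_norm_minus[OF N, of "x - q"] by (simp add: inner_diff_right)
    then show ?thesis unfolding Np using k by (simp add: field_simps)
  qed
  show ?thesis
    unfolding norm_proj_def p_def[symmetric]
  proof (rule the_equality)
    show "p \<in> orth_line v \<and> (\<forall>q\<in>orth_line v. N (x - p) \<le> N (x - q))" using p min by blast
    fix p' assume p': "p' \<in> orth_line v \<and> (\<forall>q\<in>orth_line v. N (x - p') \<le> N (x - q))"
    define d where "d = N (x - p)"
    have d': "N (x - p') = d" using p' p min[of p'] unfolding d_def by (intro antisym) auto
    show "p' = p"
    proof (rule ccontr)
      assume ne: "p' \<noteq> p"
      have "d \<noteq> 0" using ne d' is_normD(2)[OF N, of "x - p"] is_normD(2)[OF N, of "x - p'"] by (auto simp: d_def)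
      then have d: "0 < d" using is_normD(1)[OF N, of "x - p"] by (simp add: d_def)
      let ?a = "(1 / d) *\<^sub>R (x - p)" and ?b = "(1 / d) *\<^sub>R (x - p')"
      have ab: "N ?a = 1" "N ?b = 1" using d d' is_normD(3)[OF N] by (auto simp: d_def)
      have "?a \<noteq> ?b" using ne d by auto
      then have "N ((1/2) *\<^sub>R (?a + ?b)) < 1" by (rule strict[OF ab])
      moreover have "(1/2) *\<^sub>R (?a + ?b) = (1 / d) *\<^sub>R (x - (1/2) *\<^sub>R (p + p'))"
        by (simp add: vec_eq_iff field_simps)
      ultimately have "N (x - (1/2) *\<^sub>R (p + p')) < d"
        using d is_normD(3)[OF N, of "1 / d" "x - (1/2) *\<^sub>R (p + p')"] by simp
      moreover have "(1/2) *\<^sub>R (p + p') \<in> orth_line v" using p p' by (simp add: orth_line_def inner_add_right)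
      ultimately show False using min unfolding d_def by fastforce
    qed
  qed
qed

text \<open>The factor \<open>c\<close> in the last conjunct allows \<open>u\<close> to be rescaled
  onto a fixed line \<open>p + b *\<^sub>R q\<close>, on which the slope is an affine
  coordinate.\<close>

lemma norm_proj_formula:
  fixes N :: "real^2 \<Rightarrow> real"
  assumes N: "is_norm N" and C2: "C_k_on 2 N (UNIV - {0})"
    and curv: "strictly_positive_curvature (frontier (unit_ball N))" and v: "norm v = 1"
  shows "\<exists>u. norm u = 1 \<and> 0 < v \<bullet> u \<and> (\<forall>x. norm_proj N v x = x - (v \<bullet> x / (v \<bullet> u)) *\<^sub>R u)
    \<and> (\<forall>c>0. v = sgn (grad N (c *\<^sub>R u)))"
proof -
  note d = C_k_on_2_differentiable[OF C2]
  obtain u \<kappa> where u: "norm u = 1" "0 < \<kappa>" "v \<bullet> u = \<kappa> * N u" "\<And>z. v \<bullet> z \<le> \<kappa> * N z"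
    using norm_support_exists[OF N v] by blast
  have u0: "u \<noteq> 0" using u(1) by auto
  show ?thesis
  proof (intro exI[of _ u] conjI allI impI)
    show "0 < v \<bullet> u" using u is_norm_pos[OF N u0] by simp
    show "norm_proj N v x = x - (v \<bullet> x / (v \<bullet> u)) *\<^sub>R u" for x
      using strictly_convex_of_curvature[OF N d curv] by (intro norm_proj_eq[OF N _ u(2) u0 u(3,4)]) auto
    show "v = sgn (grad N (c *\<^sub>R u))" if "0 < c" for c
      using u that is_normD(3)[OF N, of c u] u0 by (intro sgn_grad_of_support[OF d v u(2)]) auto
  qed (rule u)
qed

section \<open>Lipschitz dependence of the direction on the slope\<close>

lemma norm_sgn_diff_le:
  fixes x y :: "'a::real_normed_vector"
  assumes "x \<noteq> 0" "y \<noteq> 0"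
  shows "norm (sgn x - sgn y) \<le> 2 * norm (x - y) / norm x"
proof -
  have "sgn x - sgn y = (1 / norm x) *\<^sub>R (x - y) + (1 / norm x - 1 / norm y) *\<^sub>R y"
    using assms by (simp add: sgn_div_norm divide_inverse algebra_simps)
  then have "norm (sgn x - sgn y) \<le> norm ((1 / norm x) *\<^sub>R (x - y)) + norm ((1 / norm x - 1 / norm y) *\<^sub>R y)"
    by (metis norm_triangle_ineq)
  also have "norm ((1 / norm x) *\<^sub>R (x - y)) = norm (x - y) / norm x" by simp
  also have "norm ((1 / norm x - 1 / norm y) *\<^sub>R y) = \<bar>norm y - norm x\<bar> / norm x"
  proof -
    have "1 / norm x - 1 / norm y = (norm y - norm x) / (norm x * norm y)"
      using assms by (simp add: field_simps)
    then show ?thesis using assms by (simp add: abs_mult)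
  qed
  also have "\<dots> \<le> norm (x - y) / norm x"
    using norm_triangle_ineq3[of y x] by (intro divide_right_mono) (auto simp: norm_minus_commute)
  finally show ?thesis by simp
qed

text \<open>The second derivatives are continuous away from 0, hence bounded on the compact segment,
  so the gradient is Lipschitz there. Normalization preserves this because the norm of the gradient
  has a positive minimum on the segment.\<close>

lemma sgn_grad_lipschitz:
  fixes N :: "real^2 \<Rightarrow> real"
  assumes N: "is_norm N" and C2: "C_k_on 2 N (UNIV - {0})" and q: "q \<in> Basis"
    and nz: "\<And>b. p + b *\<^sub>R q \<noteq> 0"
  obtains L where "0 < L" "\<And>a b. a \<in> {-1..1} \<Longrightarrow> b \<in> {-1..1} \<Longrightarrow>
    dist (sgn (grad N (p + a *\<^sub>R q))) (sgn (grad N (p + b *\<^sub>R q))) \<le> L * dist a b"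
proof -
  let ?z = "\<lambda>b. p + b *\<^sub>R q"
  note d1 = C_k_on_2_differentiable[OF C2]
  have d2: "partial_deriv c N differentiable at x" if "x \<noteq> 0" "c \<in> Basis" for x c
    using C2 that unfolding C_k_on_def by (auto dest!: spec[of _ "[c]"] simp: iter_partial_deriv_def)
  have c2: "continuous_on (UNIV - {0}) (partial_deriv q (partial_deriv c N))" if "c \<in> Basis" for c
    using C2 that q unfolding C_k_on_def by (auto dest!: spec[of _ "[q, c]"] simp: iter_partial_deriv_def)
  have "\<exists>M. \<forall>a\<in>{-1..1}. \<forall>b\<in>{-1..1}. \<bar>partial_deriv c N (?z a) - partial_deriv c N (?z b)\<bar> \<le> M * \<bar>a - b\<bar>"
    if c: "c \<in> Basis" for c
  proof -
    let ?g = "\<lambda>b. partial_deriv c N (?z b)" and ?g' = "\<lambda>b. partial_deriv q (partial_deriv c N) (?z b)"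
    have der: "(?g has_real_derivative ?g' b) (at b within {-1..1})" for b
    proof -
      have "(partial_deriv c N has_derivative frechet_derivative (partial_deriv c N) (at (?z b))) (at (?z b))"
        using d2[OF nz c] frechet_derivative_works by blast
      then have "(?g has_derivative (\<lambda>h. frechet_derivative (partial_deriv c N) (at (?z b)) (h *\<^sub>R q))) (at b within {-1..1})"
        by (rule has_derivative_compose[rotated]) (auto intro!: derivative_eq_intros)
      moreover have "frechet_derivative (partial_deriv c N) (at (?z b)) (h *\<^sub>R q) = ?g' b * h" for h
        using linear_frechet_derivative[OF d2[OF nz c]] by (simp add: partial_deriv_def linear_cmul mult.commute)
      ultimately show ?thesis by (simp add: has_field_derivative_def)
    qed
    have "continuous_on {-1..1} ?g'"
      by (rule continuous_on_compose2[OF c2[OF c]]) (use nz in \<open>auto intro!: continuous_intros\<close>)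
    then have "compact (?g' ` {-1..1})" by (rule compact_continuous_image) simp
    then obtain M where M: "\<And>b. b \<in> {-1..1} \<Longrightarrow> norm (?g' b) \<le> M"
      using compact_imp_bounded bounded_iff by (metis (no_types, lifting) imageI)
    have "norm (?g a - ?g b) \<le> M * norm (a - b)" if "a \<in> {-1..1}" "b \<in> {-1..1}" for a b
      by (rule field_differentiable_bound[OF _ der M]) (use that in auto)
    then show ?thesis by (intro exI[of _ M]) auto
  qed
  then obtain M where M: "\<And>c a b. c \<in> Basis \<Longrightarrow> a \<in> {-1..1} \<Longrightarrow> b \<in> {-1..1} \<Longrightarrow>
      \<bar>partial_deriv c N (?z a) - partial_deriv c N (?z b)\<bar> \<le> M c * \<bar>a - b\<bar>" by metis
  define K where "K = (\<Sum>c\<in>Basis. M c)"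
  have K: "norm (grad N (?z a) - grad N (?z b)) \<le> K * \<bar>a - b\<bar>" if "a \<in> {-1..1}" "b \<in> {-1..1}" for a b
  proof -
    have "grad N (?z a) - grad N (?z b) = (\<Sum>c\<in>Basis. (partial_deriv c N (?z a) - partial_deriv c N (?z b)) *\<^sub>R c)"
      by (simp add: grad_def scaleR_diff_left sum_subtractf)
    then have "norm (grad N (?z a) - grad N (?z b)) \<le> (\<Sum>c\<in>Basis. norm ((partial_deriv c N (?z a) - partial_deriv c N (?z b)) *\<^sub>R c))"
      by (simp only: norm_sum)
    also have "\<dots> \<le> (\<Sum>c\<in>Basis. M c * \<bar>a - b\<bar>)" using M that by (intro sum_mono) auto
    finally show ?thesis by (simp add: K_def sum_distrib_right)
  qed
  have g0: "grad N (?z b) \<noteq> 0" for b by (rule grad_nonzero[OF N d1[OF nz] nz])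
  have "continuous_on {-1..1} (\<lambda>b. grad N (?z b))"
  proof (rule lipschitz_on_continuous_on)
    show "\<bar>K\<bar>-lipschitz_on {-1..1} (\<lambda>b. grad N (?z b))"
    proof (rule lipschitz_onI)
      fix a b :: real assume "a \<in> {-1..1}" "b \<in> {-1..1}"
      then have "norm (grad N (?z a) - grad N (?z b)) \<le> K * \<bar>a - b\<bar>" by (rule K)
      also have "\<dots> \<le> \<bar>K\<bar> * \<bar>a - b\<bar>" by (intro mult_right_mono) auto
      finally show "dist (grad N (?z a)) (grad N (?z b)) \<le> \<bar>K\<bar> * dist a b" by (simp add: dist_norm)
    qed simp
  qed
  then have "continuous_on {-1..1} (\<lambda>b. norm (grad N (?z b)))" by (intro continuous_intros)
  then have "\<exists>x\<in>{-1..1}. \<forall>y\<in>{-1..1}. norm (grad N (?z x)) \<le> norm (grad N (?z y))"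
    by (intro continuous_attains_inf) auto
  then obtain b0 where b0: "\<And>b. b \<in> {-1..1} \<Longrightarrow> norm (grad N (?z b0)) \<le> norm (grad N (?z b))"
    by blast
  define m where "m = norm (grad N (?z b0))"
  have m: "0 < m" using g0 by (simp add: m_def)
  define L where "L = 2 * \<bar>K\<bar> / m + 1"
  show ?thesis
  proof (rule that)
    show "0 < L" using m by (simp add: L_def add_nonneg_pos)
    fix a b :: real assume ab: "a \<in> {-1..1}" "b \<in> {-1..1}"
    have "dist (sgn (grad N (?z a))) (sgn (grad N (?z b))) \<le> 2 * norm (grad N (?z a) - grad N (?z b)) / norm (grad N (?z a))"
      unfolding dist_norm by (rule norm_sgn_diff_le[OF g0 g0])
    also have "\<dots> \<le> 2 * norm (grad N (?z a) - grad N (?z b)) / m"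
      using m b0[OF ab(1)] by (intro divide_left_mono) (auto simp: m_def g0)
    also have "\<dots> \<le> 2 * (\<bar>K\<bar> * \<bar>a - b\<bar>) / m"
    proof (intro divide_right_mono mult_left_mono)
      have "K * \<bar>a - b\<bar> \<le> \<bar>K\<bar> * \<bar>a - b\<bar>" by (intro mult_right_mono) auto
      then show "norm (grad N (?z a) - grad N (?z b)) \<le> \<bar>K\<bar> * \<bar>a - b\<bar>" using K[OF ab] by linarith
    qed (use m in auto)
    also have "\<dots> \<le> L * dist a b" by (simp add: L_def dist_norm distrib_right)
    finally show "dist (sgn (grad N (?z a))) (sgn (grad N (?z b))) \<le> L * dist a b" .
  qed
qed

section \<open>Exceptional directions\<close>

lemma net_content_null_iff:
  fixes E :: "'a::euclidean_space set"
  assumes t: "0 < t"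
  shows "net_content t E = 0 \<longleftrightarrow> hausdorff_measure t E = 0"
proof
  assume null: "hausdorff_measure t E = 0"
  have "net_content t E \<le> 0"
  proof (rule ennreal_le_epsilon)
    fix e :: real assume "0 < e"
    then obtain V where "E \<subseteq> V" "net_content t V \<le> ennreal e"
      using hausdorff_null_open_superset[OF t null] by blast
    then show "net_content t E \<le> 0 + ennreal e" using net_content_mono[of E V t] by simp
  qed
  then show "net_content t E = 0" by simp
qed (rule hausdorff_null_of_net_content[OF t])

lemma hausdorff_null_UN:
  fixes E :: "nat \<Rightarrow> 'a::euclidean_space set"
  assumes "0 < t" "\<And>n. hausdorff_measure t (E n) = 0"
  shows "hausdorff_measure t (\<Union>n. E n) = 0"
  using assms(2) net_content_UN_null[of t E] unfolding net_content_null_iff[OF assms(1), symmetric] by blast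

lemma hausdorff_null_Un:
  fixes E F :: "'a::euclidean_space set"
  assumes "0 < t" "hausdorff_measure t E = 0" "hausdorff_measure t F = 0"
  shows "hausdorff_measure t (E \<union> F) = 0"
proof -
  have "(\<Union>n::nat. if n = 0 then E else F) = E \<union> F" by (auto split: if_splits)
  moreover have "hausdorff_measure t (\<Union>n::nat. if n = 0 then E else F) = 0"
    using assms by (intro hausdorff_null_UN) auto
  ultimately show ?thesis by simp
qed

section \<open>Hausdorff dimension\<close>

lemma hausdorff_dim_nonneg: "0 \<le> hausdorff_dim A"
  unfolding hausdorff_dim_def by (intro INF_greatest) auto

lemma hausdorff_dim_le:
  assumes "\<And>t. z < ereal t \<Longrightarrow> 0 \<le> t \<and> hausdorff_measure t A = 0"
  shows "hausdorff_dim A \<le> z"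
proof (rule dense_ge)
  fix y assume "z < y"
  then obtain t where t: "z < ereal t" "ereal t < y" using ereal_dense2 by blast
  then have "hausdorff_dim A \<le> ereal t"
    unfolding hausdorff_dim_def using assms by (intro INF_lower) auto
  then show "hausdorff_dim A \<le> y" using t by simp
qed

lemma hausdorff_null_above_dim:
  assumes "hausdorff_dim A < ereal t"
  shows "hausdorff_measure t A = 0"
proof -
  obtain s where s: "0 \<le> s" "hausdorff_measure s A = 0" "ereal s < ereal t"
    using assms unfolding hausdorff_dim_def INF_less_iff by auto
  then show ?thesis by (intro hausdorff_null_exponent_mono[of s A t]) auto
qed

lemma hausdorff_nonnull_below_dim:
  assumes "ereal t < hausdorff_dim A" "0 \<le> t"
  shows "hausdorff_measure t A \<noteq> 0"
proof
  assume "hausdorff_measure t A = 0"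
  then have "hausdorff_dim A \<le> ereal t"
    unfolding hausdorff_dim_def using assms(2) by (intro INF_lower) auto
  then show False using assms(1) by simp
qed

lemma hausdorff_dim_lipschitz_image:
  fixes f :: "'a::metric_space \<Rightarrow> 'b::metric_space"
  assumes "0 < L" "\<And>x y. dist (f x) (f y) \<le> L * dist x y"
  shows "hausdorff_dim (f ` A) \<le> hausdorff_dim A"
proof (rule hausdorff_dim_le)
  fix t assume t: "hausdorff_dim A < ereal t"
  then have "0 < ereal t" using hausdorff_dim_nonneg[of A] by (rule order_le_less_trans[rotated])
  then have "0 < t" by simp
  then show "0 \<le> t \<and> hausdorff_measure t (f ` A) = 0"
    using hausdorff_null_lipschitz_image[OF hausdorff_null_above_dim[OF t], of f L] assms by auto
qed

text \<open>Slopes in \<open>[-1, 1]\<close> only reach the kernel directions \<open>u\<close> with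
  \<open>\<bar>u $ 1\<bar> \<le> \<bar>u $ 2\<bar>\<close>; exchanging the coordinates reaches the
  others.\<close>

definition swap2 :: "real^2 \<Rightarrow> real^2" where
  "swap2 x = vector [x $ 2, x $ 1]"

lemma swap2_nth [simp]: "swap2 x $ 1 = x $ 2" "swap2 x $ 2 = x $ 1"
  by (simp_all add: swap2_def)

lemma swap2_swap2 [simp]: "swap2 (swap2 x) = x"
  by (simp add: vec_eq_iff forall_2)

lemma dist_swap2: "dist (swap2 x) (swap2 y) = dist x y"
  by (simp add: dist_vec_def L2_set_def sum_2 add.commute)

lemma swap2_borel:
  assumes "A \<in> sets borel"
  shows "swap2 ` A \<in> sets borel"
proof -
  have "continuous_on UNIV swap2"
    by (rule continuous_onI) (auto simp: dist_swap2 intro: exI less_imp_le)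
  then have "swap2 -` A \<inter> space borel \<in> sets borel"
    using assms by (intro measurable_sets[of swap2 borel borel]) (auto intro: borel_measurable_continuous_onI)
  moreover have "swap2 ` A = swap2 -` A"
    by (metis (no_types, lifting) bij_image_Collect_eq inj_imp_bij_betw_inv subset_antisym image_subsetI vimageI2 subsetI swap2_swap2 image_eqI vimageD)
  ultimately show ?thesis by simp
qed

definition bad_slopes :: "real \<Rightarrow> (real^2) set \<Rightarrow> real set" where
  "bad_slopes t A = {b\<in>{-1..1}. hausdorff_measure t (lproj b ` A) = 0}"

lemma lproj_lipschitz:
  assumes "b \<in> {-1..1}"
  shows "dist (lproj b x) (lproj b y) \<le> 2 * dist x y"
proof -
  have "\<bar>lproj b (x - y)\<bar> \<le> \<bar>(x - y) $ 1\<bar> + \<bar>b\<bar> * \<bar>(x - y) $ 2\<bar>"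
    unfolding lproj_def by (simp add: abs_mult[symmetric])
  also have "\<dots> \<le> norm (x - y) + 1 * norm (x - y)"
    using assms by (intro add_mono mult_mono component_le_norm_cart) (auto simp: abs_le_iff)
  finally show ?thesis by (simp add: dist_norm lproj_diff)
qed

text \<open>The kernel of \<open>norm_proj N v\<close> is spanned by the point \<open>u\<close> where \<open>v\<close> supports the unit ball. Up to the
  symmetry \<open>swap2\<close> it is also the kernel of some \<open>lproj b\<close> with slope \<open>b\<close> in \<open>[-1, 1]\<close>, and \<open>v\<close> is recovered from
  \<open>b\<close> by the normalized gradient, which is a Lipschitz map.\<close>

lemma exceptional_directions_null:
  fixes N :: "real^2 \<Rightarrow> real" and A :: "(real^2) set"
  assumes N: "is_norm N" and C2: "C_k_on 2 N (UNIV - {0})"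
    and curv: "strictly_positive_curvature (frontier (unit_ball N))"
    and t: "0 < t" and tau: "0 < \<tau>"
    and bad: "hausdorff_measure \<tau> (bad_slopes t A) = 0" "hausdorff_measure \<tau> (bad_slopes t (swap2 ` A)) = 0"
  shows "hausdorff_measure \<tau> {v\<in>sphere 0 1. hausdorff_measure t (norm_proj N v ` A) = 0} = 0"
proof -
  let ?e1 = "axis 1 1 :: real^2" and ?e2 = "axis 2 1 :: real^2"
  have e: "?e1 \<in> Basis" "?e2 \<in> Basis" by (auto simp: axis_in_Basis_iff)
  define G where "G p q b = sgn (grad N (p + b *\<^sub>R q))" for p q :: "real^2" and b
  have null: "hausdorff_measure \<tau> (G p q ` B) = 0"
    if q: "q \<in> Basis" and nz: "\<And>b. p + b *\<^sub>R q \<noteq> 0" and B: "hausdorff_measure \<tau> B = 0" "B \<subseteq> {-1..1}" for p q B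
  proof -
    obtain L where L: "0 < L" "\<And>a b. a \<in> {-1..1} \<Longrightarrow> b \<in> {-1..1} \<Longrightarrow> dist (G p q a) (G p q b) \<le> L * dist a b"
      unfolding G_def by (rule sgn_grad_lipschitz[OF N C2 q nz]) blast
    show ?thesis
      by (rule hausdorff_null_lipschitz_image[OF B(1) tau _ L(1)]) (use L(2) B(2) in blast)
  qed
  have bs: "bad_slopes t X \<subseteq> {-1..1}" for X by (auto simp: bad_slopes_def)
  define B where "B = bad_slopes t A"
  define B' where "B' = bad_slopes t (swap2 ` A)"
  have neg: "hausdorff_measure \<tau> (uminus ` X) = 0" "uminus ` X \<subseteq> {-1..1}"
    if "hausdorff_measure \<tau> X = 0" "X \<subseteq> {-1..1}" for X :: "real set"
    using that by (auto intro!: hausdorff_null_lipschitz_image[of \<tau> X uminus 1] tau simp: dist_minus subset_iff)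
  have nz: "?e2 + b *\<^sub>R ?e1 \<noteq> 0" "- ?e2 + b *\<^sub>R ?e1 \<noteq> 0" "?e1 + b *\<^sub>R ?e2 \<noteq> 0" "- ?e1 + b *\<^sub>R ?e2 \<noteq> 0" for b
    by (auto simp: vec_eq_iff forall_2 axis_def)
  \<comment> \<open>The four pieces correspond to the sides of the square
    \<open>[-1, 1] \<times> [-1, 1]\<close>, onto one of which \<open>u\<close> is rescaled.\<close>
  let ?S = "(G ?e2 ?e1 ` (uminus ` B) \<union> G (- ?e2) ?e1 ` B) \<union> (G ?e1 ?e2 ` (uminus ` B') \<union> G (- ?e1) ?e2 ` B')"
  have Snull: "hausdorff_measure \<tau> ?S = 0"
    using bad bs neg unfolding B_def B'_def
    by (intro hausdorff_null_Un[OF tau] null e nz) blast+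
  have "{v\<in>sphere 0 1. hausdorff_measure t (norm_proj N v ` A) = 0} \<subseteq> ?S"
  proof
    fix v assume v: "v \<in> {v\<in>sphere 0 1. hausdorff_measure t (norm_proj N v ` A) = 0}"
    then have nv: "norm v = 1" and hv: "hausdorff_measure t (norm_proj N v ` A) = 0" by auto
    obtain u where u: "norm u = 1" and P: "\<And>x. norm_proj N v x = x - (v \<bullet> x / (v \<bullet> u)) *\<^sub>R u"
        and scaled: "\<And>c. 0 < c \<Longrightarrow> v = sgn (grad N (c *\<^sub>R u))"
      using norm_proj_formula[OF N C2 curv nv] by blast
    have u0: "u \<noteq> 0" using u by auto
    have slope: "b \<in> bad_slopes t (h ` A)"
      if b: "\<bar>b\<bar> \<le> 1" and h: "\<And>x y. dist (h x) (h y) = dist x y" and eq: "\<And>x. lproj b (h (norm_proj N v x)) = lproj b (h x)" for b h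
    proof -
      have bI: "b \<in> {-1..1}" using b by (simp add: abs_le_iff)
      have "lproj b ` h ` A = (\<lambda>x. lproj b (h x)) ` norm_proj N v ` A" by (simp add: image_image eq)
      moreover have "dist (lproj b (h x)) (lproj b (h y)) \<le> 2 * dist x y" for x y
        using lproj_lipschitz[OF bI, of "h x" "h y"] by (simp add: h)
      ultimately show ?thesis
        using hausdorff_null_lipschitz_image[OF hv t, of "\<lambda>x. lproj b (h x)" 2] bI by (simp add: bad_slopes_def)
    qed
    show "v \<in> ?S"
    proof (cases "\<bar>u $ 1\<bar> \<le> \<bar>u $ 2\<bar>")
      case True
      have u2: "u $ 2 \<noteq> 0" using True u0 by (auto simp: vec_eq_iff forall_2)
      \<comment> \<open>This slope makes \<open>lproj b u\<close> vanish, so both projections have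
        the same kernel.\<close>
      define b where "b = - u $ 1 / u $ 2"
      have "lproj b ((\<lambda>x. x) (norm_proj N v x)) = lproj b x" for x using u2 by (simp add: P lproj_def b_def field_simps)
      then have bB: "b \<in> B" using slope[of b "\<lambda>x. x"] True u2 by (simp add: B_def b_def abs_divide)
      have vu: "v = sgn (grad N ((1 / \<bar>u $ 2\<bar>) *\<^sub>R u))" using u2 by (intro scaled) simp
      show ?thesis
      proof (cases "0 < u $ 2")
        case True
        have "(1 / \<bar>u $ 2\<bar>) *\<^sub>R u = ?e2 + (- b) *\<^sub>R ?e1"
          using True by (simp add: vec_eq_iff forall_2 axis_def b_def)
        then have "v = G ?e2 ?e1 (- b)" using vu by (simp only: G_def)
        then show ?thesis using bB by blast
      next
        case False
        have "(1 / \<bar>u $ 2\<bar>) *\<^sub>R u = - ?e2 + b *\<^sub>R ?e1"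
          using False u2 by (simp add: vec_eq_iff forall_2 axis_def b_def)
        then have "v = G (- ?e2) ?e1 b" using vu by (simp only: G_def)
        then show ?thesis using bB by blast
      qed
    next
      case False
      then have u1: "u $ 1 \<noteq> 0" by auto
      define b where "b = - u $ 2 / u $ 1"
      have "lproj b (swap2 (norm_proj N v x)) = lproj b (swap2 x)" for x using u1 by (simp add: P lproj_def b_def field_simps)
      then have bB: "b \<in> B'" using slope[of b swap2] False u1 by (simp add: B'_def b_def abs_divide dist_swap2)
      have vu: "v = sgn (grad N ((1 / \<bar>u $ 1\<bar>) *\<^sub>R u))" using u1 by (intro scaled) simp
      show ?thesis
      proof (cases "0 < u $ 1")
        case True
        have "(1 / \<bar>u $ 1\<bar>) *\<^sub>R u = ?e1 + (- b) *\<^sub>R ?e2"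
          using True by (simp add: vec_eq_iff forall_2 axis_def b_def)
        then have "v = G ?e1 ?e2 (- b)" using vu by (simp only: G_def)
        then show ?thesis using bB by blast
      next
        case False
        have "(1 / \<bar>u $ 1\<bar>) *\<^sub>R u = - ?e1 + b *\<^sub>R ?e2"
          using False u1 by (simp add: vec_eq_iff forall_2 axis_def b_def)
        then have "v = G (- ?e1) ?e2 b" using vu by (simp only: G_def)
        then show ?thesis using bB by blast
      qed
    qed
  qed
  then show ?thesis by (rule hausdorff_null_subset[OF Snull _ tau])
qed

text \<open>The projection is linear, hence Lipschitz. A change of dimension under projection can
  therefore only be a drop.\<close>

lemma hausdorff_dim_norm_proj_le:
  fixes N :: "real^2 \<Rightarrow> real"
  assumes N: "is_norm N" and C2: "C_k_on 2 N (UNIV - {0})"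
    and curv: "strictly_positive_curvature (frontier (unit_ball N))" and v: "norm v = 1"
  shows "hausdorff_dim (norm_proj N v ` A) \<le> hausdorff_dim A"
proof -
  obtain u where u: "norm u = 1" and vu: "0 < v \<bullet> u" and P: "\<And>x. norm_proj N v x = x - (v \<bullet> x / (v \<bullet> u)) *\<^sub>R u"
    using norm_proj_formula[OF N C2 curv v] by blast
  show ?thesis
  proof (rule hausdorff_dim_lipschitz_image)
    show "0 < 1 + 1 / (v \<bullet> u)" using vu by (simp add: add_pos_pos)
    fix x y
    have "norm_proj N v x - norm_proj N v y = (x - y) - (v \<bullet> (x - y) / (v \<bullet> u)) *\<^sub>R u"
      by (simp add: P inner_diff_right diff_divide_distrib scaleR_diff_left)
    then have "norm (norm_proj N v x - norm_proj N v y) \<le> norm (x - y) + norm ((v \<bullet> (x - y) / (v \<bullet> u)) *\<^sub>R u)"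
      by (metis norm_triangle_ineq4)
    also have "norm ((v \<bullet> (x - y) / (v \<bullet> u)) *\<^sub>R u) = \<bar>v \<bullet> (x - y)\<bar> / (v \<bullet> u)"
      using vu u by simp
    also have "\<dots> \<le> norm (x - y) / (v \<bullet> u)"
      using Cauchy_Schwarz_ineq2[of v "x - y"] v vu by (intro divide_right_mono) auto
    finally show "dist (norm_proj N v x) (norm_proj N v y) \<le> (1 + 1 / (v \<bullet> u)) * dist x y"
      by (simp add: dist_norm distrib_right)
  qed
qed

theorem theorem1p1:
  fixes N :: "real^2 \<Rightarrow> real" and \<delta> :: real and A :: "(real^2) set" and s :: ereal
  assumes "is_norm N"
    and "0 < \<delta>" and "\<delta> \<le> 1"
    and "C_k_holder_on 2 \<delta> N (UNIV - {0})"
    and "strictly_positive_curvature (frontier (unit_ball N))"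
    and "A \<in> sets borel"
    and "s = hausdorff_dim A"
  shows "(1 < s \<longrightarrow>
            hausdorff_ae 1 (sphere 0 1) (\<lambda>v. 0 < hausdorff_measure 1 (norm_proj N v ` A)) \<and>
            hausdorff_dim {v \<in> sphere 0 1. hausdorff_measure 1 (norm_proj N v ` A) = 0}
              \<le> 2 - min s (1 + ereal \<delta>)) \<and>
         (s \<le> 1 \<longrightarrow>
            hausdorff_ae 1 (sphere 0 1) (\<lambda>v. hausdorff_dim (norm_proj N v ` A) = hausdorff_dim A) \<and>
            hausdorff_dim {v \<in> sphere 0 1. hausdorff_dim (norm_proj N v ` A) < s} \<le> s)"
proof -
  have N: "is_norm N" by fact
  have C2: "C_k_on 2 N (UNIV - {0})" using assms(4) by (simp add: C_k_holder_on_def)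
  have curv: "strictly_positive_curvature (frontier (unit_ball N))" by fact
  define Bad where "Bad t = {v\<in>sphere 0 1. hausdorff_measure t (norm_proj N v ` A) = 0}" for t
  have swapA: "swap2 ` A \<in> sets borel" by (rule swap2_borel) fact
  have nonnull: "hausdorff_measure r A \<noteq> 0" "hausdorff_measure r (swap2 ` A) \<noteq> 0" if r: "0 < r" "ereal r < s" for r
  proof -
    show A: "hausdorff_measure r A \<noteq> 0" using r assms(7) by (intro hausdorff_nonnull_below_dim) auto
    show "hausdorff_measure r (swap2 ` A) \<noteq> 0"
    proof
      assume "hausdorff_measure r (swap2 ` A) = 0"
      then have "hausdorff_measure r (swap2 ` swap2 ` A) = 0"
        by (rule hausdorff_null_lipschitz_image[where L = 1]) (use r in \<open>auto simp: dist_swap2\<close>)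
      then show False using A by (simp add: image_image)
    qed
  qed
  \<comment> \<open>The minimum is at most \<open>s\<close>, so \<open>2 - \<tau> < s\<close>, and
    it is at most 2 because \<open>\<delta> \<le> 1\<close>, so \<open>0 < \<tau>\<close>. An
    exponent \<open>r\<close> between \<open>max (2 - \<tau>) 1\<close> and \<open>s\<close> keeps
    \<open>A\<close> non-null and gives \<open>2 < \<tau> + r\<close>.\<close>
  have falconer: "hausdorff_measure \<tau> (Bad 1) = 0" if s1: "1 < s" and tau: "2 - min s (1 + ereal \<delta>) < ereal \<tau>" for \<tau>
  proof -
    have "ereal (2 - \<tau>) < min s (1 + ereal \<delta>)"
      using tau by (cases s) (auto simp: min_def split: if_splits simp flip: one_ereal_def)
    moreover have tau0: "0 < \<tau>"
      using tau assms(3) by (cases s) (auto simp: min_def split: if_splits simp flip: one_ereal_def)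
    ultimately have "max (ereal (2 - \<tau>)) 1 < s" using s1 by simp
    then obtain r where r: "max (ereal (2 - \<tau>)) 1 < ereal r" "ereal r < s" using ereal_dense2 by blast
    then have r1: "1 < r" "2 < \<tau> + r" by auto
    show ?thesis unfolding Bad_def
    proof (rule exceptional_directions_null[OF N C2 curv _ tau0])
      show "hausdorff_measure \<tau> (bad_slopes 1 A) = 0"
        unfolding bad_slopes_def using r r1 tau0 nonnull assms(6) by (intro falconer_slopes[where s = r]) auto
      show "hausdorff_measure \<tau> (bad_slopes 1 (swap2 ` A)) = 0"
        unfolding bad_slopes_def using r r1 tau0 nonnull swapA by (intro falconer_slopes[where s = r]) auto
    qed simp
  qed
  \<comment> \<open>Kaufman's estimate needs three distinct exponents \<open>t < q < r\<close> below
    \<open>s\<close>; the null set is then raised from \<open>q\<close> to \<open>\<tau>\<close>.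
    This includes the borderline case in which \<open>\<tau>\<close> equals
    \<open>s\<close>.\<close>
  have kaufman: "hausdorff_measure \<tau> (Bad t) = 0" if t: "0 < t" "ereal t < s" and tau: "s \<le> ereal \<tau>" for t \<tau>
  proof -
    obtain q where q: "ereal t < ereal q" "ereal q < s" using ereal_dense2[OF t(2)] by blast
    obtain r where r: "ereal q < ereal r" "ereal r < s" using ereal_dense2[OF q(2)] by blast
    have "hausdorff_measure q (Bad t) = 0" unfolding Bad_def
    proof (rule exceptional_directions_null[OF N C2 curv t(1)])
      show "hausdorff_measure q (bad_slopes t A) = 0"
        unfolding bad_slopes_def using q r t nonnull assms(6) by (intro kaufman_slopes[where s = r]) auto
      show "hausdorff_measure q (bad_slopes t (swap2 ` A)) = 0"
        unfolding bad_slopes_def using q r t nonnull swapA by (intro kaufman_slopes[where s = r]) auto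
    qed (use q t in auto)
    moreover have "q < \<tau>" using q(2) tau by (metis ereal_less_eq(3) less_le_trans not_le)
    ultimately show ?thesis using q t by (intro hausdorff_null_exponent_mono[of q "Bad t" \<tau>]) auto
  qed
  define D where "D = {v\<in>sphere 0 1. hausdorff_dim (norm_proj N v ` A) < s}"
  have D_null: "hausdorff_measure \<tau> D = 0" if tau: "s \<le> ereal \<tau>" "0 < \<tau>" for \<tau>
  proof -
    \<comment> \<open>The exponent at which the projection becomes null depends on \<open>v\<close>.
      Rational exponents suffice, so that \<open>D\<close> is covered by countably many null
      sets.\<close>
    define E where "E n = (let t = real_of_rat (nat_to_rat_surj n) in if 0 < t \<and> ereal t < s then Bad t else {})" for n
    have "hausdorff_measure \<tau> ({} :: (real^2) set) = 0"
      unfolding hausdorff_null_iff[OF tau(2)] by (auto intro!: exI[of _ "\<lambda>_. {}"] simp: diam_power_def)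
    then have "hausdorff_measure \<tau> (E n) = 0" for n
      using kaufman[OF _ _ tau(1)] by (auto simp: E_def Let_def)
    then have "hausdorff_measure \<tau> (\<Union>n. E n) = 0" by (rule hausdorff_null_UN[OF tau(2)])
    moreover have "D \<subseteq> (\<Union>n. E n)"
    proof
      fix v assume v: "v \<in> D"
      then obtain t where t: "hausdorff_dim (norm_proj N v ` A) < ereal t" "ereal t < s"
        using ereal_dense2 unfolding D_def by blast
      obtain t' where t': "ereal t < ereal t'" "ereal t' < s" using ereal_dense2[OF t(2)] by blast
      then obtain r where r: "t < real_of_rat r" "real_of_rat r < t'" using of_rat_dense[of t t'] by auto
      have "0 < ereal t" using hausdorff_dim_nonneg t(1) by (rule order_le_less_trans)
      then have r0: "0 < real_of_rat r" using r(1) by (simp del: zero_less_of_rat_iff)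
      have rs: "ereal (real_of_rat r) < s" using r(2) t'(2) by (metis ereal_less_eq(3) less_le_trans not_le order_less_imp_le)
      have "hausdorff_dim (norm_proj N v ` A) < ereal (real_of_rat r)" using t(1) r(1) by (metis ereal_less_eq(3) less_le_trans less_imp_le)
      then have "v \<in> Bad (real_of_rat r)" using v hausdorff_null_above_dim unfolding D_def Bad_def by blast
      moreover obtain n where "r = nat_to_rat_surj n" using surj_nat_to_rat_surj by (metis surjD)
      ultimately have "v \<in> E n" using r0 rs by (simp add: E_def Let_def)
      then show "v \<in> (\<Union>n. E n)" by blast
    qed
    ultimately show ?thesis using tau(2) by (rule hausdorff_null_subset)
  qed
  show ?thesis
  proof (intro conjI impI)
    assume s1: "1 < s"
    have "2 - min s (1 + ereal \<delta>) < ereal 1"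
      using s1 assms(2) by (cases s) (auto simp: min_def simp flip: one_ereal_def)
    then have "hausdorff_measure 1 (Bad 1) = 0" by (rule falconer[OF s1])
    moreover have "{v \<in> sphere 0 1. \<not> 0 < hausdorff_measure 1 (norm_proj N v ` A)} = Bad 1"
      by (auto simp: Bad_def)
    ultimately show "hausdorff_ae 1 (sphere 0 1) (\<lambda>v. 0 < hausdorff_measure 1 (norm_proj N v ` A))"
      by (simp add: hausdorff_ae_def)
    have "hausdorff_dim (Bad 1) \<le> 2 - min s (1 + ereal \<delta>)"
    proof (rule hausdorff_dim_le)
      fix \<tau> assume tau: "2 - min s (1 + ereal \<delta>) < ereal \<tau>"
      have "0 \<le> \<tau>"
        using tau assms(3) by (cases s) (auto simp: min_def split: if_splits simp flip: one_ereal_def)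
      then show "0 \<le> \<tau> \<and> hausdorff_measure \<tau> (Bad 1) = 0" using falconer[OF s1 tau] by blast
    qed
    then show "hausdorff_dim {v \<in> sphere 0 1. hausdorff_measure 1 (norm_proj N v ` A) = 0} \<le> 2 - min s (1 + ereal \<delta>)"
      by (simp add: Bad_def)
  next
    assume s1: "s \<le> 1"
    have "hausdorff_measure 1 D = 0" using s1 by (intro D_null) (simp_all add: one_ereal_def)
    moreover have "{v \<in> sphere 0 1. \<not> hausdorff_dim (norm_proj N v ` A) = hausdorff_dim A} = D"
      using hausdorff_dim_norm_proj_le[OF N C2 curv, of _ A] by (auto simp: D_def assms(7) less_le)
    ultimately show "hausdorff_ae 1 (sphere 0 1) (\<lambda>v. hausdorff_dim (norm_proj N v ` A) = hausdorff_dim A)"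
      by (simp add: hausdorff_ae_def)
    have "hausdorff_dim D \<le> s"
    proof (rule hausdorff_dim_le)
      fix \<tau> assume tau: "s < ereal \<tau>"
      then have "0 < ereal \<tau>" using hausdorff_dim_nonneg[of A] assms(7) by (metis order_le_less_trans)
      then show "0 \<le> \<tau> \<and> hausdorff_measure \<tau> D = 0" using D_null[of \<tau>] tau by auto
    qed
    then show "hausdorff_dim {v \<in> sphere 0 1. hausdorff_dim (norm_proj N v ` A) < s} \<le> s" by (simp add: D_def)
  qed
qed

end
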